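(* Let $a,b,c\in\mathbb R$ satisfy $a,b>-1$, $0<c-a-b-2<1$, $0\le 2-c+b<1$, $a<0$ and $c>1$. Then the following hold. (i) $S_{a,b,c}$ is unbounded from $L^{\frac{1}{2-c+b}}(\mathbb D)$ to $L^{-\frac1a,\infty}(\mathbb D)$. (ii) If $0\le 2-c+b<1/2$, then $T_{a,b,c}$ is unbounded from $L^{\frac{1}{2-c+b}}(\mathbb D)$ to $L^{-\frac1a,\infty}(\mathbb D)$. (iii) If $1/2\le 2-c+b<1$, then $T_{a,b,c}$ is bounded from $L^{\frac{1}{2-c+b}}(\mathbb D)$ to $L^{-\frac1a,\infty}(\mathbb D)$. Here, in the borderline case $2-c+b=0$, the space $L^{\frac{1}{2-c+b}}(\mathbb D)$ is understood as $L^\infty(\mathbb D)$.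
   Context: $\mathbb D$ is the open unit disc in $\mathbb C$, $dA$ is normalized area measure on $\mathbb D$, and $|E|$ is the $dA$-measure of $E\subseteq\mathbb D$. For $a,b,c\in\mathbb R$, $$T_{a,b,c}f(z):=(1-|z|^2)^a\int_{\mathbb D}\frac{(1-|w|^2)^b}{(1-z\overline w)^c}f(w)\,dA(w),\qquad S_{a,b,c}f(z):=(1-|z|^2)^a\int_{\mathbb D}\frac{(1-|w|^2)^b}{|1-z\overline w|^c}f(w)\,dA(w),$$ with the principal branch of the power. $L^p(\mathbb D)=L^p(\mathbb D,dA)$. For $1\le q<\infty$, $\|f\|_{L^{q,\infty}}=\sup_{\lambda>0}\lambda|\{z\in\mathbb D:|f(z)|>\lambda\}|^{1/q}$. An operator $\mathcal T$ is bounded from $X$ to $Y$ if for every $f\in X$ the defining integral converges absolutely for a.e. $z$ and $\|\mathcal Tf\|_Y\le C\|f\|_X$ with $C$ independent of $f$; otherwise it is unbounded from $X$ to $Y$. *)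

theory Defs
  imports "HOL-Analysis.Analysis" "HOL-Probability.Essential_Supremum"
begin

abbreviation unit_disc :: "complex set" where
  "unit_disc \<equiv> ball 0 1"

definition dA :: "complex measure" where
  "dA = density (lebesgue_on unit_disc) (\<lambda>_. ennreal (1 / pi))"

lemma space_dA [simp]: "space dA = unit_disc"
  by (simp add: dA_def)

lemma sets_dA: "sets dA = sets (lebesgue_on unit_disc)"
  by (simp add: dA_def)

lemma emeasure_dA_unit_disc: "emeasure dA unit_disc = 1"
proof -
  have "emeasure lborel (unit_disc :: complex set) = ennreal pi"
    by (simp add: emeasure_ball unit_ball_vol_2)
  then have "emeasure (lebesgue_on unit_disc) unit_disc = ennreal pi"
    by (simp add: emeasure_restrict_space)
  then show ?thesis
    by (simp add: dA_def emeasure_density_const ennreal_mult[symmetric] del: ennreal_1)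
qed

text \<open>
  Exponents of Lebesgue spaces are extended reals in \<open>[1, \<infinity>]\<close>. In \<^typ>\<open>ereal\<close> one has
  \<open>1 / 0 = \<infinity>\<close>, so \<open>1 / ereal s\<close> is the exponent \<open>1/s\<close>, with the
  convention that \<open>s = 0\<close> stands for the exponent \<open>\<infinity>\<close>.
\<close>

lemma one_divide_ereal: "1 / ereal s = (if s = 0 then \<infinity> else ereal (1 / s))"
  by (simp add: divide_ereal_def inverse_eq_divide)

definition Lp_space :: "ereal \<Rightarrow> (complex \<Rightarrow> complex) set" where
  "Lp_space p = {f \<in> borel_measurable dA.
     if p = \<infinity> then esssup dA (\<lambda>z. ennreal (cmod (f z))) < \<infinity>
     else integrable dA (\<lambda>z. cmod (f z) powr real_of_ereal p)}"

definition Lp_norm :: "ereal \<Rightarrow> (complex \<Rightarrow> complex) \<Rightarrow> real" where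
  "Lp_norm p f =
     (if p = \<infinity> then enn2real (esssup dA (\<lambda>z. ennreal (cmod (f z))))
      else (LINT z|dA. cmod (f z) powr real_of_ereal p) powr (1 / real_of_ereal p))"

definition weak_Lq_norm :: "real \<Rightarrow> (complex \<Rightarrow> complex) \<Rightarrow> ennreal" where
  "weak_Lq_norm q g =
     (SUP t\<in>{0<..}. ennreal (t * measure dA {z \<in> unit_disc. cmod (g z) > t} powr (1 / q)))"

definition weighted_int_op ::
    "real \<Rightarrow> (complex \<Rightarrow> complex \<Rightarrow> complex) \<Rightarrow> (complex \<Rightarrow> complex) \<Rightarrow> complex \<Rightarrow> complex" where
  "weighted_int_op a K f z = of_real ((1 - (cmod z)\<^sup>2) powr a) * (LINT w|dA. K z w * f w)"

definition T_kernel :: "real \<Rightarrow> real \<Rightarrow> complex \<Rightarrow> complex \<Rightarrow> complex" where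
  "T_kernel b c z w = of_real ((1 - (cmod w)\<^sup>2) powr b) / (1 - z * cnj w) powr of_real c"

definition S_kernel :: "real \<Rightarrow> real \<Rightarrow> complex \<Rightarrow> complex \<Rightarrow> complex" where
  "S_kernel b c z w = of_real ((1 - (cmod w)\<^sup>2) powr b / cmod (1 - z * cnj w) powr c)"

text \<open>
  Boundedness of \<open>weighted_int_op a K\<close> from \<open>L\<^sup>p\<close> to weak \<open>L\<^sup>q\<close>. It is a predicate on the weight and
  the kernel, not on the operator as a bare map, because absolute convergence of the defining
  integral is part of it: the Bochner integral of a non-integrable function is \<open>0\<close>.
\<close>

definition bounded_Lp_weak_Lq ::
    "real \<Rightarrow> (complex \<Rightarrow> complex \<Rightarrow> complex) \<Rightarrow> ereal \<Rightarrow> real \<Rightarrow> bool" where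
  "bounded_Lp_weak_Lq a K p q \<longleftrightarrow>
     (\<exists>C::real. \<forall>f\<in>Lp_space p.
        (AE z in dA. integrable dA (\<lambda>w. K z w * f w)) \<and>
        weighted_int_op a K f \<in> borel_measurable dA \<and>
        weak_Lq_norm q (weighted_int_op a K f) \<le> ennreal (C * Lp_norm p f))"

definition T_bounded :: "real \<Rightarrow> real \<Rightarrow> real \<Rightarrow> ereal \<Rightarrow> real \<Rightarrow> bool" where
  "T_bounded a b c p q \<longleftrightarrow> bounded_Lp_weak_Lq a (T_kernel b c) p q"

definition S_bounded :: "real \<Rightarrow> real \<Rightarrow> real \<Rightarrow> ereal \<Rightarrow> real \<Rightarrow> bool" where
  "S_bounded a b c p q \<longleftrightarrow> bounded_Lp_weak_Lq a (S_kernel b c) p q"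

end

theory Submission
  imports Defs "HOL-Analysis.Simplex_Content" "HOL-Computational_Algebra.Polynomial"
begin

text \<open>
  Put \<open>s = 2 - c + b\<close>, \<open>p = 1 / s\<close> and \<open>\<rho> w = 1 - |w|\<^sup>2\<close>, and write the operator as \<open>\<rho>\<^sup>a F\<close> with
  \<open>F z = \<integral> g w (1 - z w\<^sup>*)\<^sup>-\<^sup>c dA(w)\<close>, \<open>g = \<rho>\<^sup>b f\<close>.

  For \<open>1/2 \<le> s\<close>, i.e. \<open>p \<le> 2\<close>, the means of \<open>F\<close> over annuli are controlled: \<open>f\<close> being in \<open>L\<^sup>p\<close>
  means that \<open>\<rho>\<^sup>s f\<close> is in \<open>L\<^sup>p(dA / \<rho>)\<close>, and in this scale the map to \<open>F\<close> is independent of \<open>s\<close>. It is of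
  strong type \<open>(1, 1)\<close> by the growth of the mean of \<open>|1 - z w\<^sup>*|\<^sup>-\<^sup>c\<close>, and of strong type \<open>(2, 2)\<close> by
  Bessel's inequality; interpolation gives weak type \<open>(p, p)\<close>. Because \<open>- a p > 1\<close>, the weak
  bounds on dyadic annuli sum up, and no maximal function is needed. All constants come from
  Taylor coefficients and the logarithmic convexity of the Gamma function.

  For \<open>s < 1/2\<close> there are \<open>f\<close> with \<open>|f| \<le> M \<rho>\<^sup>-\<^sup>s\<close> supported in \<open>\<rho> > 4\<^sup>-\<^sup>N / 4\<close>, hence of \<open>L\<^sup>p\<close> norm \<open>O(N\<^sup>s)\<close>, for
  which \<open>F\<close> is the lacunary polynomial \<open>\<Sum>k<N. z ^ (4 ^ k)\<close>. Near the boundary it has size \<open>\<surd>N\<close> on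
  a fixed proportion of each circle, and the weight \<open>\<rho>\<^sup>a\<close> detects this in weak \<open>L\<^sup>q\<close>,
  \<open>q = - 1 / a\<close>. For the positive kernel the function \<open>\<rho>\<^sup>-\<^sup>s\<close>, cut off at the same height,
  gives size \<open>N\<close> instead of \<open>\<surd>N\<close>, which contradicts boundedness for all \<open>s < 1\<close>.
\<close>

subsection \<open>Rotation invariance and the radial distribution of area measure\<close>

abbreviation rho :: "complex \<Rightarrow> real" where
  "rho w \<equiv> 1 - (cmod w)\<^sup>2"

section \<open>Rotation invariance of Lebesgue measure on the plane, by passing to
  \<open>real ^ 2\<close>\<close>

definition plane_complex :: "real ^ 2 \<Rightarrow> complex" where
  "plane_complex v = Complex (v $ 1) (v $ 2)"

lemma linear_plane_complex: "linear plane_complex"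
  by (rule linearI) (auto simp: plane_complex_def complex_eq_iff)

text \<open>Lebesgue measure is determined by its values on boxes, and pulling a box back to
  \<open>real ^ 2\<close> keeps its side lengths.\<close>

lemma distr_plane_complex: "distr lborel borel plane_complex = lborel"
proof (rule lborel_eqI[symmetric])
  fix l u :: complex assume le: "\<And>b. b \<in> Basis \<Longrightarrow> l \<bullet> b \<le> u \<bullet> b"
  have [measurable]: "plane_complex \<in> borel_measurable borel"
    by (intro borel_measurable_continuous_onI linear_continuous_on linear_plane_complex[unfolded linear_conv_bounded_linear])
  let ?l = "vector [Re l, Im l] :: real ^ 2" and ?u = "vector [Re u, Im u] :: real ^ 2"
  have "plane_complex -` box l u = box ?l ?u"
    by (auto simp: mem_box_cart in_box_complex_iff plane_complex_def forall_2)
  moreover have "\<And>b. b \<in> Basis \<Longrightarrow> ?l \<bullet> b \<le> ?u \<bullet> b"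
    using le[of 1] le[of \<i>] by (auto simp: Basis_vec_def Basis_complex_def inner_axis forall_2 UNIV_2)
  moreover have "(\<Prod>b\<in>Basis. (?u - ?l) \<bullet> b) = (\<Prod>b\<in>Basis. (u - l) \<bullet> b)"
  proof -
    have B: "(Basis :: (real ^ 2) set) = {axis 1 1, axis 2 1}"
      by (auto simp: Basis_vec_def UNIV_2)
    have "axis 1 1 \<noteq> (axis 2 1 :: real ^ 2)"
      by (simp add: axis_eq_axis)
    then show ?thesis
      unfolding B Basis_complex_def by (simp add: inner_axis)
  qed
  ultimately show "emeasure (distr lborel borel plane_complex) (box l u) = (\<Prod>b\<in>Basis. (u - l) \<bullet> b)"
    by (simp add: emeasure_distr emeasure_lborel_box)
qed simp

lemma det_rotation:
  fixes u :: complex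
  shows "det (matrix (\<lambda>v::real^2. vector [Re u * v $ 1 - Im u * v $ 2, Im u * v $ 1 + Re u * v $ 2])) = (cmod u)\<^sup>2"
  by (simp add: det_2 matrix_def axis_def cmod_power2[unfolded power2_eq_square] power2_eq_square)

text \<open>Again boxes suffice. The preimage of a box is a rotated box, whose measure comes from
  the determinant formula in \<open>real ^ 2\<close>; the determinant is
  \<open>(cmod u)\<^sup>2 = 1\<close>.\<close>

lemma lborel_distr_rotation:
  fixes u :: complex
  assumes u: "cmod u = 1"
  shows "distr lborel borel ((*) u) = lborel"
proof (rule lborel_eqI[symmetric])
  fix l r :: complex assume le: "\<And>b. b \<in> Basis \<Longrightarrow> l \<bullet> b \<le> r \<bullet> b"
  let ?v = "cnj u"
  define g :: "real^2 \<Rightarrow> real^2" where "g v = vector [Re ?v * v $ 1 - Im ?v * v $ 2, Im ?v * v $ 1 + Re ?v * v $ 2]" for v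
  have phig: "plane_complex (g x) = ?v * plane_complex x" for x
    by (simp add: plane_complex_def g_def complex_eq_iff)
  have uv: "u * ?v = 1" using u by (simp flip: complex_norm_square)
  have inv: "plane_complex (vector [Re z, Im z]) = z" "vector [Re (plane_complex v), Im (plane_complex v)] = v" for z v
    by (simp_all add: plane_complex_def vec_eq_iff forall_2)
  have bij: "bij plane_complex"
    by (rule bij_betw_byWitness[of _ "\<lambda>z. vector [Re z, Im z]"]) (use inv in auto)
  have lg: "linear g" by (rule linearI) (auto simp: g_def vec_eq_iff forall_2 algebra_simps)
  have [measurable]: "plane_complex \<in> borel_measurable borel"
    by (intro borel_measurable_continuous_onI linear_continuous_on linear_plane_complex[unfolded linear_conv_bounded_linear])
  define B where "B = plane_complex -` box l r"
  have Bb: "B \<in> sets borel" unfolding B_def using measurable_sets[of plane_complex borel borel "box l r"] by simp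
  have Bbox: "B = box (vector [Re l, Im l]) (vector [Re r, Im r])"
    by (auto simp: B_def mem_box_cart in_box_complex_iff plane_complex_def forall_2)
  \<comment> \<open>The preimage is rewritten as an image under the inverse rotation
    \<open>cnj u\<close>, because the determinant formula speaks of images.\<close>
  have pre: "(*) u -` box l r = (*) ?v ` box l r"
  proof (intro set_eqI iffI)
    fix x assume "x \<in> (*) u -` box l r"
    then show "x \<in> (*) ?v ` box l r" using uv by (intro image_eqI[of _ _ "u * x"]) (auto simp: mult.assoc[symmetric] mult.commute)
  next
    fix x assume "x \<in> (*) ?v ` box l r"
    then show "x \<in> (*) u -` box l r" using uv by (auto simp: mult.assoc[symmetric])
  qed
  have pre2: "plane_complex -` ((*) u -` box l r) = g ` B"
  proof -
    have "plane_complex ` (g ` B) = (*) ?v ` (plane_complex ` B)"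
      by (simp add: image_image phig)
    also have "plane_complex ` B = box l r"
      unfolding B_def using bij by (simp add: bij_is_surj surj_image_vimage_eq)
    finally have "plane_complex ` (g ` B) = (*) ?v ` box l r" .
    then show ?thesis unfolding pre using bij by (metis bij_is_inj inj_vimage_image_eq)
  qed
  have m: "(*) u -` box l r \<in> sets borel"
    using measurable_sets[of "(*) u" borel borel "box l r"] by simp
  have gB: "g ` B \<in> sets borel" unfolding pre2[symmetric] using measurable_sets[OF \<open>plane_complex \<in> _\<close> m] by simp
  have bd: "bounded B" unfolding Bbox by (rule bounded_box)
  have "bounded (g ` B)" using bd lg by (simp add: bounded_linear_image linear_conv_bounded_linear)
  then have fin: "emeasure lborel (g ` B) < \<infinity>" "emeasure lborel B < \<infinity>" using bd
    using emeasure_bounded_finite by (blast, blast)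
  have "measure lebesgue (g ` B) = \<bar>det (matrix g)\<bar> * measure lebesgue B"
    using bd lg Bb by (intro measure_lebesgue_linear_transformation) auto
  also have "det (matrix g) = 1" unfolding g_def using u det_rotation[of ?v] by simp
  finally have "measure lborel (g ` B) = measure lborel B"
    using Bb gB by (simp add: measure_completion)
  then have eq: "emeasure lborel (g ` B) = emeasure lborel B"
    using fin by (simp add: emeasure_eq_ennreal_measure)
  have "emeasure (distr lborel borel ((*) u)) (box l r) = emeasure lborel ((*) u -` box l r)"
    by (subst emeasure_distr) auto
  also have "\<dots> = emeasure (distr lborel borel plane_complex) ((*) u -` box l r)"
    by (simp add: distr_plane_complex)
  also have "\<dots> = emeasure lborel (g ` B)" using m by (subst emeasure_distr) (auto simp: pre2)
  also have "\<dots> = emeasure (distr lborel borel plane_complex) (box l r)"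
    unfolding eq by (subst emeasure_distr) (auto simp: B_def)
  also have "\<dots> = (\<Prod>b\<in>Basis. (r - l) \<bullet> b)"
    using le by (simp add: distr_plane_complex emeasure_lborel_box)
  finally show "emeasure (distr lborel borel ((*) u)) (box l r) = (\<Prod>b\<in>Basis. (r - l) \<bullet> b)" .
qed simp

section \<open>Normalized area measure: Borel sets, rotations, orthogonality, radial law\<close>

lemma unit_disc_borel [measurable, simp]: "unit_disc \<in> sets borel"
  by (intro borel_open open_ball)

lemma borel_measurable_cnj [measurable]: "cnj \<in> borel_measurable borel"
  by (intro borel_measurable_continuous_onI continuous_intros)

lemma rho_pos: "cmod w < 1 \<Longrightarrow> 0 < rho w"
  using power_strict_mono[of "cmod w" 1 2] by simp

lemma rho_le_1: "rho w \<le> 1"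
  by simp

lemma measurable_dA: "f \<in> borel \<rightarrow>\<^sub>M N \<Longrightarrow> f \<in> dA \<rightarrow>\<^sub>M N"
proof -
  assume f: "f \<in> borel \<rightarrow>\<^sub>M N"
  have "f \<in> lebesgue \<rightarrow>\<^sub>M N"
    using f by (simp add: measurable_completion)
  then have "f \<in> lebesgue_on unit_disc \<rightarrow>\<^sub>M N"
    by (rule measurable_restrict_space1)
  then show ?thesis by (simp add: dA_def)
qed

lemma measurable_id_dA: "(\<lambda>w. w) \<in> borel_measurable dA"
  by (rule measurable_dA) simp

interpretation dA: finite_measure dA
  by standard (simp add: emeasure_dA_unit_disc)

lemma sets_dA_rho [measurable]: "J \<in> sets borel \<Longrightarrow> {w \<in> unit_disc. rho w \<in> J} \<in> sets dA"
  using measurable_sets[OF measurable_dA[of rho borel], of J] by (simp add: vimage_def Int_def conj_commute)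

lemma emeasure_dA_borel:
  assumes "X \<in> sets borel" "X \<subseteq> unit_disc"
  shows "emeasure dA X = ennreal (1 / pi) * emeasure lborel X"
proof -
  have "X \<in> sets (lebesgue_on unit_disc)"
    using assms by (subst sets_restrict_space_iff) (simp_all add: sets_completionI_sets)
  then have "emeasure dA X = ennreal (1 / pi) * emeasure (lebesgue_on unit_disc) X"
    by (simp add: dA_def emeasure_density_const)
  also have "emeasure (lebesgue_on unit_disc) X = emeasure lebesgue X"
    by (rule emeasure_restrict_space) (use assms in simp_all)
  also have "\<dots> = emeasure lborel X"
    using assms by simp
  finally show ?thesis .
qed

text \<open>Pushing \<open>dA\<close> forward along the identity to the Borel sets strips off the
  completion, so that changes of variables for \<open>lborel\<close> apply.\<close>

lemma distr_dA_borel: "distr dA borel (\<lambda>w. w) = density lborel (\<lambda>w. ennreal (1 / pi) * indicator unit_disc w)"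
proof (rule measure_eqI)
  fix X assume "X \<in> sets (distr dA borel (\<lambda>w. w))"
  then have X [measurable]: "X \<in> sets borel" by simp
  have meas: "(\<lambda>w::complex. ennreal (1 / pi) * indicator unit_disc w) \<in> borel_measurable lborel"
    by (intro borel_measurable_times_ennreal borel_measurable_indicator borel_measurable_const) simp
  have "emeasure (distr dA borel (\<lambda>w. w)) X = emeasure dA (X \<inter> unit_disc)"
    by (subst emeasure_distr) (auto simp: measurable_id_dA)
  also have "\<dots> = ennreal (1 / pi) * emeasure lborel (X \<inter> unit_disc)"
    by (rule emeasure_dA_borel) auto
  also have "\<dots> = (\<integral>\<^sup>+ w. ennreal (1 / pi) * indicator (X \<inter> unit_disc) w \<partial>lborel)"
    by (simp add: nn_integral_cmult_indicator)
  also have "\<dots> = emeasure (density lborel (\<lambda>w. ennreal (1 / pi) * indicator unit_disc w)) X"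
    by (subst emeasure_density[OF meas]) (auto intro!: nn_integral_cong simp: indicator_def)
  finally show "emeasure (distr dA borel (\<lambda>w. w)) X = emeasure (density lborel (\<lambda>w. ennreal (1 / pi) * indicator unit_disc w)) X" .
qed simp

lemma distr_dA_rotation:
  assumes u: "cmod u = 1"
  shows "distr dA borel ((*) u) = distr dA borel (\<lambda>w. w)"
proof -
  let ?d = "\<lambda>w::complex. ennreal (1 / pi) * indicator unit_disc w"
  have "distr dA borel ((*) u) = distr (distr dA borel (\<lambda>w. w)) borel ((*) u)"
    by (subst distr_distr) (auto simp: measurable_id_dA comp_def)
  also have "\<dots> = distr (density lborel ?d) borel ((*) u)"
    by (simp add: distr_dA_borel)
  also have "\<dots> = distr (density lborel (\<lambda>w. ?d (u * w))) borel ((*) u)"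
    using u by (simp add: indicator_def norm_mult)
  also have "\<dots> = density (distr lborel borel ((*) u)) ?d"
    by (subst density_distr) auto
  also have "\<dots> = distr dA borel (\<lambda>w. w)"
    by (simp add: lborel_distr_rotation u distr_dA_borel)
  finally show ?thesis .
qed

lemma integral_dA_rotation:
  fixes h :: "complex \<Rightarrow> 'b::{banach, second_countable_topology}"
  assumes "cmod u = 1" and [measurable]: "h \<in> borel_measurable borel"
  shows "(LINT w|dA. h (u * w)) = (LINT w|dA. h w)"
proof -
  have "(LINT w|dA. h (u * w)) = (LINT w|distr dA borel ((*) u). h w)"
    by (subst integral_distr) (auto intro: measurable_dA)
  also have "\<dots> = (LINT w|dA. h w)"
    unfolding distr_dA_rotation[OF assms(1)]
    by (subst integral_distr) (auto intro: measurable_dA)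
  finally show ?thesis .
qed

text \<open>A rotation by \<open>u\<close> preserves \<open>dA\<close> and \<open>rho\<close> but
  multiplies the integral by \<open>u ^ n * cnj u ^ m\<close>. One \<open>u\<close> for which this
  factor is not 1 forces the integral to vanish.\<close>

lemma monomials_orthogonal:
  fixes \<phi> :: "real \<Rightarrow> real"
  assumes [measurable]: "\<phi> \<in> borel_measurable borel" and "n \<noteq> m"
  shows "(LINT w|dA. of_real (\<phi> (rho w)) * (w ^ n * cnj w ^ m)) = 0"
proof -
  define I where "I = (LINT w|dA. of_real (\<phi> (rho w)) * (w ^ n * cnj w ^ m))"
  \<comment> \<open>Since \<open>n \<noteq> m\<close>, the number n - m is nonzero and smaller in
    modulus than n + m + 1, so (n - m) times this angle lies strictly between -pi and pi and is not
    0.\<close>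
  define u where "u = cis (pi / (real n + real m + 1))"
  have u: "cmod u = 1" by (simp add: u_def)
  have uv: "u ^ n * cnj u ^ m \<noteq> 1"
  proof
    assume eq: "u ^ n * cnj u ^ m = 1"
    let ?D = "real n + real m + 1" and ?t = "pi / (real n + real m + 1)"
    have t: "?t > 0" "pi = ?t * ?D" by (auto simp: add_nonneg_pos)
    have "u ^ n * cnj u ^ m = cis (real n * ?t + real m * (- ?t))"
      unfolding u_def cis_cnj Complex.DeMoivre cis_mult ..
    then have "cis (real n * ?t - real m * ?t) = 1"
      unfolding eq by simp
    then obtain k :: int where "real n * ?t - real m * ?t = of_int k * (2 * pi)"
      unfolding complex_eq_iff cis.simps one_complex.simps cos_one_2pi_int by (auto simp only: mult_ac)
    then have "real n * ?t - real m * ?t = of_int k * (2 * (?t * ?D))"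
      unfolding t(2)[symmetric] .
    then have "(real n - real m - of_int k * 2 * ?D) * ?t = 0"
      by (simp only: algebra_simps)
    then have "real n - real m - of_int k * 2 * ?D = 0"
      using t(1) by (metis mult_eq_0_iff less_irrefl)
    then have "of_int (int n - int m) = (of_int (2 * k * (int n + int m + 1)) :: real)"
      by simp
    then have k: "int n - int m = 2 * k * (int n + int m + 1)"
      by (simp only: of_int_eq_iff)
    have "k = 0"
    proof (rule ccontr)
      assume "k \<noteq> 0"
      then have "1 * (int n + int m + 1) \<le> \<bar>2 * k\<bar> * (int n + int m + 1)"
        by (intro mult_right_mono) auto
      also have "\<dots> = \<bar>int n - int m\<bar>" unfolding k by (simp add: abs_mult)
      finally show False by simp
    qed
    with k \<open>n \<noteq> m\<close> show False by simp
  qed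
  have "I = (LINT w|dA. of_real (\<phi> (rho (u * w))) * ((u * w) ^ n * cnj (u * w) ^ m))"
    unfolding I_def by (rule integral_dA_rotation[symmetric, OF u]) measurable
  also have "\<dots> = (LINT w|dA. (u ^ n * cnj u ^ m) * (of_real (\<phi> (rho w)) * (w ^ n * cnj w ^ m)))"
    using u by (simp add: norm_mult power_mult_distrib mult_ac)
  also have "\<dots> = (u ^ n * cnj u ^ m) * I"
    by (simp add: I_def)
  finally have "(u ^ n * cnj u ^ m - 1) * I = 0" by (simp add: algebra_simps)
  then show ?thesis using uv by (simp add: I_def)
qed

text \<open>The set where \<open>rho\<close> exceeds x is a disc of radius
  \<open>sqrt (1 - x)\<close>, of normalized area 1 - x. So \<open>rho\<close> is uniformly
  distributed on [0, 1], and radial integrals become integrals over an interval.\<close>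

lemma distr_dA_rho: "distr dA borel rho = density lborel (indicator {0..1})"
proof (rule measure_eqI_lessThan)
  have [measurable]: "rho \<in> borel_measurable dA" by (rule measurable_dA) simp
  fix x :: real
  have L: "emeasure (distr dA borel rho) {x<..} = emeasure dA {w \<in> unit_disc. rho w > x}"
    by (subst emeasure_distr) (auto intro!: arg_cong[where f="emeasure dA"])
  have R: "emeasure (density lborel (indicator {0..1})) {x<..} = emeasure lborel ({0..1} \<inter> {x<..})"
    by (subst emeasure_density) (auto simp flip: indicator_inter_arith)
  show "emeasure (distr dA borel rho) {x<..} < \<infinity>"
    unfolding L using dA.emeasure_finite by (simp only: less_top infinity_ennreal_def)
  consider "x < 0" | "0 \<le> x" "x < 1" | "x \<ge> 1" by linarith
  then show "emeasure (distr dA borel rho) {x<..} = emeasure (density lborel (indicator {0..1})) {x<..}"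
  proof cases
    case 1
    then have "{w \<in> unit_disc. rho w > x} = unit_disc" "{0..1} \<inter> {x<..} = {0..1::real}"
        by (force dest: rho_pos)+
    then show ?thesis unfolding L R by (simp add: emeasure_dA_unit_disc)
  next
    case 2
    have "{w \<in> unit_disc. rho w > x} = ball 0 (sqrt (1 - x))"
    proof (intro set_eqI iffI)
      fix w assume "w \<in> {w \<in> unit_disc. rho w > x}"
      then show "w \<in> ball 0 (sqrt (1 - x))"
        by (auto intro!: real_less_rsqrt)
    next
      fix w :: complex assume w: "w \<in> ball 0 (sqrt (1 - x))"
      have "cmod w < sqrt (1 - x)" using w by simp
      then have "(cmod w)\<^sup>2 < (sqrt (1 - x))\<^sup>2" by (intro power_strict_mono) auto
      with 2 have "(cmod w)\<^sup>2 < 1 - x" by simp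
      moreover have "cmod w < 1"
        using \<open>(cmod w)\<^sup>2 < 1 - x\<close> 2 power_less_imp_less_base[of "cmod w" 2 1] by simp
      ultimately show "w \<in> {w \<in> unit_disc. rho w > x}" by auto
    qed
    moreover have "sqrt (1 - x) \<le> 1" using 2 by simp
    ultimately have "emeasure dA {w \<in> unit_disc. rho w > x} = ennreal (1 / pi) * emeasure lborel (ball (0::complex) (sqrt (1 - x)))"
      by (simp only:) (rule emeasure_dA_borel, auto)
    also have "\<dots> = ennreal (1 - x)"
      using 2 by (simp add: emeasure_ball unit_ball_vol_2 ennreal_mult[symmetric])
    also have "\<dots> = emeasure lborel ({0..1} \<inter> {x<..})"
    proof -
      have "{0..1} \<inter> {x<..} = {x<..1}" using 2 by auto
      then show ?thesis using 2 by simp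
    qed
    finally show ?thesis unfolding L R .
  next
    case 3
    then have "{w \<in> unit_disc. rho w > x} = {}" "{0..1} \<inter> {x<..} = {}"
      using order_trans[OF rho_le_1] by (auto simp: not_less)
    then show ?thesis unfolding L R by (simp only: emeasure_empty)
  qed
qed simp_all

lemma nn_integral_dA_rho:
  assumes [measurable]: "\<phi> \<in> borel_measurable borel"
  shows "(\<integral>\<^sup>+w. \<phi> (rho w) \<partial>dA) = (\<integral>\<^sup>+t\<in>{0..1}. \<phi> t \<partial>lborel)"
proof -
  have "(\<integral>\<^sup>+w. \<phi> (rho w) \<partial>dA) = (\<integral>\<^sup>+t. \<phi> t \<partial>distr dA borel rho)"
    by (subst nn_integral_distr) (auto intro: measurable_dA)
  also have "\<dots> = (\<integral>\<^sup>+t\<in>{0..1}. \<phi> t \<partial>lborel)"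
    unfolding distr_dA_rho by (subst nn_integral_density) (auto simp: mult.commute)
  finally show ?thesis .
qed

lemma emeasure_dA_rho:
  assumes [measurable]: "J \<in> sets borel"
  shows "emeasure dA {w \<in> unit_disc. rho w \<in> J} = emeasure lborel ({0..1} \<inter> J)"
proof -
  have "emeasure dA {w \<in> unit_disc. rho w \<in> J} = emeasure (distr dA borel rho) J"
    by (subst emeasure_distr) (auto intro: measurable_dA intro!: arg_cong[where f="emeasure dA"])
  also have "\<dots> = emeasure lborel ({0..1} \<inter> J)"
    unfolding distr_dA_rho by (subst emeasure_density) (auto simp flip: indicator_inter_arith)
  finally show ?thesis .
qed

lemma emeasure_dA_rho_Ioc:
  assumes "0 \<le> x" "x \<le> y" "y \<le> 1"
  shows "emeasure dA {w \<in> unit_disc. rho w \<in> {x<..y}} = ennreal (y - x)"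
proof -
  have "{0..1} \<inter> {x<..y} = {x<..y}" using assms by auto
  then show ?thesis using assms by (subst emeasure_dA_rho) auto
qed

lemma emeasure_dA_rho_Ioc_le:
  assumes "x \<le> y"
  shows "emeasure dA {w \<in> unit_disc. rho w \<in> {x<..y}} \<le> ennreal (y - x)"
proof -
  have "emeasure lborel ({0..1} \<inter> {x<..y}) \<le> emeasure lborel {x<..y}" by (intro emeasure_mono) auto
  then show ?thesis using assms by (subst emeasure_dA_rho) auto
qed

subsection \<open>Parseval's identity and binomial coefficients of the kernel\<close>

lemma integrable_dA_bounded:
  fixes h :: "complex \<Rightarrow> 'b::{banach, second_countable_topology}"
  assumes "h \<in> borel_measurable dA" "\<And>w. cmod w < 1 \<Longrightarrow> norm (h w) \<le> B"
  shows "integrable dA h"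
  by (rule dA.integrable_const_bound[of _ B]) (use assms in auto)

text \<open>Expand the square into a double sum: the weight is radial, so the monomials stay
  orthogonal and only the diagonal survives.\<close>

lemma parseval_finite:
  fixes \<phi> :: "real \<Rightarrow> real" and h :: "nat \<Rightarrow> complex"
  assumes [measurable]: "\<phi> \<in> borel_measurable borel"
    and int: "integrable dA (\<lambda>w. \<phi> (rho w))"
  shows "integrable dA (\<lambda>w. \<phi> (rho w) * (cmod (\<Sum>n<N. h n * w ^ n))\<^sup>2)"
    and "(LINT w|dA. \<phi> (rho w) * (cmod (\<Sum>n<N. h n * w ^ n))\<^sup>2)
      = (\<Sum>n<N. (cmod (h n))\<^sup>2 * (LINT w|dA. \<phi> (rho w) * cmod w ^ (2 * n)))"
proof -
  let ?e = "\<lambda>n m w. complex_of_real (\<phi> (rho w)) * (w ^ n * cnj w ^ m)"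
  have ei: "integrable dA (?e n m)" for n m
  proof (rule Bochner_Integration.integrable_bound[OF int])
    show "?e n m \<in> borel_measurable dA"
      by (rule measurable_dA) measurable
    show "AE x in dA. norm (?e n m x) \<le> norm (\<phi> (rho x))"
    proof (rule AE_I2)
      fix x assume "x \<in> space dA"
      then have "cmod x ^ n * cmod x ^ m \<le> 1 * 1"
        by (intro mult_mono power_le_one) auto
      then show "norm (?e n m x) \<le> norm (\<phi> (rho x))"
        using mult_left_mono[of "cmod x ^ n * cmod x ^ m" 1 "\<bar>\<phi> (rho x)\<bar>"]
        by (simp add: norm_mult norm_power)
    qed
  qed
  have id: "complex_of_real (\<phi> (rho w) * (cmod (\<Sum>n<N. h n * w ^ n))\<^sup>2)
      = (\<Sum>n<N. \<Sum>m<N. h n * cnj (h m) * ?e n m w)" for w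
    unfolding of_real_mult complex_norm_square cnj_sum complex_cnj_mult complex_cnj_power sum_product
    by (simp only: sum_distrib_left mult_ac)
  have int2: "integrable dA (\<lambda>w. complex_of_real (\<phi> (rho w) * (cmod (\<Sum>n<N. h n * w ^ n))\<^sup>2))"
    unfolding id by (intro Bochner_Integration.integrable_sum integrable_mult_right ei)
  then show "integrable dA (\<lambda>w. \<phi> (rho w) * (cmod (\<Sum>n<N. h n * w ^ n))\<^sup>2)"
    by (simp only: complex_of_real_integrable_eq)
  have "complex_of_real (LINT w|dA. \<phi> (rho w) * (cmod (\<Sum>n<N. h n * w ^ n))\<^sup>2)
      = (LINT w|dA. (\<Sum>n<N. \<Sum>m<N. h n * cnj (h m) * ?e n m w))"
    unfolding id[symmetric] by (rule integral_complex_of_real[symmetric])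
  also have "\<dots> = (\<Sum>n<N. \<Sum>m<N. h n * cnj (h m) * (LINT w|dA. ?e n m w))"
  proof -
    have "(LINT w|dA. (\<Sum>n<N. \<Sum>m<N. h n * cnj (h m) * ?e n m w))
        = (\<Sum>n<N. LINT w|dA. (\<Sum>m<N. h n * cnj (h m) * ?e n m w))"
      by (rule Bochner_Integration.integral_sum) (intro Bochner_Integration.integrable_sum integrable_mult_right ei)
    also have "\<dots> = (\<Sum>n<N. \<Sum>m<N. LINT w|dA. h n * cnj (h m) * ?e n m w)"
      by (intro sum.cong[OF refl] Bochner_Integration.integral_sum integrable_mult_right ei)
    finally show ?thesis by (simp only: integral_mult_right_zero)
  qed
  also have "\<dots> = (\<Sum>n<N. h n * cnj (h n) * (LINT w|dA. ?e n n w))"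
  proof (rule sum.cong[OF refl])
    fix n assume "n \<in> {..<N}"
    have "(\<Sum>m<N. h n * cnj (h m) * (LINT w|dA. ?e n m w))
        = (\<Sum>m<N. if m = n then h n * cnj (h n) * (LINT w|dA. ?e n n w) else 0)"
      by (rule sum.cong) (auto simp: monomials_orthogonal)
    then show "(\<Sum>m<N. h n * cnj (h m) * (LINT w|dA. ?e n m w)) = h n * cnj (h n) * (LINT w|dA. ?e n n w)"
      using \<open>n \<in> _\<close> by simp
  qed
  also have "\<dots> = (\<Sum>n<N. complex_of_real ((cmod (h n))\<^sup>2 * (LINT w|dA. \<phi> (rho w) * cmod w ^ (2 * n))))"
  proof (rule sum.cong[OF refl])
    fix n
    have "?e n n w = complex_of_real (\<phi> (rho w) * cmod w ^ (2 * n))" for w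
      by (simp add: power_mult_distrib[symmetric] power_mult flip: complex_norm_square)
    then have "(LINT w|dA. ?e n n w) = complex_of_real (LINT w|dA. \<phi> (rho w) * cmod w ^ (2 * n))"
      by (simp only: integral_complex_of_real)
    then show "h n * cnj (h n) * (LINT w|dA. ?e n n w)
        = complex_of_real ((cmod (h n))\<^sup>2 * (LINT w|dA. \<phi> (rho w) * cmod w ^ (2 * n)))"
      by (simp only: of_real_mult complex_norm_square)
  qed
  finally show "(LINT w|dA. \<phi> (rho w) * (cmod (\<Sum>n<N. h n * w ^ n))\<^sup>2)
      = (\<Sum>n<N. (cmod (h n))\<^sup>2 * (LINT w|dA. \<phi> (rho w) * cmod w ^ (2 * n)))"
    by (simp only: of_real_sum[symmetric] of_real_eq_iff)
qed

text \<open>For partial sums this is Parseval with every moment bounded by the measure of the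
  annular set, as \<open>cmod z \<le> 1\<close>. Fatou's lemma then passes to the limit
  \<open>H\<close>.\<close>

lemma parseval_le:
  assumes [measurable]: "J \<in> sets borel"
    and sums: "\<And>z. cmod z < 1 \<Longrightarrow> (\<lambda>n. h n * z ^ n) sums H z"
    and B: "\<And>N. (\<Sum>n<N. (cmod (h n))\<^sup>2) \<le> B"
  shows "(\<integral>\<^sup>+z\<in>{z \<in> unit_disc. rho z \<in> J}. ennreal ((cmod (H z))\<^sup>2) \<partial>dA)
      \<le> ennreal B * emeasure dA {z \<in> unit_disc. rho z \<in> J}"
proof -
  let ?A = "{z \<in> unit_disc. rho z \<in> J}"
  let ?i = "\<lambda>t. indicator J t :: real"
  let ?F = "\<lambda>N z. ennreal (?i (rho z) * (cmod (\<Sum>n<N. h n * z ^ n))\<^sup>2)"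
  have [measurable]: "?F N \<in> borel_measurable dA" for N
    by (rule measurable_dA) measurable
  have int: "integrable dA (\<lambda>z. ?i (rho z))"
    by (rule integrable_dA_bounded[of _ 1]) (auto intro: measurable_dA simp: indicator_def)
  have A: "(LINT z|dA. ?i (rho z)) = measure dA ?A"
  proof -
    have "(LINT z|dA. ?i (rho z)) = (LINT z|dA. indicator ?A z)"
      by (intro Bochner_Integration.integral_cong) (auto simp: indicator_def)
    also have "\<dots> = measure dA ?A"
      by (simp add: Int_absorb2 subset_iff)
    finally show ?thesis .
  qed
  have *: "(\<integral>\<^sup>+z. ?F N z \<partial>dA) \<le> ennreal B * emeasure dA ?A" for N
  proof -
    have "(LINT z|dA. ?i (rho z) * (cmod (\<Sum>n<N. h n * z ^ n))\<^sup>2)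
      = (\<Sum>n<N. (cmod (h n))\<^sup>2 * (LINT z|dA. ?i (rho z) * cmod z ^ (2 * n)))"
      by (rule parseval_finite(2)) (use int in auto)
    also have "\<dots> \<le> (\<Sum>n<N. (cmod (h n))\<^sup>2 * (LINT z|dA. ?i (rho z)))"
    proof (intro sum_mono mult_left_mono integral_mono int)
      fix n z assume "z \<in> space dA"
      then have "cmod z ^ (2 * n) \<le> 1" by (intro power_le_one) auto
      then show "?i (rho z) * cmod z ^ (2 * n) \<le> ?i (rho z)"
        by (simp add: indicator_def)
    next
      fix n show "integrable dA (\<lambda>z. ?i (rho z) * cmod z ^ (2 * n))"
        by (rule integrable_dA_bounded[of _ 1])
           (auto intro!: measurable_dA simp: indicator_def power_le_one)
    qed simp
    also have "\<dots> \<le> B * measure dA ?A"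
      using B[of N] by (simp add: A sum_distrib_right[symmetric] mult_right_mono)
    finally have le: "(LINT z|dA. ?i (rho z) * (cmod (\<Sum>n<N. h n * z ^ n))\<^sup>2) \<le> B * measure dA ?A" .
    have "(\<integral>\<^sup>+z. ?F N z \<partial>dA) = ennreal (LINT z|dA. ?i (rho z) * (cmod (\<Sum>n<N. h n * z ^ n))\<^sup>2)"
      by (rule nn_integral_eq_integral[OF parseval_finite(1)]) (use int in auto)
    also have "\<dots> \<le> ennreal (B * measure dA ?A)" by (intro ennreal_leI le)
    also have "\<dots> = ennreal B * emeasure dA ?A"
      using B[of 0] by (simp add: dA.emeasure_eq_measure ennreal_mult)
    finally show ?thesis .
  qed
  have "(\<integral>\<^sup>+z\<in>?A. ennreal ((cmod (H z))\<^sup>2) \<partial>dA) = (\<integral>\<^sup>+z. liminf (\<lambda>N. ?F N z) \<partial>dA)"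
  proof (rule nn_integral_cong)
    fix z assume z: "z \<in> space dA"
    have "(\<lambda>N. ?F N z) \<longlonglongrightarrow> ennreal (?i (rho z) * (cmod (H z))\<^sup>2)"
      by (intro tendsto_ennrealI tendsto_intros sums[unfolded sums_def]) (use z in auto)
    then have "liminf (\<lambda>N. ?F N z) = ennreal (?i (rho z) * (cmod (H z))\<^sup>2)"
      by (rule lim_imp_Liminf[OF sequentially_bot])
    then show "ennreal ((cmod (H z))\<^sup>2) * indicator ?A z = liminf (\<lambda>N. ?F N z)"
      using z by (auto simp: indicator_def)
  qed
  also have "\<dots> \<le> liminf (\<lambda>N. \<integral>\<^sup>+z. ?F N z \<partial>dA)"
    by (rule nn_integral_liminf) measurable
  also have "\<dots> \<le> ennreal B * emeasure dA ?A"
    using Liminf_mono[of "\<lambda>N. \<integral>\<^sup>+z. ?F N z \<partial>dA" "\<lambda>_. ennreal B * emeasure dA ?A" sequentially] *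
    by (simp add: Liminf_const)
  finally show ?thesis .
qed

section \<open>Taylor coefficients of \<open>(1 - t) powr (- x)\<close> and their size, via the
  Gamma function\<close>

definition kernel_coeff :: "real \<Rightarrow> nat \<Rightarrow> real" where
  "kernel_coeff x n = pochhammer x n / fact n"

lemma kernel_coeff_pos: "x > 0 \<Longrightarrow> kernel_coeff x n > 0"
  by (simp add: kernel_coeff_def pochhammer_pos)

lemma Gamma_real_nonzero: "x > 0 \<Longrightarrow> Gamma x \<noteq> (0 :: real)"
  by (simp add: less_imp_neq[OF Gamma_real_pos, symmetric])

lemma kernel_coeff_conv_Gamma: "x > 0 \<Longrightarrow> kernel_coeff x n = Gamma (x + n) / (Gamma x * fact n)"
  unfolding kernel_coeff_def by (subst pochhammer_Gamma) (auto elim!: nonpos_Ints_cases)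

lemma kernel_coeff_sums_complex:
  fixes x :: real
  assumes "cmod z < 1"
  shows "(\<lambda>n. of_real (kernel_coeff x n) * z ^ n) sums ((1 - z) powr (- of_real x))"
proof -
  have "((- complex_of_real x) gchoose n) * (- z) ^ n = of_real (kernel_coeff x n) * z ^ n" for n
  proof -
    have "((- complex_of_real x) gchoose n) * (- z) ^ n
      = ((- 1) ^ n * (- 1) ^ n) * (pochhammer (of_real x) n / fact n * z ^ n)"
      unfolding gbinomial_pochhammer power_minus[of z] by simp
    also have "(- 1) ^ n * (- 1) ^ n = (1 :: complex)"
      by (simp flip: power_add)
    finally show ?thesis by (simp add: kernel_coeff_def pochhammer_of_real)
  qed
  with gen_binomial_complex[of "- z" "- of_real x"] assms show ?thesis by simp
qed

lemma kernel_coeff_sums_real: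
  assumes "0 \<le> t" "t < 1"
  shows "(\<lambda>n. kernel_coeff x n * t ^ n) sums ((1 - t) powr (- x))"
proof -
  have "(\<lambda>n. complex_of_real (kernel_coeff x n * t ^ n)) sums (complex_of_real (1 - t) powr (- of_real x))"
    using kernel_coeff_sums_complex[of "of_real t" x] assms by simp
  also have "complex_of_real (1 - t) powr (- of_real x) = complex_of_real ((1 - t) powr (- x))"
    using assms by (subst powr_of_real[symmetric]) auto
  finally show ?thesis by (simp only: sums_of_real_iff)
qed

text \<open>Logarithmic convexity of Gamma at a midpoint; it supplies the coefficient bounds with
  explicit constants.\<close>

lemma Gamma_midpoint_sq_le:
  fixes x y :: real
  assumes "x > 0" "y > 0"
  shows "(Gamma ((x + y) / 2))\<^sup>2 \<le> Gamma x * Gamma y"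
proof -
  have "(ln \<circ> Gamma) ((1 - 1/2) *\<^sub>R x + (1/2) *\<^sub>R y) \<le> (1 - 1/2) * (ln \<circ> Gamma) x + (1/2) * (ln \<circ> Gamma) y"
    by (rule convex_onD[OF log_convex_Gamma_real]) (use assms in auto)
  then have "2 * ln (Gamma ((x + y) / 2)) \<le> ln (Gamma x) + ln (Gamma y)"
    by (simp add: field_simps)
  moreover have pos: "Gamma x > 0" "Gamma y > 0" "Gamma ((x + y) / 2) > 0"
    using assms by (simp_all add: Gamma_real_pos)
  ultimately have "ln ((Gamma ((x + y) / 2))\<^sup>2) \<le> ln (Gamma x * Gamma y)"
    by (simp add: ln_mult ln_realpow)
  then show ?thesis using pos by (subst (asm) ln_le_cancel_iff) (rule zero_less_power mult_pos_pos | assumption)+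
qed

text \<open>The point c/2 + n is the midpoint of n + 1 and c - 1 + n. Both sides grow like n to the
  power c - 2, so nothing is lost in the order of growth.\<close>

lemma kernel_coeff_half_sq_le:
  assumes "c > 1"
  shows "(kernel_coeff (c / 2) n)\<^sup>2 \<le> Gamma (c - 1) / (Gamma (c / 2))\<^sup>2 * kernel_coeff (c - 1) n"
proof -
  have "(Gamma (c / 2 + n))\<^sup>2 \<le> Gamma (real n + 1) * Gamma (c - 1 + n)"
    using Gamma_midpoint_sq_le[of "real n + 1" "c - 1 + n"] assms by (simp add: add_divide_distrib algebra_simps)
  then have "(Gamma (c / 2 + n))\<^sup>2 \<le> fact n * Gamma (c - 1 + n)"
    by (simp add: Gamma_fact add.commute)
  then have "(Gamma (c / 2 + n))\<^sup>2 / ((Gamma (c / 2))\<^sup>2 * (fact n)\<^sup>2)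
    \<le> fact n * Gamma (c - 1 + n) / ((Gamma (c / 2))\<^sup>2 * (fact n)\<^sup>2)"
    by (rule divide_right_mono) auto
  also have "\<dots> = Gamma (c - 1) / (Gamma (c / 2))\<^sup>2 * kernel_coeff (c - 1) n"
  proof -
    have "Gamma (c - 1) \<noteq> 0" using assms by (simp add: Gamma_real_nonzero)
    then show ?thesis using assms by (simp add: kernel_coeff_conv_Gamma power2_eq_square add.commute)
  qed
  finally show ?thesis using assms
    by (simp add: kernel_coeff_conv_Gamma power_divide power_mult_distrib)
qed

text \<open>The ratio of the two sides tends to the positive number \<open>inverse (Gamma c)\<close>
  by the limit formula for Gamma; finitely many remaining indices are absorbed into a
  minimum.\<close>

lemma kernel_coeff_lower:
  assumes "c > 0"
  obtains \<delta> where "\<delta> > 0" "\<And>n. n \<ge> 1 \<Longrightarrow> kernel_coeff c n \<ge> \<delta> * real n powr (c - 1)"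
proof -
  have "(\<lambda>n. kernel_coeff c n / real n powr (c - 1)) \<longlonglongrightarrow> inverse (Gamma c)"
  proof -
    have "(\<lambda>n. inverse (Gamma_series' c n)) \<longlonglongrightarrow> inverse (Gamma c)"
      using assms by (intro tendsto_inverse Gamma_series'_LIMSEQ Gamma_real_nonzero)
    moreover have "eventually (\<lambda>n. inverse (Gamma_series' c n) = kernel_coeff c n / real n powr (c - 1)) sequentially"
      using eventually_gt_at_top[of 0]
    proof eventually_elim
      case (elim n)
      \<comment> \<open>\<open>Gamma_series'\<close> contains \<open>fact (n - 1)\<close> in place
        of \<open>fact n\<close>; the extra factor n turns the exponent c into c - 1.\<close>
      then have "(fact n :: real) = real n * fact (n - 1)" by (simp add: fact_reduce)
      with elim assms show ?case
        by (simp add: Gamma_series'_def kernel_coeff_def powr_def exp_diff algebra_simps pochhammer_pos)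
    qed
    ultimately show ?thesis by (rule Lim_transform_eventually)
  qed
  moreover have "inverse (Gamma c) / 2 < inverse (Gamma c)" using assms Gamma_real_pos[of c] by simp
  ultimately have "eventually (\<lambda>n. inverse (Gamma c) / 2 < kernel_coeff c n / real n powr (c - 1)) sequentially"
    by (rule order_tendstoD)
  then obtain M where M: "\<And>n. n \<ge> M \<Longrightarrow> inverse (Gamma c) / 2 < kernel_coeff c n / real n powr (c - 1)"
    by (auto simp: eventually_sequentially)
  \<comment> \<open>Half the limit serves all indices beyond \<open>M\<close>, the listed ratios
    serve the indices up to \<open>M\<close>.\<close>
  let ?S = "insert (inverse (Gamma c) / 2) ((\<lambda>n. kernel_coeff c n / real n powr (c - 1)) ` {1..M})"
  define \<delta> where "\<delta> = Min ?S"
  have "\<delta> > 0" unfolding \<delta>_def using assms Gamma_real_pos[of c]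
    by (subst Min_gr_iff) (auto intro!: divide_pos_pos kernel_coeff_pos)
  moreover have "kernel_coeff c n \<ge> \<delta> * real n powr (c - 1)" if "n \<ge> 1" for n
  proof -
    have "\<delta> \<le> kernel_coeff c n / real n powr (c - 1)"
    proof (cases "n \<le> M")
      case True then show ?thesis unfolding \<delta>_def using that by (intro Min_le) auto
    next
      case False
      have "\<delta> \<le> inverse (Gamma c) / 2" unfolding \<delta>_def by (intro Min_le) auto
      also have "\<dots> \<le> kernel_coeff c n / real n powr (c - 1)" using M[of n] False by simp
      finally show ?thesis .
    qed
    then show ?thesis using that by (simp add: pos_le_divide_eq)
  qed
  ultimately show ?thesis by (rule that)
qed

subsection \<open>Strong type bounds for the kernel integral\<close>

interpretation dA2: pair_sigma_finite dA dA ..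

section \<open>The kernel integral: integrability, power series, measurability\<close>

lemma one_minus_mult_cnj_bounds:
  assumes "cmod z < 1" "cmod w < 1"
  shows "1 - z * cnj w \<noteq> 0" "1 - cmod z \<le> cmod (1 - z * cnj w)" "cmod (z * cnj w) < 1"
proof -
  have "cmod (z * cnj w) \<le> cmod z * 1"
    unfolding norm_mult complex_mod_cnj using assms by (intro mult_left_mono) auto
  then have le: "cmod (z * cnj w) \<le> cmod z" by simp
  show "1 - cmod z \<le> cmod (1 - z * cnj w)"
    using norm_triangle_ineq2[of 1 "z * cnj w"] le by simp
  then show "1 - z * cnj w \<noteq> 0" using assms by auto
  show "cmod (z * cnj w) < 1" using le assms by simp
qed

lemma norm_powr_minus_of_real: "cmod (x powr (- complex_of_real c)) = cmod x powr (- c)"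
  by (subst norm_powr_real_powr') auto

text \<open>The principal power jumps across its branch cut, so measurability is read off the
  binomial series, which represents it on the whole disc.\<close>

lemma measurable_powr_kernel:
  assumes "cmod z < 1"
  shows "(\<lambda>w. (1 - z * cnj w) powr (- complex_of_real c)) \<in> borel_measurable dA"
proof -
  have "(\<lambda>w. \<Sum>n. of_real (kernel_coeff c n) * (z * cnj w) ^ n) \<in> borel_measurable dA"
    by (intro borel_measurable_suminf measurable_dA) measurable
  moreover have "(\<Sum>n. of_real (kernel_coeff c n) * (z * cnj w) ^ n) = (1 - z * cnj w) powr (- complex_of_real c)"
    if "w \<in> space dA" for w
    using kernel_coeff_sums_complex[OF one_minus_mult_cnj_bounds(3)[OF assms, of w]] that by (simp add: sums_iff)
  ultimately show ?thesis by (rule measurable_cong[THEN iffD1, rotated])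
qed

lemma integrable_kernel_mult:
  fixes g :: "complex \<Rightarrow> complex"
  assumes "integrable dA g" "cmod z < 1" "c \<ge> 0"
  shows "integrable dA (\<lambda>w. g w * (1 - z * cnj w) powr (- of_real c))"
proof (rule Bochner_Integration.integrable_bound)
  show "integrable dA (\<lambda>w. (1 - cmod z) powr (- c) * cmod (g w))"
    using assms by (intro integrable_mult_right integrable_norm)
  show "(\<lambda>w. g w * (1 - z * cnj w) powr (- of_real c)) \<in> borel_measurable dA"
    using assms by (intro borel_measurable_times measurable_powr_kernel) auto
  show "AE w in dA. norm (g w * (1 - z * cnj w) powr (- of_real c)) \<le> norm ((1 - cmod z) powr (- c) * cmod (g w))"
  proof (rule AE_I2)
    fix w assume "w \<in> space dA"
    then have "cmod (1 - z * cnj w) powr (- c) \<le> (1 - cmod z) powr (- c)"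
      using one_minus_mult_cnj_bounds[of z w] assms by (intro powr_mono2') auto
    then show "norm (g w * (1 - z * cnj w) powr (- of_real c)) \<le> norm ((1 - cmod z) powr (- c) * cmod (g w))"
      by (simp add: norm_mult norm_powr_minus_of_real mult.commute mult_left_mono)
  qed
qed

definition cauchy_int :: "real \<Rightarrow> (complex \<Rightarrow> complex) \<Rightarrow> complex \<Rightarrow> complex" where
  "cauchy_int c g z = (LINT w|dA. g w * (1 - z * cnj w) powr (- of_real c))"

text \<open>Expand the kernel in its binomial series and integrate term by term. The series of
  absolute values is dominated by \<open>cmod (g w)\<close> times the convergent series at
  \<open>cmod z\<close>.\<close>

lemma cauchy_int_sums:
  assumes g: "integrable dA g" and z: "cmod z < 1" and c: "c > 0"
  shows "(\<lambda>n. of_real (kernel_coeff c n) * (LINT w|dA. g w * cnj w ^ n) * z ^ n) sums cauchy_int c g z"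
proof -
  have [measurable]: "g \<in> borel_measurable dA" using g by auto
  have [measurable]: "(\<lambda>w. cnj w ^ n) \<in> borel_measurable dA" for n
    by (rule measurable_dA) measurable
  let ?f = "\<lambda>n w. g w * (of_real (kernel_coeff c n) * (z * cnj w) ^ n)"
  have nf: "cmod (?f n w) \<le> cmod (g w) * (kernel_coeff c n * cmod z ^ n)" if "w \<in> unit_disc" for n w
  proof -
    have "cmod (z * cnj w) ^ n \<le> cmod z ^ n"
      using that by (intro power_mono) (simp_all add: norm_mult mult_left_le)
    then show ?thesis
      using kernel_coeff_pos[OF c, of n] by (simp add: norm_mult norm_power mult_left_mono)
  qed
  have fi: "integrable dA (?f n)" for n
  proof (rule Bochner_Integration.integrable_bound)
    show "integrable dA (\<lambda>w. cmod (g w) * (kernel_coeff c n * cmod z ^ n))"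
      using g by (intro integrable_mult_left integrable_norm)
    show "?f n \<in> borel_measurable dA" by (simp add: power_mult_distrib)
    show "AE w in dA. cmod (?f n w) \<le> norm (cmod (g w) * (kernel_coeff c n * cmod z ^ n))"
      using nf by (intro AE_I2) (force intro: order_trans[OF _ abs_ge_self])
  qed
  have sz: "summable (\<lambda>n. kernel_coeff c n * cmod z ^ n)"
    using kernel_coeff_sums_real[of "cmod z" c] z by (auto simp: sums_iff)
  have "(\<lambda>n. integral\<^sup>L dA (?f n)) sums (LINT w|dA. (\<Sum>n. ?f n w))"
  proof (rule sums_integral[OF fi])
    show "AE w in dA. summable (\<lambda>n. norm (?f n w))"
    proof (rule AE_I2)
      fix w assume "w \<in> space dA"
      then show "summable (\<lambda>n. norm (?f n w))"
        using nf[of w] by (intro summable_comparison_test'[OF summable_mult[OF sz, of "cmod (g w)"], of 0]) auto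
    qed
    show "summable (\<lambda>n. LINT w|dA. norm (?f n w))"
    proof (rule summable_comparison_test'[OF summable_mult[OF sz, of "LINT w|dA. cmod (g w)"], of 0])
      fix n
      have "(LINT w|dA. norm (?f n w)) \<le> (LINT w|dA. cmod (g w) * (kernel_coeff c n * cmod z ^ n))"
        using fi g nf by (intro integral_mono integrable_norm integrable_mult_left) auto
      then show "norm (LINT w|dA. norm (?f n w)) \<le> (LINT w|dA. cmod (g w)) * (kernel_coeff c n * cmod z ^ n)"
        by simp
    qed
  qed
  also have "(LINT w|dA. (\<Sum>n. ?f n w)) = cauchy_int c g z"
    unfolding cauchy_int_def
  proof (rule Bochner_Integration.integral_cong[OF refl])
    fix w assume "w \<in> space dA"
    then have "(\<lambda>n. of_real (kernel_coeff c n) * (z * cnj w) ^ n) sums ((1 - z * cnj w) powr (- of_real c))"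
      using one_minus_mult_cnj_bounds[of z w] z by (intro kernel_coeff_sums_complex) auto
    then show "(\<Sum>n. ?f n w) = g w * (1 - z * cnj w) powr (- of_real c)"
      by (intro sums_unique[symmetric] sums_mult)
  qed
  also have "(\<lambda>n. integral\<^sup>L dA (?f n)) = (\<lambda>n. of_real (kernel_coeff c n) * (LINT w|dA. g w * cnj w ^ n) * z ^ n)"
  proof
    fix n
    have "?f n = (\<lambda>w. (of_real (kernel_coeff c n) * z ^ n) * (g w * cnj w ^ n))"
      by (simp add: power_mult_distrib mult_ac)
    then have "integral\<^sup>L dA (?f n) = (of_real (kernel_coeff c n) * z ^ n) * (LINT w|dA. g w * cnj w ^ n)"
      by (simp only: integral_mult_right_zero)
    then show "integral\<^sup>L dA (?f n) = of_real (kernel_coeff c n) * (LINT w|dA. g w * cnj w ^ n) * z ^ n"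
      by (simp only: mult_ac)
  qed
  finally show ?thesis .
qed

lemma measurable_cauchy_int:
  assumes "integrable dA g" "c > 0"
  shows "cauchy_int c g \<in> borel_measurable dA"
proof -
  let ?s = "\<lambda>n z. of_real (kernel_coeff c n) * (LINT w|dA. g w * cnj w ^ n) * z ^ n"
  have "(\<lambda>z. \<Sum>n. ?s n z) \<in> borel_measurable dA"
    by (intro borel_measurable_suminf measurable_dA) measurable
  moreover have "(\<Sum>n. ?s n z) = cauchy_int c g z" if "z \<in> space dA" for z
    using cauchy_int_sums[OF assms(1) _ assms(2), of z] that by (simp add: sums_iff)
  ultimately show ?thesis by (rule measurable_cong[THEN iffD1, rotated])
qed

section \<open>Strong type (1, 1)\<close>

definition kernel_mean_const :: "real \<Rightarrow> real" where
  "kernel_mean_const c = Gamma (c - 1) / (Gamma (c / 2))\<^sup>2"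

text \<open>The integrand is the squared modulus of the power with exponent -c/2, so Parseval
  applies in z. The squared coefficients are then compared with the binomial series of exponent c -
  1 at \<open>(cmod w)\<^sup>2\<close>.\<close>

lemma kernel_mean_le:
  assumes c: "c > 1" and w: "cmod w < 1" and J: "J \<in> sets borel"
  shows "(\<integral>\<^sup>+z\<in>{z \<in> unit_disc. rho z \<in> J}. ennreal (cmod (1 - z * cnj w) powr (- c)) \<partial>dA)
    \<le> ennreal (kernel_mean_const c * rho w powr (1 - c)) * emeasure dA {z \<in> unit_disc. rho z \<in> J}"
proof -
  let ?h = "\<lambda>n. of_real (kernel_coeff (c / 2) n) * cnj w ^ n :: complex"
  have "(\<integral>\<^sup>+z\<in>{z \<in> unit_disc. rho z \<in> J}. ennreal ((cmod ((1 - z * cnj w) powr (- of_real (c / 2))))\<^sup>2) \<partial>dA)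
    \<le> ennreal (kernel_mean_const c * rho w powr (1 - c)) * emeasure dA {z \<in> unit_disc. rho z \<in> J}"
  proof (rule parseval_le[OF J])
    fix z :: complex assume "cmod z < 1"
    then show "(\<lambda>n. ?h n * z ^ n) sums ((1 - z * cnj w) powr (- of_real (c / 2)))"
      using kernel_coeff_sums_complex[of "z * cnj w" "c / 2"] one_minus_mult_cnj_bounds[of z w] w
      by (simp add: power_mult_distrib mult_ac)
  next
    fix N
    have w2: "(cmod w)\<^sup>2 < 1" using rho_pos[OF w] by simp
    have s: "(\<lambda>n. kernel_mean_const c * (kernel_coeff (c - 1) n * (cmod w)\<^sup>2 ^ n)) sums (kernel_mean_const c * rho w powr (- (c - 1)))"
      by (intro sums_mult kernel_coeff_sums_real w2) simp
    have pos: "0 \<le> kernel_mean_const c * (kernel_coeff (c - 1) n * (cmod w)\<^sup>2 ^ n)" for n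
      using c kernel_coeff_pos[of "c - 1" n] Gamma_real_pos[of "c - 1"] by (auto simp: kernel_mean_const_def)
    have "(\<Sum>n<N. (cmod (?h n))\<^sup>2) \<le> (\<Sum>n<N. kernel_mean_const c * (kernel_coeff (c - 1) n * (cmod w)\<^sup>2 ^ n))"
    proof (rule sum_mono)
      fix n
      have "(cmod (?h n))\<^sup>2 = (kernel_coeff (c / 2) n)\<^sup>2 * (cmod w)\<^sup>2 ^ n"
        by (simp add: norm_mult norm_power power_mult_distrib mult.commute flip: power_mult)
      also have "\<dots> \<le> (kernel_mean_const c * kernel_coeff (c - 1) n) * (cmod w)\<^sup>2 ^ n"
        unfolding kernel_mean_const_def by (intro mult_right_mono kernel_coeff_half_sq_le c) simp
      finally show "(cmod (?h n))\<^sup>2 \<le> kernel_mean_const c * (kernel_coeff (c - 1) n * (cmod w)\<^sup>2 ^ n)" by (simp add: mult_ac)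
    qed
    also have "\<dots> \<le> kernel_mean_const c * rho w powr (- (c - 1))"
      using sum_le_suminf[of "\<lambda>n. kernel_mean_const c * (kernel_coeff (c - 1) n * (cmod w)\<^sup>2 ^ n)" "{..<N}"] s pos
      by (simp add: sums_iff)
    finally show "(\<Sum>n<N. (cmod (?h n))\<^sup>2) \<le> kernel_mean_const c * rho w powr (1 - c)" by simp
  qed
  moreover have "(cmod ((1 - z * cnj w) powr (- of_real (c / 2))))\<^sup>2 = cmod (1 - z * cnj w) powr (- c)" for z
    by (simp only: norm_powr_minus_of_real power2_eq_square powr_add[symmetric]) simp
  ultimately show ?thesis by simp
qed

text \<open>Tonelli's theorem moves the z-integral inside, where it is a kernel mean. For
  \<open>g = rho\<^sup>b f\<close> with b = c - 2 + s, the integral on the right is the norm of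
  \<open>rho\<^sup>s f\<close> in L1 of dA / rho.\<close>

lemma cauchy_int_strong_1:
  assumes c: "c > 1" and g: "integrable dA g" and J [measurable]: "J \<in> sets borel"
  shows "(\<integral>\<^sup>+z\<in>{z \<in> unit_disc. rho z \<in> J}. ennreal (cmod (cauchy_int c g z)) \<partial>dA)
    \<le> ennreal (kernel_mean_const c) * emeasure dA {z \<in> unit_disc. rho z \<in> J} * (\<integral>\<^sup>+w. ennreal (cmod (g w) * rho w powr (1 - c)) \<partial>dA)"
proof -
  let ?A = "{z \<in> unit_disc. rho z \<in> J}"
  let ?k = "\<lambda>z w. ennreal (cmod (g w)) * (ennreal (cmod (1 - z * cnj w) powr (- c)) * indicator ?A z)"
  have [measurable]: "g \<in> borel_measurable dA" using g by auto
  have [measurable]: "(\<lambda>w. w) \<in> borel_measurable dA" by (rule measurable_id_dA)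
  have [measurable]: "fst \<in> borel_measurable (dA \<Otimes>\<^sub>M dA)" "snd \<in> borel_measurable (dA \<Otimes>\<^sub>M dA)"
    using measurable_compose[OF measurable_fst measurable_id_dA, of dA] measurable_compose[OF measurable_snd measurable_id_dA, of dA]
    by simp_all
  have [measurable]: "?A \<in> sets dA" by measurable
  have m: "case_prod ?k \<in> borel_measurable (dA \<Otimes>\<^sub>M dA)"
    unfolding case_prod_beta
    by (intro borel_measurable_times_ennreal measurable_compose[OF measurable_fst, of "\<lambda>z. indicator ?A z"]
       measurable_compose[OF measurable_snd, of "\<lambda>w. ennreal (cmod (g w))"]) measurable
  have "(\<integral>\<^sup>+z\<in>?A. ennreal (cmod (cauchy_int c g z)) \<partial>dA) \<le> (\<integral>\<^sup>+z. \<integral>\<^sup>+w. ?k z w \<partial>dA \<partial>dA)"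
  proof (rule nn_integral_mono)
    fix z assume z: "z \<in> space dA"
    have "ennreal (cmod (cauchy_int c g z)) \<le> (\<integral>\<^sup>+w. ennreal (cmod (g w * (1 - z * cnj w) powr (- of_real c))) \<partial>dA)"
      unfolding cauchy_int_def using z c by (intro integral_norm_bound_ennreal integrable_kernel_mult g) auto
    also have "\<dots> = (\<integral>\<^sup>+w. ennreal (cmod (g w)) * ennreal (cmod (1 - z * cnj w) powr (- c)) \<partial>dA)"
      by (simp add: norm_mult norm_powr_minus_of_real ennreal_mult)
    finally show "ennreal (cmod (cauchy_int c g z)) * indicator ?A z \<le> (\<integral>\<^sup>+w. ?k z w \<partial>dA)"
      by (simp add: indicator_def)
  qed
  also have "\<dots> = (\<integral>\<^sup>+w. \<integral>\<^sup>+z. ?k z w \<partial>dA \<partial>dA)"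
    by (rule dA2.Fubini'[OF m, symmetric])
  also have "\<dots> \<le> (\<integral>\<^sup>+w. ennreal (kernel_mean_const c) * emeasure dA ?A * ennreal (cmod (g w) * rho w powr (1 - c)) \<partial>dA)"
  proof (rule nn_integral_mono)
    fix w assume w: "w \<in> space dA"
    have mm: "(\<lambda>z. ennreal (cmod (1 - z * cnj w) powr (- c)) * indicator ?A z) \<in> borel_measurable dA"
      by (intro borel_measurable_times_ennreal borel_measurable_indicator \<open>?A \<in> sets dA\<close> measurable_dA) measurable
    have "(\<integral>\<^sup>+z. ?k z w \<partial>dA) = ennreal (cmod (g w)) * (\<integral>\<^sup>+z\<in>?A. ennreal (cmod (1 - z * cnj w) powr (- c)) \<partial>dA)"
      by (rule nn_integral_cmult[OF mm])
    also have "\<dots> \<le> ennreal (cmod (g w)) * (ennreal (kernel_mean_const c * rho w powr (1 - c)) * emeasure dA ?A)"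
      using w by (intro mult_left_mono kernel_mean_le[OF c _ J]) auto
    also have "\<dots> = ennreal (kernel_mean_const c) * emeasure dA ?A * ennreal (cmod (g w) * rho w powr (1 - c))"
      by (simp add: ennreal_mult'' mult_ac)
    finally show "(\<integral>\<^sup>+z. ?k z w \<partial>dA) \<le> ennreal (kernel_mean_const c) * emeasure dA ?A * ennreal (cmod (g w) * rho w powr (1 - c))" .
  qed
  also have "\<dots> = ennreal (kernel_mean_const c) * emeasure dA ?A * (\<integral>\<^sup>+w. ennreal (cmod (g w) * rho w powr (1 - c)) \<partial>dA)"
  proof (rule nn_integral_cmult)
    have "(\<lambda>w. rho w powr (1 - c)) \<in> borel_measurable dA" by (rule measurable_dA) measurable
    then show "(\<lambda>w. ennreal (cmod (g w) * rho w powr (1 - c))) \<in> borel_measurable dA" by measurable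
  qed
  finally show ?thesis .
qed

section \<open>Beta integrals and strong type (2, 2)\<close>

lemma nn_integral_dA_beta:
  assumes x: "x > 0"
  shows "(\<integral>\<^sup>+w. ennreal (rho w powr (x - 1) * cmod w ^ (2 * n)) \<partial>dA) = ennreal (Beta x (n + 1))"
proof -
  have "(\<integral>\<^sup>+w. ennreal (rho w powr (x - 1) * cmod w ^ (2 * n)) \<partial>dA)
      = (\<integral>\<^sup>+w. (\<lambda>t. ennreal (t powr (x - 1) * (1 - t) ^ n)) (rho w) \<partial>dA)"
    by (simp add: power_mult)
  also have "\<dots> = (\<integral>\<^sup>+t\<in>{0..1}. ennreal (t powr (x - 1) * (1 - t) ^ n) \<partial>lborel)"
    by (rule nn_integral_dA_rho) measurable
  also have "\<dots> = (\<integral>\<^sup>+t. ennreal (indicator {0..1} t * (t powr (x - 1) * (1 - t) powr (real (n + 1) - 1))) \<partial>lborel)"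
  proof (rule nn_integral_cong_AE)
    \<comment> \<open>The point t = 1 is excluded because for n = 0 the power
      \<open>(1 - t) ^ 0\<close> is 1 while \<open>0 powr 0\<close> is 0.\<close>
    have "AE t in lborel. t \<noteq> (1::real)" by (rule AE_lborel_singleton)
    then show "AE t in lborel. ennreal (t powr (x - 1) * (1 - t) ^ n) * indicator {0..1} t
        = ennreal (indicator {0..1} t * (t powr (x - 1) * (1 - t) powr (real (n + 1) - 1)))"
      by eventually_elim (auto simp: indicator_def powr_realpow)
  qed
  also have "\<dots> = ennreal (Beta x (n + 1))"
    by (rule nn_integral_has_integral_lebesgue[OF _ has_integral_Beta_real]) (use x in auto)
  finally show ?thesis .
qed

lemma
  assumes x: "x > 0"
  shows integrable_dA_beta: "integrable dA (\<lambda>w. rho w powr (x - 1) * cmod w ^ (2 * n))"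
    and integral_dA_beta: "(LINT w|dA. rho w powr (x - 1) * cmod w ^ (2 * n)) = Beta x (n + 1)"
proof -
  have m: "(\<lambda>w. rho w powr (x - 1) * cmod w ^ (2 * n)) \<in> borel_measurable dA"
    by (rule measurable_dA) measurable
  have B: "Beta x (real n + 1) \<ge> 0" using x Gamma_real_pos[of x] Gamma_real_pos[of "real n + 1"] Gamma_real_pos[of "x + (real n + 1)"]
    unfolding Beta_def by (intro divide_nonneg_nonneg mult_nonneg_nonneg) auto
  have "integrable dA (\<lambda>w. rho w powr (x - 1) * cmod w ^ (2 * n)) \<and> (LINT w|dA. rho w powr (x - 1) * cmod w ^ (2 * n)) = Beta x (n + 1)"
    using nn_integral_dA_beta[OF x, of n] B by (subst nn_integral_eq_integrable[OF m, symmetric]) (auto simp: add.commute)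
  then show "integrable dA (\<lambda>w. rho w powr (x - 1) * cmod w ^ (2 * n))"
    "(LINT w|dA. rho w powr (x - 1) * cmod w ^ (2 * n)) = Beta x (n + 1)" by auto
qed

lemma integrable_rho_powr: "y > -1 \<Longrightarrow> integrable dA (\<lambda>w. rho w powr y)"
  using integrable_dA_beta[of "y + 1" 0] by simp

definition bessel_const :: "real \<Rightarrow> real" where
  "bessel_const c = Gamma (2 * c - 2) / (Gamma c)\<^sup>2"

lemma bessel_const_pos: "c > 1 \<Longrightarrow> bessel_const c > 0"
  unfolding bessel_const_def by (intro divide_pos_pos zero_less_power Gamma_real_pos) auto

text \<open>The point c + n is the midpoint of n + 1 and 2 * c - 1 + n. The squared coefficient
  grows like n to the power 2 * c - 2, which is exactly the decay of the Beta moment.\<close>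

lemma kernel_coeff_sq_beta_le:
  assumes c: "c > 1"
  shows "(kernel_coeff c n)\<^sup>2 * Beta (2 * c - 2) (n + 1) \<le> bessel_const c"
proof -
  have "(Gamma (c + n))\<^sup>2 \<le> Gamma (real n + 1) * Gamma (2 * c - 2 + (real n + 1))"
    using Gamma_midpoint_sq_le[of "real n + 1" "2 * c - 2 + (real n + 1)"] c by (simp add: add_divide_distrib algebra_simps)
  then have le: "(Gamma (c + n))\<^sup>2 / (fact n * Gamma (2 * c - 2 + (real n + 1))) \<le> 1"
    using Gamma_real_pos[of "2 * c - 2 + (real n + 1)"] c
    by (subst divide_le_eq_1_pos) (auto simp: Gamma_fact add.commute)
  have "(kernel_coeff c n)\<^sup>2 * Beta (2 * c - 2) (n + 1)
    = (Gamma (c + n))\<^sup>2 / (fact n * Gamma (2 * c - 2 + (real n + 1))) * bessel_const c"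
  proof -
    have "Beta (2 * c - 2) (n + 1) = Gamma (2 * c - 2) * fact n / Gamma (2 * c - 2 + (real n + 1))"
      using Gamma_fact[of n, where 'a = real] by (simp add: Beta_def add_ac)
    then show ?thesis
      using c by (simp add: kernel_coeff_conv_Gamma bessel_const_def power_divide power_mult_distrib power2_eq_square mult_ac)
  qed
  also have "\<dots> \<le> 1 * bessel_const c"
    using le bessel_const_pos[OF c] by (intro mult_right_mono) auto
  finally show ?thesis by simp
qed

text \<open>This is Bessel's inequality for the monomials, which are orthogonal in \<open>L\<^sup>2\<close> with
  weight \<open>rho w powr (2 * c - 3)\<close>.\<close>

lemma coeff_square_sum_le:
  assumes c: "c > 1" and g: "integrable dA g"
    and g2: "integrable dA (\<lambda>w. (cmod (g w))\<^sup>2 * rho w powr (3 - 2 * c))"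
  shows "(\<Sum>n<N. (cmod (of_real (kernel_coeff c n) * (LINT w|dA. g w * cnj w ^ n)))\<^sup>2)
    \<le> bessel_const c * (LINT w|dA. (cmod (g w))\<^sup>2 * rho w powr (3 - 2 * c))"
proof -
  define X where "X n = (LINT w|dA. g w * cnj w ^ n)" for n
  define C where "C = bessel_const c"
  define I where "I = (LINT w|dA. (cmod (g w))\<^sup>2 * rho w powr (3 - 2 * c))"
  \<comment> \<open>The dual polynomial \<open>Q\<close> is scaled so that its pairing with
    \<open>g\<close> equals \<open>S / C\<close> and its weighted square norm is at most
    \<open>S / C\<close>. Then twice the pairing is at most the sum of both square norms, which
    gives \<open>S \<le> C * I\<close>.\<close>
  define \<xi> where "\<xi> n = of_real ((kernel_coeff c n)\<^sup>2 / C) * X n" for n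
  define Q where "Q w = (\<Sum>n<N. \<xi> n * w ^ n)" for w
  define S where "S = (\<Sum>n<N. (kernel_coeff c n)\<^sup>2 * (cmod (X n))\<^sup>2)"
  have C: "C > 0" using bessel_const_pos[OF c] by (simp add: C_def)
  have int: "integrable dA (\<lambda>w. rho w powr (2 * c - 3))"
    using c by (intro integrable_rho_powr) simp
  have gi: "integrable dA (\<lambda>w. g w * cnj w ^ n)" for n
  proof (rule Bochner_Integration.integrable_bound[OF g])
    show "(\<lambda>w. g w * cnj w ^ n) \<in> borel_measurable dA"
      by (intro borel_measurable_times borel_measurable_integrable[OF g] measurable_dA) measurable
    show "AE w in dA. cmod (g w * cnj w ^ n) \<le> cmod (g w)"
      by (intro AE_I2) (auto simp: norm_mult norm_power intro!: mult_left_le power_le_one)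
  qed
  have gQ: "g w * cnj (Q w) = (\<Sum>n<N. cnj (\<xi> n) * (g w * cnj w ^ n))" for w
    by (simp add: Q_def sum_distrib_left mult_ac)
  have gQi: "integrable dA (\<lambda>w. g w * cnj (Q w))"
    unfolding gQ by (intro Bochner_Integration.integrable_sum integrable_mult_right gi)
  have "(LINT w|dA. Re (g w * cnj (Q w))) = Re (LINT w|dA. g w * cnj (Q w))"
    by (rule integral_Re[OF gQi])
  also have "(LINT w|dA. g w * cnj (Q w)) = (\<Sum>n<N. cnj (\<xi> n) * X n)"
    unfolding gQ X_def by (subst Bochner_Integration.integral_sum) (auto intro: gi)
  also have "\<dots> = of_real (S / C)"
    unfolding S_def sum_divide_distrib of_real_sum
    by (intro sum.cong refl) (simp add: \<xi>_def complex_norm_square mult_ac del: of_real_power)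
  finally have eq: "(LINT w|dA. Re (g w * cnj (Q w))) = S / C" by simp
  have "2 * (S / C) = (LINT w|dA. 2 * Re (g w * cnj (Q w)))"
    unfolding integral_mult_right_zero eq ..
  also have "\<dots> \<le> (LINT w|dA. (cmod (g w))\<^sup>2 * rho w powr (3 - 2 * c) + rho w powr (2 * c - 3) * (cmod (Q w))\<^sup>2)"
  proof (rule integral_mono)
    show "integrable dA (\<lambda>w. 2 * Re (g w * cnj (Q w)))"
      using gQi by (intro integrable_mult_right integrable_Re)
    show "integrable dA (\<lambda>w. (cmod (g w))\<^sup>2 * rho w powr (3 - 2 * c) + rho w powr (2 * c - 3) * (cmod (Q w))\<^sup>2)"
      unfolding Q_def by (intro Bochner_Integration.integrable_add g2 parseval_finite(1)[OF _ int]) measurable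
    fix w assume "w \<in> space dA"
    then have r: "rho w > 0" using rho_pos[of w] by simp
    \<comment> \<open>The weights of \<open>g\<close> and of \<open>Q\<close> are reciprocal;
      \<open>q\<close> is the square root of the first, which balances the arithmetic-geometric
      inequality.\<close>
    define q where "q = rho w powr ((3 - 2 * c) / 2)"
    have q: "rho w powr (3 - 2 * c) = q\<^sup>2" "rho w powr (2 * c - 3) = inverse (q\<^sup>2)" "q > 0"
      using r powr_minus[of "rho w" "3 - 2 * c"] by (simp_all add: q_def power2_eq_square powr_add[symmetric])
    have "Re (g w * cnj (Q w)) \<le> cmod (g w) * cmod (Q w)"
      using complex_Re_le_cmod[of "g w * cnj (Q w)"] by (simp add: norm_mult)
    also have "2 * \<dots> \<le> (cmod (g w) * q)\<^sup>2 + (cmod (Q w) / q)\<^sup>2"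
      using sum_squares_bound[of "cmod (g w) * q" "cmod (Q w) / q"] q by simp
    finally show "2 * Re (g w * cnj (Q w)) \<le> (cmod (g w))\<^sup>2 * rho w powr (3 - 2 * c) + rho w powr (2 * c - 3) * (cmod (Q w))\<^sup>2"
      unfolding q by (simp add: power_mult_distrib power_divide field_simps)
  qed
  also have "\<dots> = I + (LINT w|dA. rho w powr (2 * c - 3) * (cmod (Q w))\<^sup>2)"
    unfolding I_def Q_def by (intro Bochner_Integration.integral_add g2 parseval_finite(1)[OF _ int]) measurable
  also have "(LINT w|dA. rho w powr (2 * c - 3) * (cmod (Q w))\<^sup>2)
      = (\<Sum>n<N. (cmod (\<xi> n))\<^sup>2 * Beta (2 * c - 2) (n + 1))"
    unfolding Q_def by (subst parseval_finite(2)[OF _ int], measurable)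
      (use integral_dA_beta[of "2 * c - 2"] c in simp)
  also have "\<dots> \<le> (\<Sum>n<N. (kernel_coeff c n)\<^sup>2 * (cmod (X n))\<^sup>2 / C)"
  proof (rule sum_mono)
    fix n
    have "(cmod (\<xi> n))\<^sup>2 * Beta (2 * c - 2) (n + 1)
        = ((kernel_coeff c n)\<^sup>2 * Beta (2 * c - 2) (n + 1)) * ((kernel_coeff c n)\<^sup>2 * (cmod (X n))\<^sup>2 / C\<^sup>2)"
      using C by (simp add: \<xi>_def norm_mult power_mult_distrib power_divide norm_divide norm_power)
    also have "\<dots> \<le> C * ((kernel_coeff c n)\<^sup>2 * (cmod (X n))\<^sup>2 / C\<^sup>2)"
      unfolding C_def by (intro mult_right_mono kernel_coeff_sq_beta_le c) simp
    finally show "(cmod (\<xi> n))\<^sup>2 * Beta (2 * c - 2) (n + 1) \<le> (kernel_coeff c n)\<^sup>2 * (cmod (X n))\<^sup>2 / C"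
      using C by (simp add: power2_eq_square)
  qed
  also have "\<dots> = S / C" by (simp add: S_def sum_divide_distrib)
  finally have "S \<le> C * I" using C by (simp add: field_simps)
  then show ?thesis
    by (simp add: S_def C_def I_def X_def norm_mult power_mult_distrib)
qed

text \<open>Parseval for the Taylor series of the kernel integral, with the coefficients summed by
  Bessel's inequality. For \<open>g = rho\<^sup>b f\<close> with b = c - 2 + s, the integral on the
  right is the square norm of \<open>rho\<^sup>s f\<close> in L2 of dA / rho.\<close>

lemma cauchy_int_strong_2:
  assumes c: "c > 1" and g: "integrable dA g"
    and g2: "integrable dA (\<lambda>w. (cmod (g w))\<^sup>2 * rho w powr (3 - 2 * c))" and J: "J \<in> sets borel"
  shows "(\<integral>\<^sup>+z\<in>{z \<in> unit_disc. rho z \<in> J}. ennreal ((cmod (cauchy_int c g z))\<^sup>2) \<partial>dA)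
    \<le> ennreal (bessel_const c * (LINT w|dA. (cmod (g w))\<^sup>2 * rho w powr (3 - 2 * c))) * emeasure dA {z \<in> unit_disc. rho z \<in> J}"
  by (rule parseval_le[OF J cauchy_int_sums[OF g] coeff_square_sum_le[OF c g g2]]) (use c in auto)

subsection \<open>Boundedness for \<open>1/2 \<le> 2 - c + b\<close>\<close>

text \<open>A Young-type inequality with the conjugate exponents 1/s and 1/(1 - s): according to
  which of \<open>cmod (f w)\<close> and \<open>rho w powr (b * s / (1 - s))\<close> is larger, one
  of the two summands of the majorant dominates. The condition b > s - 1 makes the second summand
  integrable.\<close>

lemma integrable_mult_rho_powr:
  fixes f :: "complex \<Rightarrow> complex"
  assumes s: "0 < s" "s < 1" and b: "b > s - 1"
    and f: "f \<in> borel_measurable dA" "integrable dA (\<lambda>w. cmod (f w) powr (1 / s))"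
  shows "integrable dA (\<lambda>w. f w * of_real (rho w powr b))"
proof (rule Bochner_Integration.integrable_bound)
  have "b / (1 - s) > -1" using s b by (simp add: less_divide_eq)
  then show "integrable dA (\<lambda>w. cmod (f w) powr (1 / s) + rho w powr (b / (1 - s)))"
    by (intro Bochner_Integration.integrable_add f(2) integrable_rho_powr)
  show "(\<lambda>w. f w * of_real (rho w powr b)) \<in> borel_measurable dA"
    by (intro borel_measurable_times f(1) measurable_dA) measurable
  show "AE w in dA. norm (f w * of_real (rho w powr b)) \<le> norm (cmod (f w) powr (1 / s) + rho w powr (b / (1 - s)))"
  proof (rule AE_I2)
    fix w assume "w \<in> space dA"
    then have r: "rho w > 0" using rho_pos[of w] by simp
    have e1: "1 + (1 - s) / s = 1 / s" using s by (simp add: field_simps)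
    have e2: "b * s / (1 - s) + b = b / (1 - s)" using s by (simp add: field_simps)
    have "cmod (f w) * rho w powr b \<le> cmod (f w) powr (1 / s) + rho w powr (b / (1 - s))"
    proof (cases "cmod (f w) \<le> rho w powr (b * s / (1 - s))")
      case True
      then have "cmod (f w) * rho w powr b \<le> rho w powr (b * s / (1 - s)) * rho w powr b"
        by (rule mult_right_mono) simp
      also have "\<dots> = rho w powr (b / (1 - s))" unfolding powr_add[symmetric] e2 ..
      finally show ?thesis by (simp add: add_increasing)
    next
      case False
      then have "(rho w powr (b * s / (1 - s))) powr ((1 - s) / s) \<le> cmod (f w) powr ((1 - s) / s)"
        using s by (intro powr_mono2) auto
      then have le: "rho w powr b \<le> cmod (f w) powr ((1 - s) / s)"
        using s by (simp add: powr_powr)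
      have pos: "cmod (f w) > 0" using False by (smt (verit) powr_ge_zero)
      have "cmod (f w) * rho w powr b \<le> cmod (f w) powr 1 * cmod (f w) powr ((1 - s) / s)"
        using le pos by (simp add: mult_left_mono)
      also have "\<dots> = cmod (f w) powr (1 / s)" unfolding powr_add[symmetric] e1 ..
      finally show ?thesis by (simp add: add_increasing2)
    qed
    then show "norm (f w * of_real (rho w powr b)) \<le> norm (cmod (f w) powr (1 / s) + rho w powr (b / (1 - s)))"
      by (simp add: norm_mult)
  qed
qed

text \<open>The two pointwise inequalities of Marcinkiewicz truncation: the large part is measured
  in the first power, the small part in the second.\<close>

lemma powr_split_bounds:
  fixes y \<alpha> p :: real
  assumes "\<alpha> > 0" "1 \<le> p" "p \<le> 2" "y \<ge> 0"
  shows "\<alpha> < y \<Longrightarrow> y \<le> y powr p * \<alpha> powr (1 - p)"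
    and "y \<le> \<alpha> \<Longrightarrow> y\<^sup>2 \<le> y powr p * \<alpha> powr (2 - p)"
proof -
  assume y: "\<alpha> < y"
  have "y = y powr p * y powr (1 - p)" using y assms by (simp flip: powr_add)
  also have "\<dots> \<le> y powr p * \<alpha> powr (1 - p)"
    using y assms by (intro mult_left_mono powr_mono2') auto
  finally show "y \<le> y powr p * \<alpha> powr (1 - p)" .
next
  assume y: "y \<le> \<alpha>"
  show "y\<^sup>2 \<le> y powr p * \<alpha> powr (2 - p)"
  proof (cases "y = 0")
    case False
    then have "y\<^sup>2 = y powr p * y powr (2 - p)" using assms by (simp flip: powr_add)
    also have "\<dots> \<le> y powr p * \<alpha> powr (2 - p)"
      using y assms by (intro mult_left_mono powr_mono2) auto
    finally show ?thesis .
  qed auto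
qed

text \<open>Splitting \<open>f\<close> at the height \<open>|f w| * rho w powr s = \<alpha>\<close> interpolates between the
  two strong-type bounds.\<close>

lemma cauchy_int_weak_type:
  fixes f :: "complex \<Rightarrow> complex"
  assumes s: "1 / 2 \<le> s" "s < 1" and c: "c > 1" and b: "b = c - 2 + s"
    and f [measurable]: "f \<in> borel_measurable dA" and fp: "integrable dA (\<lambda>w. cmod (f w) powr (1 / s))"
    and \<alpha>: "\<alpha> > 0" and J: "J \<in> sets borel"
  defines "g \<equiv> \<lambda>w. f w * of_real (rho w powr b)"
    and "M \<equiv> LINT w|dA. cmod (f w) powr (1 / s)"
  shows "emeasure dA {z \<in> unit_disc. rho z \<in> J \<and> cmod (cauchy_int c g z) > \<alpha>}
    \<le> ennreal ((2 * kernel_mean_const c + 4 * bessel_const c) * M * \<alpha> powr (- 1 / s)) * emeasure dA {z \<in> unit_disc. rho z \<in> J}"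
proof -
  define p where "p = 1 / s"
  have p: "1 \<le> p" "p \<le> 2" "s * p = 1" using s by (auto simp: p_def field_simps)
  let ?A = "{z \<in> unit_disc. rho z \<in> J}"
  define m where "m = measure dA ?A"
  have A [measurable]: "?A \<in> sets dA" using J by (rule sets_dA_rho)
  have Am: "emeasure dA ?A = ennreal m" by (simp add: m_def dA.emeasure_eq_measure)
  have rm [measurable]: "(\<lambda>w. rho w powr y) \<in> borel_measurable dA" for y
    by (rule measurable_dA) measurable
  define P where "P w \<longleftrightarrow> \<alpha> < cmod (f w) * rho w powr s" for w
  have [measurable]: "Measurable.pred dA P" unfolding P_def by measurable
  define g1 where "g1 w = (if P w then g w else 0)" for w
  define g2 where "g2 w = (if P w then 0 else g w)" for w
  have gi: "integrable dA g"
    unfolding g_def using s c fp by (intro integrable_mult_rho_powr) (auto simp: b)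
  then have [measurable]: "g \<in> borel_measurable dA" by auto
  have g1i: "integrable dA g1" and g2i: "integrable dA g2"
    by (rule Bochner_Integration.integrable_bound[OF gi]; simp add: g1_def[abs_def] g2_def[abs_def])+
  have F: "cauchy_int c g z = cauchy_int c g1 z + cauchy_int c g2 z" if "cmod z < 1" for z
  proof -
    have "cauchy_int c g z = (LINT w|dA. g1 w * (1 - z * cnj w) powr (- of_real c) + g2 w * (1 - z * cnj w) powr (- of_real c))"
      unfolding cauchy_int_def by (rule Bochner_Integration.integral_cong) (auto simp: g1_def g2_def)
    also have "\<dots> = cauchy_int c g1 z + cauchy_int c g2 z"
      unfolding cauchy_int_def using that c
      by (intro Bochner_Integration.integral_add integrable_kernel_mult g1i g2i) auto
    finally show ?thesis .
  qed
  \<comment> \<open>In terms of y = |f| rho^s, both strong-type bounds live on the one measure dA /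
    rho, and since s * p = 1 the p-norm of y there is the p-norm of \<open>f\<close> for dA. This
    makes the interpolation possible.\<close>
  have y: "cmod (g w) * rho w powr (1 - c) = cmod (f w) * rho w powr s / rho w"
      "(cmod (g w))\<^sup>2 * rho w powr (3 - 2 * c) = (cmod (f w) * rho w powr s)\<^sup>2 / rho w"
      "(cmod (f w) * rho w powr s) powr p / rho w = cmod (f w) powr p" if "w \<in> space dA" for w
  proof -
    have r: "rho w > 0" using rho_pos[of w] that by simp
    have "rho w powr b * rho w powr (1 - c) = rho w powr (s - 1)"
      by (simp flip: powr_add add: b)
    also have "\<dots> = rho w powr s / rho w" using r by (simp add: powr_diff)
    finally show "cmod (g w) * rho w powr (1 - c) = cmod (f w) * rho w powr s / rho w"
      by (simp add: g_def norm_mult mult.assoc)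
    have "(rho w powr b)\<^sup>2 * rho w powr (3 - 2 * c) = rho w powr (2 * s - 1)"
      unfolding power2_eq_square[of "_ powr _"] powr_add[symmetric] b by (rule arg_cong[where f="\<lambda>x. rho w powr x"]) simp
    also have "\<dots> = (rho w powr s)\<^sup>2 / rho w"
      using r by (simp add: powr_diff power2_eq_square flip: powr_add)
    finally show "(cmod (g w))\<^sup>2 * rho w powr (3 - 2 * c) = (cmod (f w) * rho w powr s)\<^sup>2 / rho w"
      by (simp add: g_def norm_mult power_mult_distrib mult.assoc)
    show "(cmod (f w) * rho w powr s) powr p / rho w = cmod (f w) powr p"
      using r p(3) by (simp add: powr_mult powr_powr)
  qed
  have M0: "M \<ge> 0" by (simp add: M_def)
  have c1: "kernel_mean_const c \<ge> 0" unfolding kernel_mean_const_def using c by (auto intro!: divide_nonneg_nonneg less_imp_le[OF Gamma_real_pos])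
  have c2: "bessel_const c \<ge> 0" using bessel_const_pos[OF c] by simp
  have m0: "m \<ge> 0" by (simp add: m_def)
  have fp': "integrable dA (\<lambda>w. cmod (f w) powr p)" using fp by (simp add: p_def)
  have M: "M = (LINT w|dA. cmod (f w) powr p)" by (simp add: M_def p_def)
  have b1: "(\<integral>\<^sup>+w. ennreal (cmod (g1 w) * rho w powr (1 - c)) \<partial>dA) \<le> ennreal (M * \<alpha> powr (1 - p))"
  proof -
    have "(\<integral>\<^sup>+w. ennreal (cmod (g1 w) * rho w powr (1 - c)) \<partial>dA) \<le> (\<integral>\<^sup>+w. ennreal (cmod (f w) powr p * \<alpha> powr (1 - p)) \<partial>dA)"
    proof (intro nn_integral_mono ennreal_leI)
      fix w assume w: "w \<in> space dA"
      then have r: "rho w > 0" using rho_pos[of w] by simp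
      show "cmod (g1 w) * rho w powr (1 - c) \<le> cmod (f w) powr p * \<alpha> powr (1 - p)"
      proof (cases "P w")
        case True
        have "cmod (f w) * rho w powr s / rho w \<le> (cmod (f w) * rho w powr s) powr p * \<alpha> powr (1 - p) / rho w"
          using True r by (intro divide_right_mono powr_split_bounds(1) \<alpha> p) (auto simp: P_def)
        also have "\<dots> = cmod (f w) powr p * \<alpha> powr (1 - p)"
          unfolding y(3)[OF w, symmetric] by simp
        finally show ?thesis using True y(1)[OF w] by (simp add: g1_def)
      qed (simp add: g1_def)
    qed
    also have "\<dots> = ennreal (LINT w|dA. cmod (f w) powr p * \<alpha> powr (1 - p))"
      by (intro nn_integral_eq_integral integrable_mult_left fp') auto
    finally show ?thesis by (simp add: M)
  qed
  have pt2: "(cmod (g2 w))\<^sup>2 * rho w powr (3 - 2 * c) \<le> cmod (f w) powr p * \<alpha> powr (2 - p)" if w: "w \<in> space dA" for w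
  proof -
    have r: "rho w > 0" using rho_pos[of w] w by simp
    show ?thesis
    proof (cases "P w")
      case False
      have "(cmod (f w) * rho w powr s)\<^sup>2 / rho w \<le> (cmod (f w) * rho w powr s) powr p * \<alpha> powr (2 - p) / rho w"
        using False r by (intro divide_right_mono powr_split_bounds(2) \<alpha> p) (auto simp: P_def)
      also have "\<dots> = cmod (f w) powr p * \<alpha> powr (2 - p)"
        unfolding y(3)[OF w, symmetric] by simp
      finally show ?thesis using False y(2)[OF w] by (simp add: g2_def)
    qed (simp add: g2_def)
  qed
  have int2: "integrable dA (\<lambda>w. (cmod (g2 w))\<^sup>2 * rho w powr (3 - 2 * c))"
  proof (rule Bochner_Integration.integrable_bound)
    show "integrable dA (\<lambda>w. cmod (f w) powr p * \<alpha> powr (2 - p))" using fp' by (rule integrable_mult_left)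
    show "(\<lambda>w. (cmod (g2 w))\<^sup>2 * rho w powr (3 - 2 * c)) \<in> borel_measurable dA"
      using g2i by (intro borel_measurable_times rm) auto
    show "AE w in dA. norm ((cmod (g2 w))\<^sup>2 * rho w powr (3 - 2 * c)) \<le> norm (cmod (f w) powr p * \<alpha> powr (2 - p))"
      using pt2 by (intro AE_I2) simp
  qed
  have b2: "(LINT w|dA. (cmod (g2 w))\<^sup>2 * rho w powr (3 - 2 * c)) \<le> M * \<alpha> powr (2 - p)"
  proof -
    have "(LINT w|dA. (cmod (g2 w))\<^sup>2 * rho w powr (3 - 2 * c)) \<le> (LINT w|dA. cmod (f w) powr p * \<alpha> powr (2 - p))"
      using pt2 by (intro integral_mono int2 integrable_mult_left fp') auto
    then show ?thesis by (simp add: M)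
  qed
  have [measurable]: "cauchy_int c g1 \<in> borel_measurable dA" "cauchy_int c g2 \<in> borel_measurable dA"
    using c by (auto intro: measurable_cauchy_int g1i g2i)
  \<comment> \<open>These are the sets where the respective part is at least \<alpha> / 2, written
    for Markov's inequality in the first power for \<open>g1\<close> and in the second power for
    \<open>g2\<close>.\<close>
  let ?E1 = "{z \<in> ?A. 1 \<le> ennreal (2 / \<alpha>) * ennreal (cmod (cauchy_int c g1 z))}"
  let ?E2 = "{z \<in> ?A. 1 \<le> ennreal (4 / \<alpha>\<^sup>2) * ennreal ((cmod (cauchy_int c g2 z))\<^sup>2)}"
  have E1: "emeasure dA ?E1 \<le> ennreal (2 * kernel_mean_const c * M * \<alpha> powr (- p) * m)"
  proof -
    have "emeasure dA ?E1 \<le> ennreal (2 / \<alpha>) * (\<integral>\<^sup>+z\<in>?A. ennreal (cmod (cauchy_int c g1 z)) \<partial>dA)"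
      using A by (intro nn_integral_Markov_inequality) measurable
    also have "\<dots> \<le> ennreal (2 / \<alpha>) * (ennreal (kernel_mean_const c) * emeasure dA ?A * ennreal (M * \<alpha> powr (1 - p)))"
      by (intro mult_left_mono order_trans[OF cauchy_int_strong_1[OF c g1i J]] b1) auto
    also have "\<dots> = ennreal (2 / \<alpha> * (kernel_mean_const c * m * (M * \<alpha> powr (1 - p))))"
      unfolding Am using \<alpha> c1 M0 m0 by (simp add: mult_ac flip: ennreal_mult)
    also have "2 / \<alpha> * (kernel_mean_const c * m * (M * \<alpha> powr (1 - p))) = 2 * kernel_mean_const c * M * \<alpha> powr (- p) * m"
      using \<alpha> by (simp add: powr_diff powr_minus field_simps)
    finally show ?thesis .
  qed
  have E2: "emeasure dA ?E2 \<le> ennreal (4 * bessel_const c * M * \<alpha> powr (- p) * m)"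
  proof -
    have "emeasure dA ?E2 \<le> ennreal (4 / \<alpha>\<^sup>2) * (\<integral>\<^sup>+z\<in>?A. ennreal ((cmod (cauchy_int c g2 z))\<^sup>2) \<partial>dA)"
      using A by (intro nn_integral_Markov_inequality) measurable
    also have "\<dots> \<le> ennreal (4 / \<alpha>\<^sup>2) * (ennreal (bessel_const c * (M * \<alpha> powr (2 - p))) * emeasure dA ?A)"
      by (intro mult_left_mono order_trans[OF cauchy_int_strong_2[OF c g2i int2 J]] mult_right_mono ennreal_leI b2 c2) auto
    also have "\<dots> = ennreal (4 / \<alpha>\<^sup>2 * (bessel_const c * (M * \<alpha> powr (2 - p)) * m))"
      unfolding Am using \<alpha> c2 M0 m0 by (simp add: mult_ac flip: ennreal_mult)
    also have "4 / \<alpha>\<^sup>2 * (bessel_const c * (M * \<alpha> powr (2 - p)) * m) = 4 * bessel_const c * M * \<alpha> powr (- p) * m"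
      using \<alpha> by (simp add: powr_diff powr_minus field_simps)
    finally show ?thesis .
  qed
  have "emeasure dA {z \<in> unit_disc. rho z \<in> J \<and> cmod (cauchy_int c g z) > \<alpha>} \<le> emeasure dA (?E1 \<union> ?E2)"
  proof (rule emeasure_mono)
    show "{z \<in> unit_disc. rho z \<in> J \<and> cmod (cauchy_int c g z) > \<alpha>} \<subseteq> ?E1 \<union> ?E2"
    proof
      fix z assume z: "z \<in> {z \<in> unit_disc. rho z \<in> J \<and> cmod (cauchy_int c g z) > \<alpha>}"
      then have "\<alpha> < cmod (cauchy_int c g1 z) + cmod (cauchy_int c g2 z)"
        using F[of z] norm_triangle_ineq[of "cauchy_int c g1 z" "cauchy_int c g2 z"] by auto
      then consider "\<alpha> / 2 \<le> cmod (cauchy_int c g1 z)" | "\<alpha> / 2 \<le> cmod (cauchy_int c g2 z)" by linarith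
      then show "z \<in> ?E1 \<union> ?E2"
      proof cases
        case 1
        then have "1 \<le> ennreal (2 / \<alpha> * cmod (cauchy_int c g1 z))"
          using \<alpha> by (simp add: field_simps)
        then show ?thesis using z \<alpha> by (simp flip: ennreal_mult)
      next
        case 2
        then have "(\<alpha> / 2)\<^sup>2 \<le> (cmod (cauchy_int c g2 z))\<^sup>2"
          using \<alpha> by (intro power_mono) auto
        then have "1 \<le> ennreal (4 / \<alpha>\<^sup>2 * (cmod (cauchy_int c g2 z))\<^sup>2)"
          using \<alpha> by (simp add: field_simps power_divide)
        then show ?thesis using z \<alpha> by (simp flip: ennreal_mult)
      qed
    qed
    show "?E1 \<union> ?E2 \<in> sets dA" using A by measurable
  qed
  also have "\<dots> \<le> emeasure dA ?E1 + emeasure dA ?E2"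
    using A by (intro emeasure_subadditive) measurable
  also have "\<dots> \<le> ennreal (2 * kernel_mean_const c * M * \<alpha> powr (- p) * m) + ennreal (4 * bessel_const c * M * \<alpha> powr (- p) * m)"
    by (intro add_mono E1 E2)
  also have "\<dots> = ennreal ((2 * kernel_mean_const c + 4 * bessel_const c) * M * \<alpha> powr (- p) * m)"
    using c1 c2 M0 m0 by (subst ennreal_plus[symmetric]) (auto simp: algebra_simps)
  also have "\<dots> = ennreal ((2 * kernel_mean_const c + 4 * bessel_const c) * M * \<alpha> powr (- 1 / s)) * emeasure dA ?A"
    unfolding Am using c1 c2 M0 m0 by (simp add: p_def flip: ennreal_mult)
  finally show ?thesis .
qed

text \<open>Since \<open>\<kappa> * p > 1\<close>, a weak \<open>(p, p)\<close> bound on every annulus can be summed over dyadic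
  annuli away from the boundary; the rest of the disc is estimated by its area.\<close>

lemma weighted_level_set_le:
  fixes F :: "complex \<Rightarrow> complex"
  assumes \<kappa>: "\<kappa> > 0" "\<kappa> * p > 1" and D: "D \<ge> 0" and t: "t > 0" and x0: "x0 > 0"
    and F [measurable]: "F \<in> borel_measurable dA"
    and weak: "\<And>\<alpha> J. \<alpha> > 0 \<Longrightarrow> J \<in> sets borel \<Longrightarrow>
      emeasure dA {z \<in> unit_disc. rho z \<in> J \<and> cmod (F z) > \<alpha>} \<le> ennreal (D * \<alpha> powr (- p)) * emeasure dA {z \<in> unit_disc. rho z \<in> J}"
  shows "measure dA {z \<in> unit_disc. rho z powr (- \<kappa>) * cmod (F z) > t}
    \<le> x0 + D * t powr (- p) * x0 powr (1 - \<kappa> * p) / (1 - 2 powr (1 - \<kappa> * p))"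
proof -
  define X where "X k = 2 ^ k * x0" for k :: nat
  have X: "X k > 0" "X (Suc k) - X k = X k" for k using x0 by (simp_all add: X_def)
  define q where "q = 2 powr (1 - \<kappa> * p)"
  have q: "0 < q" "q < 1" using \<kappa> powr_less_mono[of "1 - \<kappa> * p" 0 2] by (simp_all add: q_def)
  \<comment> \<open>On this annulus the weight is at most \<open>X k powr (- \<kappa>)\<close>, so
    the weighted level t forces the unweighted level \<open>t * X k powr \<kappa>\<close>.\<close>
  define E where "E k = {z \<in> unit_disc. rho z \<in> {X k<..X (Suc k)} \<and> cmod (F z) > t * X k powr \<kappa>}" for k
  define B where "B = D * t powr (- p) * x0 powr (1 - \<kappa> * p)"
  have B: "B \<ge> 0" using D by (simp add: B_def)
  have E: "emeasure dA (E k) \<le> ennreal (B * q ^ k)" for k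
  proof -
    have "emeasure dA (E k) \<le> ennreal (D * (t * X k powr \<kappa>) powr (- p)) * emeasure dA {z \<in> unit_disc. rho z \<in> {X k<..X (Suc k)}}"
      unfolding E_def using t X(1)[of k] by (intro weak) auto
    also have "\<dots> \<le> ennreal (D * (t * X k powr \<kappa>) powr (- p)) * ennreal (X (Suc k) - X k)"
      using x0 by (intro mult_left_mono emeasure_dA_rho_Ioc_le) (auto simp: X_def)
    also have "\<dots> = ennreal (D * (t * X k powr \<kappa>) powr (- p) * X k)"
      unfolding X(2) using D X(1)[of k] by (simp flip: ennreal_mult)
    \<comment> \<open>The weak bound contributes \<open>X k\<close> to the power -\<kappa> * p and
      the area contributes one more factor \<open>X k\<close>; doubling \<open>X k\<close> therefore
      costs the ratio \<open>q < 1\<close>.\<close>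
    also have "D * (t * X k powr \<kappa>) powr (- p) * X k = B * q ^ k"
    proof -
      have "(t * X k powr \<kappa>) powr (- p) * X k = t powr (- p) * (X k powr (- (\<kappa> * p)) * X k powr 1)"
        using t X(1)[of k] by (simp add: powr_mult powr_powr)
      also have "X k powr (- (\<kappa> * p)) * X k powr 1 = X k powr (1 - \<kappa> * p)"
        unfolding powr_add[symmetric] by simp
      also have "\<dots> = (2 ^ k) powr (1 - \<kappa> * p) * x0 powr (1 - \<kappa> * p)"
        unfolding X_def using x0 by (simp add: powr_mult)
      also have "(2 ^ k :: real) powr (1 - \<kappa> * p) = q ^ k"
        unfolding q_def by (simp add: powr_powr mult.commute flip: powr_realpow)
      finally show ?thesis by (simp add: B_def)
    qed
    finally show ?thesis .
  qed
  have Es: "range E \<subseteq> sets dA"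
  proof -
    have "E k = {z \<in> space dA. cmod (F z) > t * X k powr \<kappa>} \<inter> {z \<in> unit_disc. rho z \<in> {X k<..X (Suc k)}}" for k
      by (auto simp: E_def)
    moreover have "{z \<in> space dA. cmod (F z) > t * X k powr \<kappa>} \<inter> {z \<in> unit_disc. rho z \<in> {X k<..X (Suc k)}} \<in> sets dA" for k
      by (intro sets.Int sets_dA_rho) measurable
    ultimately show ?thesis by auto
  qed
  let ?S = "{z \<in> unit_disc. rho z powr (- \<kappa>) * cmod (F z) > t}" and ?R = "{z \<in> unit_disc. rho z \<in> {0<..x0}}"
  have sub: "?S \<subseteq> ?R \<union> (\<Union>k. E k)"
  proof
    fix z assume z: "z \<in> ?S"
    then have r: "rho z > 0" using rho_pos[of z] by auto
    show "z \<in> ?R \<union> (\<Union>k. E k)"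
    proof (cases "rho z \<le> x0")
      case False
      obtain n where n: "rho z \<le> X n"
        using real_arch_pow[of 2 "rho z / x0"] x0 by (auto simp: X_def field_simps intro: less_imp_le)
      \<comment> \<open>The least dyadic level above \<open>rho z\<close> is not the level 0, as
        \<open>rho z > x0\<close>; its predecessor is the inner edge of the annulus containing
        z.\<close>
      define m where "m = (LEAST n. rho z \<le> X n)"
      have m: "rho z \<le> X m" unfolding m_def using n by (rule LeastI)
      have "m \<noteq> 0" using m False by (intro notI) (simp add: X_def)
      then obtain k where k: "m = Suc k" using not0_implies_Suc by blast
      have "\<not> rho z \<le> X k" using k not_less_Least[of k "\<lambda>n. rho z \<le> X n"] by (simp add: m_def)
      then have gt: "X k < rho z" by simp
      have "t * X k powr \<kappa> < cmod (F z)"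
      proof -
        have "t * X k powr \<kappa> \<le> t * rho z powr \<kappa>"
          using t gt X(1)[of k] \<kappa> by (intro mult_left_mono powr_mono2) auto
        also have "\<dots> < rho z powr (- \<kappa>) * cmod (F z) * rho z powr \<kappa>"
          using z r by (intro mult_strict_right_mono) auto
        also have "\<dots> = cmod (F z)" using r by (simp add: powr_minus)
        finally show ?thesis .
      qed
      then have "z \<in> E k" using z gt m k by (simp add: E_def)
      then show ?thesis by blast
    qed (use z r in auto)
  qed
  have "emeasure dA ?S \<le> emeasure dA (?R \<union> (\<Union>k. E k))"
    using Es by (intro emeasure_mono sub sets.Un sets_dA_rho) auto
  also have "\<dots> \<le> emeasure dA ?R + emeasure dA (\<Union>k. E k)"
    using Es by (intro emeasure_subadditive sets_dA_rho) auto
  also have "\<dots> \<le> ennreal x0 + ennreal (B / (1 - q))"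
  proof (intro add_mono)
    show "emeasure dA ?R \<le> ennreal x0" using emeasure_dA_rho_Ioc_le[of 0 x0] x0 by simp
    have "emeasure dA (\<Union>k. E k) \<le> (\<Sum>k. emeasure dA (E k))"
      by (intro emeasure_subadditive_countably Es)
    also have "\<dots> \<le> (\<Sum>k. ennreal (B * q ^ k))"
      by (intro suminf_le E) auto
    also have "\<dots> = ennreal (B / (1 - q))"
      using sums_mult[OF geometric_sums[of q], of B] q B by (intro suminf_ennreal_eq) auto
    finally show "emeasure dA (\<Union>k. E k) \<le> ennreal (B / (1 - q))" .
  qed
  also have "\<dots> = ennreal (x0 + B / (1 - q))" using x0 B q by (simp flip: ennreal_plus)
  finally have "ennreal (measure dA ?S) \<le> ennreal (x0 + B / (1 - q))"
    by (simp only: dA.emeasure_eq_measure)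
  moreover have "x0 + B / (1 - q) \<ge> 0" using x0 B q by simp
  ultimately have "measure dA ?S \<le> x0 + B / (1 - q)"
    by (simp only: ennreal_le_iff)
  then show ?thesis by (simp only: B_def q_def)
qed

lemma T_integral_eq_cauchy_int:
  "(LINT w|dA. T_kernel b c z w * f w) = cauchy_int c (\<lambda>w. f w * of_real (rho w powr b)) z"
  unfolding cauchy_int_def T_kernel_def
  by (intro Bochner_Integration.integral_cong refl) (simp add: powr_minus divide_inverse mult_ac)

text \<open>The weak-type estimate is summed over dyadic annuli, which needs \<kappa> * p > 1, that
  is -a > s. The height \<open>x0\<close> below which only area is counted is then optimized in
  terms of t and the norm of \<open>f\<close>.\<close>

lemma T_bounded_of_half_le:
  assumes s: "1 / 2 \<le> s" "s < 1" and c: "c > 1" and a: "- a > s" "a > -1"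
  shows "T_bounded a (c - 2 + s) c (1 / ereal s) (- 1 / a)"
proof -
  define b where "b = c - 2 + s"
  define \<kappa> where "\<kappa> = - a"
  define p where "p = 1 / s"
  have p: "p > 0" "s * p = 1" "1 / s = p" using s by (auto simp: p_def)
  have \<kappa>: "\<kappa> > 0" "\<kappa> * p > 1" using a s by (auto simp: \<kappa>_def p_def field_simps)
  define C3 where "C3 = 2 * kernel_mean_const c + 4 * bessel_const c"
  have C3: "C3 \<ge> 0" unfolding C3_def kernel_mean_const_def bessel_const_def using c
    by (auto intro!: add_nonneg_nonneg mult_nonneg_nonneg divide_nonneg_nonneg less_imp_le[OF Gamma_real_pos])
  define K where "K = 1 / (1 - 2 powr (1 - \<kappa> * p))"
  have K: "K \<ge> 0" using \<kappa> powr_less_mono[of "1 - \<kappa> * p" 0 2] by (simp add: K_def)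
  define C where "C = (1 + C3 * K) powr \<kappa>"
  have ps: "1 / ereal s = ereal p" using s by (simp add: one_divide_ereal p_def)
  show ?thesis
    unfolding T_bounded_def bounded_Lp_weak_Lq_def ps b_def[symmetric]
  proof (intro exI[of _ C] ballI conjI)
    fix f assume "f \<in> Lp_space (ereal p)"
    then have f: "f \<in> borel_measurable dA" and fp: "integrable dA (\<lambda>w. cmod (f w) powr (1 / s))"
      by (auto simp: Lp_space_def p)
    define g where "g w = f w * of_real (rho w powr b)" for w
    define M where "M = (LINT w|dA. cmod (f w) powr (1 / s))"
    have M0: "M \<ge> 0" by (simp add: M_def)
    have N: "Lp_norm (ereal p) f = M powr s" by (simp add: Lp_norm_def M_def p_def)
    have gi: "integrable dA g"
      unfolding g_def using s c f fp by (intro integrable_mult_rho_powr) (auto simp: b_def)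
    show "AE z in dA. integrable dA (\<lambda>w. T_kernel b c z w * f w)"
    proof (rule AE_I2)
      fix z assume "z \<in> space dA"
      then have "integrable dA (\<lambda>w. g w * (1 - z * cnj w) powr (- of_real c))"
        using c by (intro integrable_kernel_mult gi) auto
      then show "integrable dA (\<lambda>w. T_kernel b c z w * f w)"
        by (simp add: g_def T_kernel_def powr_minus divide_inverse mult_ac)
    qed
    have T: "weighted_int_op a (T_kernel b c) f = (\<lambda>z. of_real (rho z powr a) * cauchy_int c g z)"
      unfolding weighted_int_op_def T_integral_eq_cauchy_int g_def[abs_def] ..
    have Fm: "cauchy_int c g \<in> borel_measurable dA" using c by (intro measurable_cauchy_int gi) auto
    show "weighted_int_op a (T_kernel b c) f \<in> borel_measurable dA"
      unfolding T by (intro borel_measurable_times Fm measurable_dA) measurable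
    have lev: "measure dA {z \<in> unit_disc. rho z powr (- \<kappa>) * cmod (cauchy_int c g z) > t}
      \<le> x0 + C3 * M * t powr (- p) * x0 powr (1 - \<kappa> * p) / (1 - 2 powr (1 - \<kappa> * p))" if "t > 0" "x0 > 0" for t x0
    proof (rule weighted_level_set_le[OF \<kappa>(1,2) _ that Fm])
      show "0 \<le> C3 * M" using C3 M0 by simp
      fix \<alpha> :: real and J :: "real set" assume "\<alpha> > 0" "J \<in> sets borel"
      then show "emeasure dA {z \<in> unit_disc. rho z \<in> J \<and> cmod (cauchy_int c g z) > \<alpha>}
        \<le> ennreal (C3 * M * \<alpha> powr (- p)) * emeasure dA {z \<in> unit_disc. rho z \<in> J}"
        using cauchy_int_weak_type[OF s c b_def f fp, of \<alpha> J] by (simp add: C3_def M_def g_def[abs_def] p_def)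
    qed
    show "weak_Lq_norm (- 1 / a) (weighted_int_op a (T_kernel b c) f) \<le> ennreal (C * Lp_norm (ereal p) f)"
      unfolding weak_Lq_norm_def N
    proof (intro SUP_least ennreal_leI)
      fix t :: real assume "t \<in> {0<..}"
      then have t: "t > 0" by simp
      define m where "m = measure dA {z \<in> unit_disc. rho z powr (- \<kappa>) * cmod (cauchy_int c g z) > t}"
      have m0: "m \<ge> 0" by (simp add: m_def)
      have "t * m powr \<kappa> \<le> C * M powr s"
      proof (cases "M = 0")
        case True
        have "m \<le> x0" if "x0 > 0" for x0 using lev[OF t that] True by (simp add: m_def)
        then have "m \<le> 0" by (meson field_le_epsilon add_0 dense_ge)
        then have "m = 0" using m0 by simp
        then show ?thesis using True by simp
      next
        case False
        then have M: "M > 0" using M0 by simp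
        \<comment> \<open>This height makes
          \<open>M * t powr (- p) * x0 powr (1 - \<kappa> * p)\<close> equal to \<open>x0\<close>,
          so both terms of the level-set bound are multiples of \<open>x0\<close>.\<close>
        define x0 where "x0 = (M powr s / t) powr (1 / \<kappa>)"
        have x0: "x0 > 0" using M t by (simp add: x0_def)
        have x0k: "x0 powr \<kappa> = M powr s / t" using \<kappa> M t by (simp add: x0_def powr_powr)
        have "M * t powr (- p) * x0 powr (1 - \<kappa> * p) = x0"
        proof -
          have "x0 powr (1 - \<kappa> * p) = x0 * (x0 powr \<kappa>) powr (- p)"
            using x0 by (simp add: powr_powr powr_diff powr_minus divide_inverse)
          also have "(x0 powr \<kappa>) powr (- p) = t powr p / M"
            unfolding x0k using M t p by (simp add: powr_divide powr_powr powr_minus field_simps)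
          finally show ?thesis using M t by (simp add: powr_minus field_simps)
        qed
        then have "m \<le> x0 + C3 * K * x0"
          using lev[OF t x0] by (simp add: m_def K_def mult_ac)
        then have "m \<le> (1 + C3 * K) * x0" by (simp add: algebra_simps)
        then have "m powr \<kappa> \<le> ((1 + C3 * K) * x0) powr \<kappa>"
          using m0 \<kappa> by (intro powr_mono2) auto
        also have "\<dots> = C * (M powr s / t)"
          unfolding C_def x0k[symmetric] by (rule powr_mult)
        finally show ?thesis using t by (simp add: field_simps)
      qed
      moreover have "{z \<in> unit_disc. cmod (weighted_int_op a (T_kernel b c) f z) > t}
          = {z \<in> unit_disc. rho z powr (- \<kappa>) * cmod (cauchy_int c g z) > t}"
        unfolding T by (simp add: norm_mult \<kappa>_def)
      ultimately show "t * measure dA {z \<in> unit_disc. cmod (weighted_int_op a (T_kernel b c) f z) > t} powr (1 / (- 1 / a)) \<le> C * M powr s"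
        by (simp add: m_def \<kappa>_def)
    qed
  qed
qed

subsection \<open>Unboundedness of \<open>S\<close>\<close>

lemma nn_integral_inverse_rho_le:
  assumes d: "0 < d" "d < 1"
  shows "(\<integral>\<^sup>+w. ennreal (if rho w > d then 1 / rho w else 0) \<partial>dA) \<le> ennreal (ln (1 / d))"
proof -
  have "(\<integral>\<^sup>+w. ennreal (if rho w > d then 1 / rho w else 0) \<partial>dA)
      = (\<integral>\<^sup>+t\<in>{0..1}. ennreal (if t > d then 1 / t else 0) \<partial>lborel)"
    by (rule nn_integral_dA_rho[of "\<lambda>t. ennreal (if t > d then 1 / t else 0)"]) measurable
  also have "\<dots> \<le> (\<integral>\<^sup>+t. ennreal (1 / t) * indicator {d..1} t \<partial>lborel)"
    by (intro nn_integral_mono) (auto simp: indicator_def)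
  also have "\<dots> = ennreal (ln 1 - ln d)"
    using d by (intro nn_integral_FTC_Icc) (auto intro!: derivative_eq_intros)
  also have "ln 1 - ln d = ln (1 / d)" using d by (simp add: ln_div)
  finally show ?thesis .
qed

text \<open>With p = 1/s the p-th power of the majorant is \<open>M powr p / rho w\<close>, whose
  integral over \<open>rho w > d\<close> is logarithmic in 1/d. For s = 0 the majorant is the
  constant \<open>M\<close> and the logarithm enters with exponent 0.\<close>

lemma Lp_norm_rho_powr_bound:
  fixes f :: "complex \<Rightarrow> complex"
  assumes s: "0 \<le> s" "s < 1" and d: "0 < d" "d < 1" and M: "M \<ge> 0"
    and f [measurable]: "f \<in> borel_measurable dA"
    and le: "\<And>w. cmod w < 1 \<Longrightarrow> cmod (f w) \<le> (if rho w > d then M * rho w powr (- s) else 0)"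
  shows "f \<in> Lp_space (1 / ereal s)" "Lp_norm (1 / ereal s) f \<le> M * ln (1 / d) powr s"
proof -
  have L: "ln (1 / d) > 0" using d by simp
  have "f \<in> Lp_space (1 / ereal s) \<and> Lp_norm (1 / ereal s) f \<le> M * ln (1 / d) powr s"
  proof (cases "s = 0")
    case True
    have "cmod (f w) \<le> M" if "cmod w < 1" for w
      using le[OF that] rho_pos[OF that] True M by (auto split: if_splits)
    then have e: "esssup dA (\<lambda>z. ennreal (cmod (f z))) \<le> ennreal M"
      by (intro esssup_I AE_I2 ennreal_leI) auto
    have "esssup dA (\<lambda>z. ennreal (cmod (f z))) < \<infinity>"
      by (rule le_less_trans[OF e]) simp
    moreover have "enn2real (esssup dA (\<lambda>z. ennreal (cmod (f z)))) \<le> M"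
      using e M by (rule enn2real_leI[rotated])
    ultimately show ?thesis
      using True L f by (simp add: one_divide_ereal Lp_space_def Lp_norm_def)
  next
    case False
    then have s0: "s > 0" using s by simp
    define p where "p = 1 / s"
    have p: "p > 0" "s * p = 1" "1 / p = s" using s0 by (auto simp: p_def)
    have ps: "1 / ereal s = ereal p" using s0 by (simp add: one_divide_ereal p_def)
    have pt: "cmod (f w) powr p \<le> M powr p * (if rho w > d then 1 / rho w else 0)" if "w \<in> space dA" for w
    proof -
      have r: "rho w > 0" using rho_pos[of w] that by simp
      have "cmod (f w) powr p \<le> (if rho w > d then M * rho w powr (- s) else 0) powr p"
        using le[of w] that p by (intro powr_mono2) auto
      also have "\<dots> = M powr p * (if rho w > d then 1 / rho w else 0)"
      proof -
        have "(rho w powr (- s)) powr p = rho w powr (- 1)"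
          unfolding powr_powr using p(2) by simp
        also have "\<dots> = 1 / rho w" using r by (simp add: powr_minus divide_inverse)
        finally show ?thesis by (simp only: powr_mult if_distrib[of "\<lambda>x. x powr p"] powr_0) simp
      qed
      finally show ?thesis .
    qed
    have "(\<integral>\<^sup>+w. ennreal (cmod (f w) powr p) \<partial>dA) \<le> (\<integral>\<^sup>+w. ennreal (M powr p) * ennreal (if rho w > d then 1 / rho w else 0) \<partial>dA)"
      using pt d by (intro nn_integral_mono) (simp add: ennreal_leI flip: ennreal_mult)
    also have "\<dots> = ennreal (M powr p) * (\<integral>\<^sup>+w. ennreal (if rho w > d then 1 / rho w else 0) \<partial>dA)"
      by (intro nn_integral_cmult measurable_dA) measurable
    also have "\<dots> \<le> ennreal (M powr p) * ennreal (ln (1 / d))"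
      by (intro mult_left_mono nn_integral_inverse_rho_le d) auto
    finally have nn: "(\<integral>\<^sup>+w. ennreal (cmod (f w) powr p) \<partial>dA) \<le> ennreal (M powr p * ln (1 / d))"
      using L by (simp only: ennreal_mult powr_ge_zero less_imp_le)
    have int: "integrable dA (\<lambda>w. cmod (f w) powr p)"
    proof (rule integrableI_bounded)
      show "(\<integral>\<^sup>+w. ennreal (norm (cmod (f w) powr p)) \<partial>dA) < \<infinity>"
        using nn ennreal_less_top by (simp add: order.strict_trans1)
    qed measurable
    have "(LINT w|dA. cmod (f w) powr p) \<le> M powr p * ln (1 / d)"
      using nn L by (subst (asm) nn_integral_eq_integral[OF int]) (auto simp: ennreal_le_iff)
    then have "(LINT w|dA. cmod (f w) powr p) powr s \<le> (M powr p * ln (1 / d)) powr s"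
      using s0 by (intro powr_mono2) auto
    also have "\<dots> = M * ln (1 / d) powr s"
      using M p by (simp add: powr_mult powr_powr mult.commute)
    finally show ?thesis
      unfolding ps using f int p by (simp add: Lp_space_def Lp_norm_def)
  qed
  then show "f \<in> Lp_space (1 / ereal s)" "Lp_norm (1 / ereal s) f \<le> M * ln (1 / d) powr s" by auto
qed

text \<open>For the exponent -1/a the measure of a level set enters with the power -a, which cancels
  the factor \<open>\<epsilon> powr a\<close> of the level. Only the relative size of
  \<open>X\<close> and the unweighted height \<tau> remain, so a lower bound is as strong near the
  boundary as elsewhere.\<close>

lemma weak_norm_annulus_bound:
  assumes a: "a < 0" and B: "weak_Lq_norm (- 1 / a) h \<le> ennreal B" "B \<ge> 0"
    and h [measurable]: "h \<in> borel_measurable dA" and \<epsilon>: "\<epsilon> > 0" and \<tau>: "\<tau> > 0"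
    and X: "X \<subseteq> unit_disc" "\<And>z. z \<in> X \<Longrightarrow> cmod (h z) > \<epsilon> powr a * \<tau>"
  shows "\<tau> * (measure dA X / \<epsilon>) powr (- a) \<le> B"
proof -
  define t where "t = \<epsilon> powr a * \<tau>"
  have t: "t > 0" using \<epsilon> \<tau> by (simp add: t_def)
  have "{z \<in> space dA. cmod (h z) > t} \<in> sets dA" by measurable
  then have "measure dA X \<le> measure dA {z \<in> unit_disc. cmod (h z) > t}"
    using X by (intro dA.finite_measure_mono) (auto simp: t_def)
  then have "t * measure dA X powr (- a) \<le> t * measure dA {z \<in> unit_disc. cmod (h z) > t} powr (- a)"
    using a t by (intro mult_left_mono powr_mono2) auto
  moreover have "t * measure dA {z \<in> unit_disc. cmod (h z) > t} powr (- a) \<le> B"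
  proof -
    have "ennreal (t * measure dA {z \<in> unit_disc. cmod (h z) > t} powr (- a)) \<le> weak_Lq_norm (- 1 / a) h"
      unfolding weak_Lq_norm_def using t by (intro SUP_upper2[of t]) auto
    also have "\<dots> \<le> ennreal B" by (rule B)
    finally show ?thesis using B(2) by (simp only: ennreal_le_iff)
  qed
  moreover have "\<tau> * (measure dA X / \<epsilon>) powr (- a) = t * measure dA X powr (- a)"
    using \<epsilon> by (simp add: powr_divide powr_minus t_def field_simps)
  ultimately show ?thesis by simp
qed

lemma not_bounded_powr:
  fixes \<alpha> :: real
  assumes "\<alpha> > 0"
  obtains N :: nat where "N \<ge> 1" "real N powr \<alpha> > K"
proof -
  obtain N :: nat where N: "(\<bar>K\<bar> + 1) powr (1 / \<alpha>) < real N"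
    using reals_Archimedean2 by blast
  have "((\<bar>K\<bar> + 1) powr (1 / \<alpha>)) powr \<alpha> < real N powr \<alpha>"
    using N assms by (intro powr_less_mono2) auto
  then have "K < real N powr \<alpha>" using assms by (simp add: powr_powr)
  moreover have "N \<ge> 1" using N by (cases N) (auto simp: not_less[symmetric])
  ultimately show ?thesis using that by blast
qed

section \<open>Lower bound for the integral with the positive kernel\<close>

lemma measure_dA_ball:
  assumes "ball x r \<subseteq> unit_disc" "r \<ge> 0"
  shows "measure dA (ball x r) = r\<^sup>2"
proof -
  have "emeasure dA (ball x r) = ennreal (1 / pi) * ennreal (pi * r\<^sup>2)"
    using assms by (subst emeasure_dA_borel) (auto simp: emeasure_ball unit_ball_vol_2)
  also have "\<dots> = ennreal (r\<^sup>2)" by (simp flip: ennreal_mult)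
  finally show ?thesis by (simp add: measure_def)
qed

text \<open>A power is increasing or decreasing according to the sign of its exponent; the minimum
  covers both. It is applied with the exponents c - 2 and b, which may have either sign.\<close>

lemma powr_between_ge:
  fixes r x y e :: real
  assumes "0 < r" "r \<le> x" "x \<le> y"
  shows "min (r powr e) (y powr e) \<le> x powr e"
proof (cases "e \<ge> 0")
  case True
  then have "r powr e \<le> x powr e" using assms by (intro powr_mono2) auto
  then show ?thesis by simp
next
  case False
  then have "y powr e \<le> x powr e" using assms by (intro powr_mono2') auto
  then show ?thesis by simp
qed

text \<open>Each of the disjoint balls of radius \<open>(1/4) ^ k / 2\<close> around \<open>(1 - (1/4) ^ k) z / |z|\<close>,
  \<open>1 \<le> k \<le> N\<close>, contributes at least a constant.\<close>

lemma S_integral_lower_bound: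
  fixes N :: nat
  assumes c: "c > 1" and b: "b > -1" "b = c - 2 + s" and s: "s \<ge> 0"
    and z: "cmod z < 1" "rho z \<le> (1/4) ^ N" and N: "N \<ge> 1"
  defines "f \<equiv> \<lambda>w. if rho w > (1/4) ^ N / 4 then rho w powr (- s) else 0"
    and "\<kappa> \<equiv> 3 powr (- c) * min ((1/2) powr (c - 2)) (3 powr (c - 2))"
  shows "real N * (\<kappa> / 4) \<le> (LINT w|dA. rho w powr b / cmod (1 - z * cnj w) powr c * f w)"
proof -
  let ?h = "\<lambda>w. rho w powr b / cmod (1 - z * cnj w) powr c * f w"
  let ?\<delta> = "(1/4) ^ N / 4 :: real"
  have \<kappa>: "\<kappa> > 0" by (simp add: \<kappa>_def)
  have fm: "f \<in> borel_measurable borel" unfolding f_def by measurable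
  have h0: "?h w \<ge> 0" for w by (simp add: f_def)
  \<comment> \<open>Comparison from below requires integrability first, since a non-integrable
    function has Bochner integral 0.\<close>
  have hi: "integrable dA ?h"
  proof (rule Bochner_Integration.integrable_bound)
    show "integrable dA (\<lambda>w. rho w powr b * ((1 - cmod z) powr (- c) * ?\<delta> powr (- s)))"
      by (intro integrable_mult_left integrable_rho_powr b(1))
    show "?h \<in> borel_measurable dA"
      by (intro measurable_dA borel_measurable_times fm) measurable
    show "AE w in dA. norm (?h w) \<le> norm (rho w powr b * ((1 - cmod z) powr (- c) * ?\<delta> powr (- s)))"
    proof (rule AE_I2)
      fix w assume "w \<in> space dA"
      then have w: "cmod w < 1" by simp
      have "f w \<le> ?\<delta> powr (- s)" unfolding f_def using s by (auto intro!: powr_mono2')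
      moreover have "1 / cmod (1 - z * cnj w) powr c \<le> (1 - cmod z) powr (- c)"
        using one_minus_mult_cnj_bounds[OF z(1) w] z(1) c
        by (simp add: powr_minus divide_inverse powr_mono2 flip: inverse_eq_divide)
      ultimately have "rho w powr b * (1 / cmod (1 - z * cnj w) powr c * f w)
          \<le> rho w powr b * ((1 - cmod z) powr (- c) * ?\<delta> powr (- s))"
        by (intro mult_left_mono mult_mono) (auto simp: f_def)
      then show "norm (?h w) \<le> norm (rho w powr b * ((1 - cmod z) powr (- c) * ?\<delta> powr (- s)))"
        using h0[of w] by (simp add: abs_mult)
    qed
  qed
  have q1: "(1/4 :: real) ^ k \<le> 1/4" if "k \<ge> 1" for k :: nat
    using that power_decreasing[of 1 k "1/4 :: real"] by simp
  have z0: "z \<noteq> 0" using z(2) q1[OF N] by auto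
  define u where "u = z / of_real (cmod z)"
  have u: "cmod u = 1" "z = of_real (cmod z) * u" using z0 by (simp_all add: u_def norm_divide)
  have z1: "1 - cmod z \<le> (1/4) ^ N"
  proof -
    have "(cmod z)\<^sup>2 \<le> cmod z" using z(1) by (simp add: power2_eq_square mult_left_le)
    then show ?thesis using z(2) by simp
  qed
  define r where "r k = (1/4 :: real) ^ k" for k :: nat
  define B where "B k = ball (of_real (1 - r k) * u) (r k / 2)" for k
  have r: "r k > 0" for k by (simp add: r_def)
  \<comment> \<open>On \<open>B k\<close> the quantities \<open>1 - cmod w\<close> and
    \<open>rho w\<close> are comparable to \<open>r k\<close>, and
    \<open>cmod (1 - z * cnj w)\<close> is at most \<open>3 * r k\<close>. The last bound uses that
    z is at least as close to the circle:
    \<open>1 - cmod z \<le> (1/4) ^ N \<le> r k\<close>.\<close>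
  have inB: "r k / 2 < 1 - cmod w" "1 - cmod w < 3 * r k / 2" "cmod w < 1" "cmod (1 - z * cnj w) \<le> 3 * r k"
    "r k / 2 \<le> rho w" "rho w \<le> 3 * r k"
    if w: "w \<in> B k" and k: "1 \<le> k" "k \<le> N" for w k
  proof -
    have rk: "r k \<le> 1/4" using q1[OF k(1)] by (simp add: r_def)
    have n1: "cmod (of_real (1 - r k) * u) = 1 - r k" using rk by (simp add: norm_mult u(1) del: of_real_diff)
    have d: "cmod (of_real (1 - r k) * u - w) < r k / 2" using w by (simp add: B_def dist_norm)
    show 1: "r k / 2 < 1 - cmod w" using norm_triangle_ineq3[of "of_real (1 - r k) * u" w] n1 d by linarith
    show 2: "1 - cmod w < 3 * r k / 2" using norm_triangle_ineq3[of "of_real (1 - r k) * u" w] n1 d by linarith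
    show w1: "cmod w < 1" using 1 r[of k] by linarith
    have rho: "rho w = (1 - cmod w) * (1 + cmod w)" by (simp add: power2_eq_square algebra_simps)
    have "(1 - cmod w) * 1 \<le> rho w" unfolding rho using w1 by (intro mult_left_mono) auto
    then show "r k / 2 \<le> rho w" using 1 by simp
    have "rho w \<le> (1 - cmod w) * 2" unfolding rho using w1 by (intro mult_left_mono) auto
    then show "rho w \<le> 3 * r k" using 2 by simp
    have "u * cnj u = 1" using u by (simp flip: complex_norm_square)
    then have "1 - z * cnj w = of_real (1 - cmod z * (1 - r k)) + z * cnj (of_real (1 - r k) * u - w)"
    proof -
      have "z * cnj (of_real (1 - r k) * u) = (of_real (cmod z) * u) * cnj (of_real (1 - r k) * u)"
        by (subst u(2)[symmetric]) (rule refl)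
      also have "\<dots> = of_real (cmod z * (1 - r k)) * (u * cnj u)"
        by (simp add: mult_ac)
      finally show ?thesis unfolding \<open>u * cnj u = 1\<close> by (simp add: algebra_simps)
    qed
    then have "cmod (1 - z * cnj w) \<le> \<bar>1 - cmod z * (1 - r k)\<bar> + cmod z * cmod (of_real (1 - r k) * u - w)"
      using norm_triangle_ineq[of "of_real (1 - cmod z * (1 - r k))" "z * cnj (of_real (1 - r k) * u - w)"]
      by (simp only: norm_mult complex_mod_cnj norm_of_real)
    moreover have "cmod z * cmod (of_real (1 - r k) * u - w) \<le> 1 * (r k / 2)"
      using z(1) d by (intro mult_mono) auto
    moreover have "\<bar>1 - cmod z * (1 - r k)\<bar> \<le> 2 * r k"
    proof -
      have "cmod z * (1 - r k) \<le> 1 * 1" using z(1) rk r[of k] by (intro mult_mono) auto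
      moreover have "cmod z * r k \<le> 1 * r k" using z(1) r[of k] by (intro mult_right_mono) auto
      moreover have "(1/4) ^ N \<le> r k" unfolding r_def using k by (intro power_decreasing) auto
      ultimately show ?thesis using z1 by (simp add: algebra_simps)
    qed
    ultimately show "cmod (1 - z * cnj w) \<le> 3 * r k" using r[of k] by linarith
  qed
  have Bsub: "B k \<subseteq> unit_disc" if "1 \<le> k" "k \<le> N" for k
    using inB(3)[OF _ that] by auto
  \<comment> \<open>The ranges (r/2, 3r/2) of \<open>1 - cmod w\<close> are disjoint because the
    radii shrink by 4 and 3/8 < 1/2.\<close>
  have uniq: "k = l" if "w \<in> B k" "w \<in> B l" "1 \<le> k" "k \<le> N" "1 \<le> l" "l \<le> N" for w k l
  proof (rule ccontr)
    assume "k \<noteq> l"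
    then consider "k < l" | "l < k" by linarith
    then show False
    proof cases
      case 1
      then have "r l \<le> r (Suc k)" unfolding r_def by (intro power_decreasing) auto
      then have "r l \<le> r k / 4" by (simp add: r_def)
      then show False using inB(1)[OF that(1,3,4)] inB(2)[OF that(2,5,6)] r[of l] by linarith
    next
      case 2
      then have "r k \<le> r (Suc l)" unfolding r_def by (intro power_decreasing) auto
      then have "r k \<le> r l / 4" by (simp add: r_def)
      then show False using inB(1)[OF that(2,5,6)] inB(2)[OF that(1,3,4)] r[of k] by linarith
    qed
  qed
  \<comment> \<open>The ball lies above the cut-off height, so the integrand is the power c - 2 = b
    - s of \<open>rho w\<close> over the power c of the distance. Its order is
    \<open>1 / (r k)\<^sup>2\<close>, which cancels against the area
    \<open>(r k / 2)\<^sup>2\<close>.\<close>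
  have hB: "\<kappa> / (r k)\<^sup>2 \<le> ?h w" if w: "w \<in> B k" and k: "1 \<le> k" "k \<le> N" for w k
  proof -
    note i = inB[OF w k]
    have rp: "rho w > 0" using rho_pos[OF i(3)] .
    have "r N \<le> r k" unfolding r_def using k by (intro power_decreasing) auto
    moreover have "?\<delta> = r N / 4" by (simp add: r_def)
    ultimately have "?\<delta> < rho w" using i(5) r[of k] r[of N] by linarith
    then have f: "f w = rho w powr (- s)" by (simp add: f_def)
    have "\<kappa> / (r k)\<^sup>2 = min ((1/2) powr (c - 2) * r k powr (c - 2)) (3 powr (c - 2) * r k powr (c - 2)) * (3 * r k) powr (- c)"
    proof -
      let ?m = "min ((1/2) powr (c - 2)) (3 powr (c - 2))"
      have "\<kappa> / (r k)\<^sup>2 = ?m * 3 powr (- c) * (1 / (r k)\<^sup>2)"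
        by (simp add: \<kappa>_def)
      also have "1 / (r k)\<^sup>2 = r k powr (c - 2) * r k powr (- c)"
        using r[of k] by (simp add: powr_minus powr_diff divide_inverse powr_numeral)
      also have "?m * 3 powr (- c) * (r k powr (c - 2) * r k powr (- c)) = (?m * r k powr (c - 2)) * (3 * r k) powr (- c)"
        by (simp add: powr_mult)
      also have "?m * r k powr (c - 2) = min ((1/2) powr (c - 2) * r k powr (c - 2)) (3 powr (c - 2) * r k powr (c - 2))"
        by (simp add: min_mult_distrib_right)
      finally show ?thesis .
    qed
    also have "\<dots> = min ((r k / 2) powr (c - 2)) ((3 * r k) powr (c - 2)) * (3 * r k) powr (- c)"
      using r[of k] by (simp add: powr_mult powr_divide)
    also have "\<dots> \<le> rho w powr (c - 2) * cmod (1 - z * cnj w) powr (- c)"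
      using i r[of k] c one_minus_mult_cnj_bounds(1)[OF z(1) i(3)]
      by (intro mult_mono powr_between_ge powr_mono2') auto
    also have "rho w powr (c - 2) = rho w powr b * rho w powr (- s)"
      unfolding powr_add[symmetric] b(2) by simp
    finally show ?thesis by (simp add: f powr_minus divide_inverse mult_ac)
  qed
  have "real N * (\<kappa> / 4) = (\<Sum>k=1..N. \<kappa> / (r k)\<^sup>2 * measure dA (B k))"
  proof -
    have "\<kappa> / (r k)\<^sup>2 * measure dA (B k) = \<kappa> / 4" if "k \<in> {1..N}" for k
    proof -
      have "measure dA (B k) = (r k / 2)\<^sup>2"
        unfolding B_def using Bsub[of k] that r[of k] by (intro measure_dA_ball) (auto simp: B_def)
      then show ?thesis using less_imp_neq[OF r[of k]] by (simp only:) (simp add: power_divide)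
    qed
    then have "(\<Sum>k=1..N. \<kappa> / (r k)\<^sup>2 * measure dA (B k)) = (\<Sum>k=1..N. \<kappa> / 4)"
      by (rule sum.cong[OF refl])
    then show ?thesis by (simp only: sum_constant card_atLeastAtMost One_nat_def diff_Suc_Suc minus_nat.diff_0)
  qed
  also have "\<dots> = (LINT w|dA. (\<Sum>k=1..N. \<kappa> / (r k)\<^sup>2 * indicator (B k) w))"
  proof -
    have Bs: "B k \<in> sets dA" if "k \<in> {1..N}" for k
      using measurable_sets[OF measurable_id_dA, of "B k"] Bsub[of k] that
      by (simp add: B_def vimage_def Int_absorb2)
    have ii: "integrable dA (\<lambda>w. \<kappa> / (r k)\<^sup>2 * indicator (B k) w)" if "k \<in> {1..N}" for k
      using Bs[OF that] by (intro integrable_mult_right integrable_real_indicator) (auto simp: dA.emeasure_finite less_top[symmetric])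
    show ?thesis
    proof (subst Bochner_Integration.integral_sum[OF ii])
      show "(\<Sum>k=1..N. \<kappa> / (r k)\<^sup>2 * measure dA (B k)) = (\<Sum>k=1..N. LINT w|dA. \<kappa> / (r k)\<^sup>2 * indicator (B k) w)"
      proof (rule sum.cong[OF refl])
        fix k assume k: "k \<in> {1..N}"
        then have "B k \<inter> space dA = B k" using Bsub[of k] by auto
        then show "\<kappa> / (r k)\<^sup>2 * measure dA (B k) = (LINT w|dA. \<kappa> / (r k)\<^sup>2 * indicator (B k) w)"
          by simp
      qed
    qed
  qed
  also have "\<dots> \<le> (LINT w|dA. ?h w)"
  proof (rule integral_mono'[OF hi])
    fix w assume "w \<in> space dA"
    show "(\<Sum>k=1..N. \<kappa> / (r k)\<^sup>2 * indicator (B k) w) \<le> ?h w"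
    proof (cases "\<exists>l\<in>{1..N}. w \<in> B l")
      case True
      then obtain l where l: "l \<in> {1..N}" "w \<in> B l" by blast
      have "(\<Sum>k=1..N. \<kappa> / (r k)\<^sup>2 * indicator (B k) w) = (\<Sum>k=1..N. if k = l then \<kappa> / (r l)\<^sup>2 else 0)"
      proof (rule sum.cong[OF refl])
        fix k assume k: "k \<in> {1..N}"
        have "w \<notin> B k" if "k \<noteq> l"
          using uniq[of w k l] that k l by auto
        then show "\<kappa> / (r k)\<^sup>2 * indicator (B k) w = (if k = l then \<kappa> / (r l)\<^sup>2 else 0)"
          using l(2) by (cases "k = l") simp_all
      qed
      also have "\<dots> = \<kappa> / (r l)\<^sup>2" using l by simp
      also have "\<dots> \<le> ?h w" using hB[of w l] l by auto
      finally show ?thesis .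
    next
      case False
      then have "(\<Sum>k=1..N. \<kappa> / (r k)\<^sup>2 * indicator (B k) w) = 0" by (intro sum.neutral) auto
      then show ?thesis using h0 by simp
    qed
  qed (rule h0)
  finally show ?thesis .
qed

section \<open>Comparing growth in N with an assumed operator bound\<close>

lemma ln_inverse_power_four_le:
  assumes "N \<ge> 1"
  shows "ln (1 / ((1/4) ^ N / 4)) \<le> 4 * real N"
proof -
  have "1 / ((1/4) ^ N / 4) = (4 :: real) ^ (N + 1)" by (simp add: power_one_over)
  then have "ln (1 / ((1/4 :: real) ^ N / 4)) = real (N + 1) * ln 4"
    by (simp only: ln_realpow zero_less_numeral)
  also have "ln (4 :: real) = 2 * ln 2" using ln_realpow[of "2 :: real" 2] by simp
  also have "real (N + 1) * (2 * ln 2) \<le> real (N + 1) * (2 * 1)"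
    using ln_2_less_1 by (intro mult_left_mono) auto
  also have "\<dots> \<le> 4 * real N" using assms by simp
  finally show ?thesis .
qed

text \<open>Here s is the growth exponent of the norms of the test functions and e that of their
  images: e = 1 for the positive kernel, e = 1/2 for the lacunary polynomials.\<close>

lemma growth_contradiction:
  assumes s: "s < e" and k: "k > 0" and A: "A \<ge> 0"
    and le: "\<And>N::nat. N \<ge> 1 \<Longrightarrow> k * real N powr e \<le> A * (4 * real N) powr s"
  shows False
proof -
  obtain N :: nat where N: "N \<ge> 1" "real N powr (e - s) > A * 4 powr s / k"
    using not_bounded_powr[of "e - s" "A * 4 powr s / k"] s by auto
  have "A * 4 powr s < k * real N powr (e - s)"
    using N(2) k by (simp add: field_simps)
  then have "A * 4 powr s * real N powr s < k * real N powr (e - s) * real N powr s"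
    using N by (intro mult_strict_right_mono) auto
  also have "\<dots> = k * real N powr e" by (simp flip: powr_add)
  also have "\<dots> \<le> A * 4 powr s * real N powr s" using le[OF N(1)] by (simp add: powr_mult)
  finally show False by simp
qed

text \<open>The logarithm in the norm bound is at most \<open>4 * real N\<close> for this cut-off.
  The assumed constant \<open>C\<close> may be negative, hence its absolute value.\<close>

lemma weak_norm_bound_of_test_function:
  assumes "\<forall>f\<in>Lp_space (1 / ereal s). (AE z in dA. integrable dA (\<lambda>w. K z w * f w)) \<and>
        weighted_int_op a K f \<in> borel_measurable dA \<and>
        weak_Lq_norm q (weighted_int_op a K f) \<le> ennreal (C * Lp_norm (1 / ereal s) f)"
    and s: "0 \<le> s" "s < 1" and N: "N \<ge> 1" and M: "M \<ge> 0"
    and f: "f \<in> borel_measurable dA"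
    and le: "\<And>w. cmod w < 1 \<Longrightarrow> cmod (f w) \<le> (if rho w > (1/4) ^ N / 4 then M * rho w powr (- s) else 0)"
  shows "weighted_int_op a K f \<in> borel_measurable dA"
    and "weak_Lq_norm q (weighted_int_op a K f) \<le> ennreal (\<bar>C\<bar> * M * (4 * real N) powr s)"
proof -
  let ?d = "(1/4) ^ N / 4 :: real"
  have d: "0 < ?d" "?d < 1" using power_le_one[of "1/4 :: real" N] by (auto intro: le_less_trans[of _ "1/4"])
  note L = Lp_norm_rho_powr_bound[OF s d M f le]
  show "weighted_int_op a K f \<in> borel_measurable dA" using assms(1) L(1) by blast
  have "C * Lp_norm (1 / ereal s) f \<le> \<bar>C\<bar> * Lp_norm (1 / ereal s) f"
    by (intro mult_right_mono) (auto simp: Lp_norm_def)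
  also have "\<dots> \<le> \<bar>C\<bar> * (M * ln (1 / ?d) powr s)" by (intro mult_left_mono L) auto
  also have "\<dots> \<le> \<bar>C\<bar> * (M * (4 * real N) powr s)"
    using d s M by (intro mult_left_mono powr_mono2 ln_inverse_power_four_le N) auto
  finally have "C * Lp_norm (1 / ereal s) f \<le> \<bar>C\<bar> * M * (4 * real N) powr s" by (simp add: mult_ac)
  then show "weak_Lq_norm q (weighted_int_op a K f) \<le> ennreal (\<bar>C\<bar> * M * (4 * real N) powr s)"
    using assms(1) L(1) by (meson ennreal_leI order_trans)
qed

text \<open>For the truncated power of \<open>rho\<close> the integral is at least a multiple of N
  throughout the annulus \<open>rho z \<le> (1/4) ^ N\<close>, while the norm is only of order N to
  the power s < 1.\<close>

lemma not_S_bounded: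
  assumes s: "0 \<le> s" "s < 1" and c: "c > 1" and b: "c - 2 + s > -1" and a: "a < 0"
  shows "\<not> S_bounded a (c - 2 + s) c (1 / ereal s) (- 1 / a)"
proof
  define b where "b = c - 2 + s"
  assume "S_bounded a (c - 2 + s) c (1 / ereal s) (- 1 / a)"
  then obtain C where C: "\<forall>f\<in>Lp_space (1 / ereal s). (AE z in dA. integrable dA (\<lambda>w. S_kernel b c z w * f w)) \<and>
        weighted_int_op a (S_kernel b c) f \<in> borel_measurable dA \<and>
        weak_Lq_norm (- 1 / a) (weighted_int_op a (S_kernel b c) f) \<le> ennreal (C * Lp_norm (1 / ereal s) f)"
    unfolding S_bounded_def bounded_Lp_weak_Lq_def b_def by blast
  define \<kappa> :: real where "\<kappa> = 3 powr (- c) * min ((1/2) powr (c - 2)) (3 powr (c - 2))"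
  have \<kappa>: "\<kappa> > 0" by (simp add: \<kappa>_def)
  show False
  proof (rule growth_contradiction)
    show "s < 1" by (rule s)
    show "\<kappa> / 8 > 0" using \<kappa> by simp
    show "\<bar>C\<bar> \<ge> 0" by simp
    fix N :: nat assume N: "N \<ge> 1"
    define f where "f w = (if rho w > (1/4) ^ N / 4 then rho w powr (- s) else 0)" for w
    let ?f = "\<lambda>w. complex_of_real (f w)"
    have fm: "?f \<in> borel_measurable dA" unfolding f_def by (rule measurable_dA) measurable
    have fle: "cmod (?f w) \<le> (if rho w > (1/4) ^ N / 4 then 1 * rho w powr (- s) else 0)" for w
      by (simp add: f_def)
    note W = weak_norm_bound_of_test_function[OF C s N zero_le_one fm fle]
    define I where "I z = (LINT w|dA. rho w powr b / cmod (1 - z * cnj w) powr c * f w)" for z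
    have op: "weighted_int_op a (S_kernel b c) ?f z = of_real (rho z powr a * I z)" for z
      unfolding weighted_int_op_def S_kernel_def I_def of_real_mult
      by (subst integral_complex_of_real[symmetric]) simp
    let ?X = "{z \<in> unit_disc. rho z \<in> {0<..(1/4) ^ N}}" and ?e = "(1/4 :: real) ^ N"
    have X: "measure dA ?X = ?e"
      using emeasure_dA_rho_Ioc[of 0 ?e] power_le_one[of "1/4 :: real" N] by (simp add: measure_def)
    \<comment> \<open>The annulus has measure exactly \<open>?e\<close>, so the ratio is 1. The
      height is half of the proved lower bound, which makes the level inequality strict.\<close>
    have "(real N * (\<kappa> / 8)) * (measure dA ?X / ?e) powr (- a) \<le> \<bar>C\<bar> * 1 * (4 * real N) powr s"
    proof (rule weak_norm_annulus_bound[OF a W(2) _ W(1)])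
      fix z assume z: "z \<in> ?X"
      have "real N * (\<kappa> / 4) \<le> I z"
        unfolding I_def f_def \<kappa>_def using z c b s N by (intro S_integral_lower_bound) (auto simp: b_def)
      moreover have "real N * (\<kappa> / 8) < real N * (\<kappa> / 4)" using N \<kappa> by simp
      ultimately have I: "real N * (\<kappa> / 8) < I z" by (rule less_le_trans[rotated])
      have "?e powr a * (real N * (\<kappa> / 8)) \<le> rho z powr a * (real N * (\<kappa> / 8))"
        using z a \<kappa> by (intro mult_right_mono powr_mono2') auto
      also have "\<dots> < rho z powr a * I z" using I z by (intro mult_strict_left_mono) auto
      also have "\<dots> \<le> cmod (weighted_int_op a (S_kernel b c) ?f z)" unfolding op by (simp only: norm_of_real abs_ge_self)
      finally show "?e powr a * (real N * (\<kappa> / 8)) < cmod (weighted_int_op a (S_kernel b c) ?f z)" .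
    qed (use N \<kappa> in auto)
    then show "\<kappa> / 8 * real N powr 1 \<le> \<bar>C\<bar> * (4 * real N) powr s"
      unfolding X by (simp add: mult_ac)
  qed
qed

subsection \<open>Unboundedness of \<open>T\<close>\<close>

definition poly_sq :: "complex poly \<Rightarrow> real" where
  "poly_sq p = (\<Sum>i\<le>degree p. (cmod (coeff p i))\<^sup>2)"

lemma poly_sq_eq: "degree p < n \<Longrightarrow> poly_sq p = (\<Sum>i<n. (cmod (coeff p i))\<^sup>2)"
  unfolding poly_sq_def by (intro sum.mono_neutral_left) (auto simp: coeff_eq_0)

lemma poly_eq_sum: "degree p < n \<Longrightarrow> poly p (z :: complex) = (\<Sum>i<n. coeff p i * z ^ i)"
  unfolding poly_altdef by (intro sum.mono_neutral_left) (auto simp: coeff_eq_0)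

lemma poly_sq_smult: "poly_sq (smult k p) = (cmod k)\<^sup>2 * poly_sq p"
  using poly_sq_eq[of "smult k p" "Suc (degree p)"] poly_sq_eq[of p "Suc (degree p)"]
  by (simp add: le_imp_less_Suc degree_smult_le norm_mult power_mult_distrib sum_distrib_left del: sum.lessThan_Suc)

text \<open>Multiplication by the monomial moves the coefficients of \<open>q\<close> past those of
  \<open>p\<close>, so the two index ranges are disjoint.\<close>

lemma poly_sq_add_shift:
  assumes n: "degree p < n"
  shows "poly_sq (p + monom 1 n * q) = poly_sq p + poly_sq q"
proof -
  let ?K = "Suc (degree q)"
  have split: "(\<Sum>i<n + K. G i) = (\<Sum>i<n. G i) + (\<Sum>i<K. G (i + n))" for G :: "nat \<Rightarrow> real" and K
    by (induction K) (simp_all add: add_ac)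
  have "degree (p + monom 1 n * q) \<le> max (degree p) (n + degree q)"
    by (intro order_trans[OF degree_add_le_max] max.mono order_trans[OF degree_mult_le]) (auto simp: degree_monom_eq)
  then have "degree (p + monom 1 n * q) < n + ?K" using n by linarith
  then have "poly_sq (p + monom 1 n * q) = (\<Sum>i<n + ?K. (cmod (coeff (p + monom 1 n * q) i))\<^sup>2)"
    by (rule poly_sq_eq)
  also have "\<dots> = (\<Sum>i<n. (cmod (coeff (p + monom 1 n * q) i))\<^sup>2) + (\<Sum>i<?K. (cmod (coeff (p + monom 1 n * q) (i + n)))\<^sup>2)"
    by (rule split)
  also have "(\<Sum>i<n. (cmod (coeff (p + monom 1 n * q) i))\<^sup>2) = poly_sq p"
    unfolding poly_sq_eq[OF n] by (intro sum.cong) (auto simp: coeff_monom_mult)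
  also have "(\<Sum>i<?K. (cmod (coeff (p + monom 1 n * q) (i + n)))\<^sup>2) = poly_sq q"
    unfolding poly_sq_eq[OF lessI] using n by (intro sum.cong refl) (auto simp: coeff_monom_mult coeff_eq_0)
  finally show ?thesis .
qed

definition lacunary :: "nat \<Rightarrow> complex poly" where
  "lacunary N = (\<Sum>k<N. monom 1 (4 ^ k))"

lemma lacunary_Suc: "lacunary (Suc N) = lacunary N + monom 1 (4 ^ N) * 1"
  by (simp add: lacunary_def)

lemma poly_lacunary: "poly (lacunary N) z = (\<Sum>k<N. z ^ (4 ^ k))"
  by (simp add: lacunary_def poly_sum poly_monom)

text \<open>The factor 2 leaves room for the square: it too has degree below the next frequency
  \<open>4 ^ N\<close>.\<close>

lemma degree_lacunary: "2 * degree (lacunary N) < 4 ^ N"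
proof (induction N)
  case (Suc N)
  have "degree (lacunary (Suc N)) \<le> max (degree (lacunary N)) (4 ^ N)"
    unfolding lacunary_Suc by (intro order_trans[OF degree_add_le_max]) (simp add: degree_monom_eq)
  also have "\<dots> \<le> 4 ^ N" using Suc by simp
  finally show ?case by (simp add: le_less_trans[of _ "2 * 4 ^ N"])
qed (simp add: lacunary_def)

lemma poly_sq_lacunary: "poly_sq (lacunary N) = N"
proof (induction N)
  case (Suc N)
  have "degree (lacunary N) < 4 ^ N" using degree_lacunary[of N] by simp
  then have "poly_sq (lacunary (Suc N)) = poly_sq (lacunary N) + poly_sq 1"
    unfolding lacunary_Suc by (rule poly_sq_add_shift)
  then show ?case using Suc by (simp add: poly_sq_def)
qed (simp add: lacunary_def poly_sq_def)

text \<open>Adding the next monomial to F splits the new square into the old square, the shifted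
  \<open>2 F\<close> and a single monomial of twice the frequency. Their index ranges are disjoint,
  so the quantity grows by 4 * N + 1 at each step; this controls the fourth moment.\<close>

lemma poly_sq_lacunary_square: "poly_sq (lacunary N ^ 2) \<le> 2 * (real N)\<^sup>2"
proof (induction N)
  case (Suc N)
  let ?F = "lacunary N" and ?m = "monom 1 (4 ^ N) :: complex poly"
  have eq: "lacunary (Suc N) ^ 2 = ?F ^ 2 + ?m * (smult 2 ?F + ?m * 1)"
  proof -
    have "smult 2 ?F = ?F + ?F" by (metis smult_add_left one_add_one smult_1_left)
    then show ?thesis unfolding lacunary_Suc by (simp add: power2_eq_square algebra_simps)
  qed
  have d1: "degree (?F ^ 2) < 4 ^ N"
    using degree_lacunary[of N] degree_power_le[of ?F 2] by linarith
  have d2: "degree (smult 2 ?F) < 4 ^ N" using degree_lacunary[of N] by simp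
  have "poly_sq (lacunary (Suc N) ^ 2) = poly_sq (?F ^ 2) + (4 * real N + 1)"
    unfolding eq poly_sq_add_shift[OF d1] poly_sq_add_shift[OF d2] poly_sq_smult poly_sq_lacunary
    by (simp add: poly_sq_def)
  also have "\<dots> \<le> 2 * (real (Suc N))\<^sup>2" using Suc by (simp add: power2_eq_square algebra_simps)
  finally show ?case .
qed (simp add: lacunary_def poly_sq_def)

section \<open>Square means of polynomials over thin annuli at the boundary\<close>

context
  fixes \<epsilon> :: real
  assumes \<epsilon>: "0 < \<epsilon>" "\<epsilon> < 1"
begin

private abbreviation "ann \<equiv> indicator {0<..\<epsilon>} :: real \<Rightarrow> real"

lemma annulus_integrable:
  shows "integrable dA (\<lambda>w. ann (rho w))" "(LINT w|dA. ann (rho w)) = \<epsilon>"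
    "integrable dA (\<lambda>w. ann (rho w) * cmod w ^ k)"
proof -
  have e: "(LINT w|dA. ann (rho w)) = (LINT w|dA. indicator {w \<in> unit_disc. rho w \<in> {0<..\<epsilon>}} w)"
    by (intro Bochner_Integration.integral_cong) (auto simp: indicator_def)
  have "{w \<in> unit_disc. rho w \<in> {0<..\<epsilon>}} \<inter> space dA = {w \<in> unit_disc. rho w \<in> {0<..\<epsilon>}}" by auto
  then have "(LINT w|dA. ann (rho w)) = measure dA {w \<in> unit_disc. rho w \<in> {0<..\<epsilon>}}"
    unfolding e by simp
  then show "(LINT w|dA. ann (rho w)) = \<epsilon>"
    using emeasure_dA_rho_Ioc[of 0 \<epsilon>] \<epsilon> by (simp add: measure_def)
  show "integrable dA (\<lambda>w. ann (rho w))" "integrable dA (\<lambda>w. ann (rho w) * cmod w ^ k)"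
    by (rule integrable_dA_bounded[of _ 1]; auto intro!: measurable_dA simp: indicator_def power_le_one)+
qed

text \<open>By Parseval each coefficient is weighted by the integral of
  \<open>(1 - rho w) ^ n\<close> over the annulus. This is at most \<epsilon>, and by Bernoulli's
  inequality at least \<epsilon> / 2 as long as n * \<epsilon> is at most 1/2.\<close>

lemma annulus_poly_integral:
  shows "integrable dA (\<lambda>w. ann (rho w) * (cmod (poly p w))\<^sup>2)"
    and "(LINT w|dA. ann (rho w) * (cmod (poly p w))\<^sup>2) \<le> \<epsilon> * poly_sq p"
    and "degree p * \<epsilon> \<le> 1 / 2 \<Longrightarrow> \<epsilon> / 2 * poly_sq p \<le> (LINT w|dA. ann (rho w) * (cmod (poly p w))\<^sup>2)"
proof -
  note P = parseval_finite[of ann "coeff p" "Suc (degree p)", OF _ annulus_integrable(1), folded poly_eq_sum[OF lessI]]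
  show "integrable dA (\<lambda>w. ann (rho w) * (cmod (poly p w))\<^sup>2)" by (rule P(1)) measurable
  have eq: "(LINT w|dA. ann (rho w) * (cmod (poly p w))\<^sup>2)
      = (\<Sum>n<Suc (degree p). (cmod (coeff p n))\<^sup>2 * (LINT w|dA. ann (rho w) * cmod w ^ (2 * n)))"
    by (rule P(2)) measurable
  have up: "(LINT w|dA. ann (rho w) * cmod w ^ (2 * n)) \<le> \<epsilon>" for n
  proof -
    have "(LINT w|dA. ann (rho w) * cmod w ^ (2 * n)) \<le> (LINT w|dA. ann (rho w))"
      by (intro integral_mono annulus_integrable) (auto simp: indicator_def power_le_one)
    then show ?thesis by (simp only: annulus_integrable(2))
  qed
  show "(LINT w|dA. ann (rho w) * (cmod (poly p w))\<^sup>2) \<le> \<epsilon> * poly_sq p"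
    unfolding eq poly_sq_eq[OF lessI] sum_distrib_left
  proof (rule sum_mono)
    fix n
    show "(cmod (coeff p n))\<^sup>2 * (LINT w|dA. ann (rho w) * cmod w ^ (2 * n)) \<le> \<epsilon> * (cmod (coeff p n))\<^sup>2"
      using mult_left_mono[OF up[of n], of "(cmod (coeff p n))\<^sup>2"] by (simp only: zero_le_power2 mult.commute simp_thms)
  qed
  assume d: "degree p * \<epsilon> \<le> 1 / 2"
  have lo: "\<epsilon> / 2 \<le> (LINT w|dA. ann (rho w) * cmod w ^ (2 * n))" if n: "n < Suc (degree p)" for n
  proof -
    have "(LINT w|dA. ann (rho w) * (1 / 2)) \<le> (LINT w|dA. ann (rho w) * cmod w ^ (2 * n))"
    proof (intro integral_mono annulus_integrable integrable_mult_left)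
      fix w
      show "ann (rho w) * (1 / 2) \<le> ann (rho w) * cmod w ^ (2 * n)"
      proof (cases "rho w \<in> {0<..\<epsilon>}")
        case True
        have "n * rho w \<le> degree p * \<epsilon>" using n True by (intro mult_mono) auto
        moreover have "1 - real n * rho w \<le> (1 - rho w) ^ n"
          using Bernoulli_inequality[of "- rho w" n] True \<epsilon> by (auto simp only: mult_minus_right diff_conv_add_uminus[symmetric] greaterThanAtMost_iff)
        ultimately have "1 / 2 \<le> (1 - rho w) ^ n" using d by linarith
        also have "(1 - rho w) ^ n = cmod w ^ (2 * n)" by (simp add: power_mult)
        finally show ?thesis using True by simp
      qed simp
    qed
    then show ?thesis by (simp only: integral_mult_left_zero annulus_integrable(2))
  qed
  show "\<epsilon> / 2 * poly_sq p \<le> (LINT w|dA. ann (rho w) * (cmod (poly p w))\<^sup>2)"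
    unfolding eq poly_sq_eq[OF lessI] sum_distrib_left
  proof (rule sum_mono)
    fix n assume "n \<in> {..<Suc (degree p)}"
    then have "(cmod (coeff p n))\<^sup>2 * (\<epsilon> / 2) \<le> (cmod (coeff p n))\<^sup>2 * (LINT w|dA. ann (rho w) * cmod w ^ (2 * n))"
      by (intro mult_left_mono lo) auto
    then show "\<epsilon> / 2 * (cmod (coeff p n))\<^sup>2 \<le> (cmod (coeff p n))\<^sup>2 * (LINT w|dA. ann (rho w) * cmod w ^ (2 * n))"
      by (simp only: mult.commute)
  qed
qed

end

text \<open>The Paley--Zygmund argument: comparable second and fourth moments force a large level set.\<close>

lemma lacunary_level_set:
  assumes N: "N \<ge> 1"
  defines "\<epsilon> \<equiv> 1 / (2 * 4 ^ N)"
  shows "\<epsilon> / 32 \<le> measure dA {z \<in> unit_disc. rho z \<in> {0<..\<epsilon>} \<and> cmod (poly (lacunary N) z) > sqrt N / 2}"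
proof -
  have \<epsilon>: "0 < \<epsilon>" "\<epsilon> < 1" by (auto simp: \<epsilon>_def field_simps intro: less_le_trans[of _ 2])
  let ?F = "lacunary N" and ?i = "\<lambda>w. indicator {0<..\<epsilon>} (rho w) :: real"
  define X where "X = {z \<in> unit_disc. rho z \<in> {0<..\<epsilon>} \<and> cmod (poly (lacunary N) z) > sqrt N / 2}"
  note I = annulus_poly_integral[OF \<epsilon>]
  \<comment> \<open>The width \<epsilon> is chosen for this bound, which gives the lower estimate of
    the second moment; the fourth moment enters only through its upper estimate.\<close>
  have d: "real (degree ?F) * \<epsilon> \<le> 1 / 2"
  proof -
    have "real (2 * degree ?F) < real (4 ^ N)"
      using degree_lacunary[of N] by (simp only: of_nat_less_iff)
    moreover have "real (2 * degree ?F) = 2 * real (degree ?F)" "real (4 ^ N) = 4 ^ N" by simp_all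
    ultimately have "real (degree ?F) \<le> 4 ^ N" by linarith
    then show ?thesis unfolding \<epsilon>_def by (simp only: times_divide_eq_right mult_1_right) (simp add: divide_le_eq del: of_nat_le_iff)
  qed
  have "poly ?F \<in> borel_measurable borel"
    by (intro borel_measurable_continuous_onI continuous_intros)
  then have [measurable]: "poly ?F \<in> borel_measurable dA" by (rule measurable_dA)
  have Xs: "X \<in> sets dA"
  proof -
    have "X = {z \<in> unit_disc. rho z \<in> {0<..\<epsilon>}} \<inter> {z \<in> space dA. cmod (poly ?F z) > sqrt N / 2}"
      by (auto simp: X_def)
    also have "\<dots> \<in> sets dA" by (intro sets.Int sets_dA_rho) measurable
    finally show ?thesis .
  qed
  have Xi: "integrable dA (indicator X :: complex \<Rightarrow> real)"
    by (rule integrable_real_indicator[OF Xs]) (simp add: dA.emeasure_eq_measure)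
  have XS: "X \<inter> space dA = X" by (auto simp: X_def)
  have p4: "(cmod (poly (?F ^ 2) w))\<^sup>2 = cmod (poly ?F w) ^ 4" for w
    by (simp add: norm_power flip: power_mult)
  \<comment> \<open>Off \<open>X\<close> the squared modulus is at most N/4; on \<open>X\<close> it
    is at most its square over 16 * N plus 4 * N. The three contributions are \<epsilon> * N / 4,
    \<epsilon> * N / 8 and \<open>4 * real N * measure dA X\<close>, against \<epsilon> * N / 2 on
    the left; this leaves the proportion 1/32.\<close>
  have "\<epsilon> / 2 * N \<le> (LINT w|dA. ?i w * (cmod (poly ?F w))\<^sup>2)"
    using I(3)[OF d] by (simp add: poly_sq_lacunary)
  also have "\<dots> \<le> (LINT w|dA. (real N / 4) * ?i w + (1 / (16 * real N)) * (?i w * (cmod (poly (?F ^ 2) w))\<^sup>2) + 4 * real N * indicator X w)"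
  proof (rule integral_mono)
    show "integrable dA (\<lambda>w. (real N / 4) * ?i w + (1 / (16 * real N)) * (?i w * (cmod (poly (?F ^ 2) w))\<^sup>2) + 4 * real N * indicator X w)"
      by (intro Bochner_Integration.integrable_add integrable_mult_right annulus_integrable \<epsilon> I(1) Xi)
    fix w assume w: "w \<in> space dA"
    show "?i w * (cmod (poly ?F w))\<^sup>2 \<le> (real N / 4) * ?i w + (1 / (16 * real N)) * (?i w * (cmod (poly (?F ^ 2) w))\<^sup>2) + 4 * real N * indicator X w"
    proof (cases "rho w \<in> {0<..\<epsilon>}")
      case True
      show ?thesis
      proof (cases "w \<in> X")
        case False
        then have "cmod (poly ?F w) \<le> sqrt N / 2" using True w by (auto simp: X_def)
        then have "(cmod (poly ?F w))\<^sup>2 \<le> (sqrt N / 2)\<^sup>2" by (intro power_mono) auto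
        then show ?thesis using True False by (simp add: power_divide add_increasing2)
      next
        case X: True
        define y where "y = (cmod (poly ?F w))\<^sup>2"
        have "0 \<le> (y / (4 * sqrt N) - 2 * sqrt N)\<^sup>2" by simp
        then have "y \<le> y\<^sup>2 / (16 * real N) + 4 * real N"
          using N by (simp add: power2_diff power_divide power_mult_distrib)
        moreover have "y\<^sup>2 = cmod (poly ?F w) ^ 4" by (simp add: y_def flip: power_mult)
        ultimately show ?thesis using True X unfolding p4 by (simp add: y_def)
      qed
    qed simp
  qed (intro I(1))
  also have "\<dots> = real N / 4 * \<epsilon> + 1 / (16 * real N) * (LINT w|dA. ?i w * (cmod (poly (?F ^ 2) w))\<^sup>2) + 4 * real N * measure dA X"
    using annulus_integrable[OF \<epsilon>] I(1)[of "?F ^ 2"] Xi XS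
    by (simp add: Bochner_Integration.integral_add integrable_mult_right)
  also have "\<dots> \<le> real N / 4 * \<epsilon> + 1 / (16 * real N) * (\<epsilon> * (2 * (real N)\<^sup>2)) + 4 * real N * measure dA X"
    using \<epsilon> by (intro add_mono mult_left_mono order_trans[OF I(2)] poly_sq_lacunary_square) auto
  also have "1 / (16 * real N) * (\<epsilon> * (2 * (real N)\<^sup>2)) = real N * \<epsilon> / 8"
    using N by (simp add: power2_eq_square)
  finally have "real N * \<epsilon> / 8 \<le> 4 * real N * measure dA X" by (simp add: algebra_simps)
  then have "\<epsilon> / 32 \<le> measure dA X" using N by (simp add: field_simps)
  then show ?thesis by (simp add: X_def)
qed

section \<open>Preimages of lacunary polynomials under the kernel integral\<close>

lemma integrable_block:
  assumes b: "b > -1" and [measurable]: "J \<in> sets borel"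
  shows "integrable dA (\<lambda>w. of_real (indicator J (rho w) * rho w powr b) * w ^ m)"
    and "integrable dA (\<lambda>w. indicator J (rho w) * rho w powr b * cmod w ^ k)"
proof -
  show "integrable dA (\<lambda>w. of_real (indicator J (rho w) * rho w powr b) * w ^ m)"
  proof (rule Bochner_Integration.integrable_bound[OF integrable_rho_powr[OF b]])
    show "(\<lambda>w. of_real (indicator J (rho w) * rho w powr b) * w ^ m) \<in> borel_measurable dA"
      by (rule measurable_dA) measurable
    show "AE w in dA. norm (of_real (indicator J (rho w) * rho w powr b) * w ^ m) \<le> norm (rho w powr b)"
      by (intro AE_I2) (auto simp: norm_mult norm_power indicator_def intro!: mult_left_le power_le_one)
  qed
  show "integrable dA (\<lambda>w. indicator J (rho w) * rho w powr b * cmod w ^ k)"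
  proof (rule Bochner_Integration.integrable_bound[OF integrable_rho_powr[OF b]])
    show "(\<lambda>w. indicator J (rho w) * rho w powr b * cmod w ^ k) \<in> borel_measurable dA"
      by (rule measurable_dA) measurable
    show "AE w in dA. norm (indicator J (rho w) * rho w powr b * cmod w ^ k) \<le> norm (rho w powr b)"
      by (intro AE_I2) (auto simp: indicator_def intro!: mult_left_le power_le_one)
  qed
qed

text \<open>A radial multiple of \<open>w ^ m\<close> is orthogonal to all other monomials, so the
  power series of its kernel integral has a single term.\<close>

lemma cauchy_int_block:
  assumes c: "c > 0" and b: "b > -1" and J [measurable]: "J \<in> sets borel" and z: "cmod z < 1"
  shows "cauchy_int c (\<lambda>w. of_real (indicator J (rho w) * rho w powr b) * w ^ m) z
    = of_real (kernel_coeff c m * (LINT w|dA. indicator J (rho w) * rho w powr b * cmod w ^ (2 * m))) * z ^ m"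
proof -
  let ?g = "\<lambda>w. of_real (indicator J (rho w) * rho w powr b) * w ^ m :: complex"
  let ?I = "LINT w|dA. indicator J (rho w) * rho w powr b * cmod w ^ (2 * m)"
  have X: "(LINT w|dA. ?g w * cnj w ^ n) = (if n = m then of_real ?I else 0)" for n
  proof (cases "n = m")
    case True
    have "?g w * cnj w ^ m = of_real (indicator J (rho w) * rho w powr b * cmod w ^ (2 * m))" for w
      by (simp add: mult.assoc power_mult flip: power_mult_distrib complex_norm_square)
    then have "(LINT w|dA. ?g w * cnj w ^ m) = of_real ?I"
      by (simp only: integral_complex_of_real)
    then show ?thesis using True by simp
  next
    case False
    then show ?thesis
      using monomials_orthogonal[of "\<lambda>t. indicator J t * t powr b" m n] by (simp add: mult.assoc)
  qed
  have "(\<lambda>n. if n = m then of_real (kernel_coeff c m * ?I) * z ^ m else 0) sums (of_real (kernel_coeff c m * ?I) * z ^ m)"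
    by (rule sums_single)
  moreover have "(\<lambda>n. of_real (kernel_coeff c n) * (LINT w|dA. ?g w * cnj w ^ n) * z ^ n) sums cauchy_int c ?g z"
    by (intro cauchy_int_sums integrable_block b J z c)
  then have "(\<lambda>n. if n = m then of_real (kernel_coeff c m * ?I) * z ^ m else 0) sums cauchy_int c ?g z"
    unfolding X by (rule sums_cong[THEN iffD1, rotated]) auto
  ultimately show ?thesis by (rule sums_unique2[symmetric])
qed

text \<open>On this annulus \<open>rho w\<close> lies between 1/(4n) and 1/(2n): its power b has
  order n to the power -b, Bernoulli gives \<open>cmod w ^ (2 * n) \<ge> 1/2\<close>, and the area
  is 1/(4n). The last two produce the factor 1/8.\<close>

lemma block_integral_lower_bound:
  fixes k :: nat
  assumes b: "b > -1"
  defines "n \<equiv> (4 :: nat) ^ k" and "x \<equiv> (1/4) ^ k / 4 :: real"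
  shows "min ((1/4) powr b) ((1/2) powr b) / 8 * real n powr (- b - 1)
    \<le> (LINT w|dA. indicator {x<..2 * x} (rho w) * rho w powr b * cmod w ^ (2 * n))"
proof -
  let ?J = "{x<..2 * x}" and ?m = "min ((1/4) powr b) ((1/2) powr b)"
  have n: "real n > 0" "x = 1 / (4 * real n)" by (simp_all add: n_def x_def power_one_over field_simps)
  have x: "0 < x" "2 * x \<le> 1" using power_le_one[of "1/4 :: real" k] by (auto simp: x_def)
  have meas: "measure dA {w \<in> unit_disc. rho w \<in> ?J} = x"
    using emeasure_dA_rho_Ioc[of x "2 * x"] x by (simp add: measure_def)
  have "?m / 8 * real n powr (- b - 1) = (?m * real n powr (- b) / 2) * x"
    using n by (simp add: powr_diff)
  also have "\<dots> = (LINT w|dA. (?m * real n powr (- b) / 2) * indicator {w \<in> unit_disc. rho w \<in> ?J} w)"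
  proof -
    have "{w \<in> unit_disc. rho w \<in> ?J} \<inter> space dA = {w \<in> unit_disc. rho w \<in> ?J}" by auto
    then have "(LINT w|dA. indicator {w \<in> unit_disc. rho w \<in> ?J} w) = x" using meas by simp
    then show ?thesis by (simp only: integral_mult_right_zero)
  qed
  also have "\<dots> \<le> (LINT w|dA. indicator ?J (rho w) * rho w powr b * cmod w ^ (2 * n))"
  proof (rule integral_mono)
    have "{w \<in> unit_disc. rho w \<in> ?J} \<in> sets dA" by (rule sets_dA_rho) simp
    then show "integrable dA (\<lambda>w. (?m * real n powr (- b) / 2) * indicator {w \<in> unit_disc. rho w \<in> ?J} w)"
      by (intro integrable_mult_right integrable_real_indicator) (simp_all add: dA.emeasure_eq_measure)
    show "integrable dA (\<lambda>w. indicator ?J (rho w) * rho w powr b * cmod w ^ (2 * n))"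
      by (rule integrable_block(2)[OF b]) simp
    fix w assume w: "w \<in> space dA"
    show "(?m * real n powr (- b) / 2) * indicator {w \<in> unit_disc. rho w \<in> ?J} w
      \<le> indicator ?J (rho w) * rho w powr b * cmod w ^ (2 * n)"
    proof (cases "rho w \<in> ?J")
      case True
      have "?m * real n powr (- b) = min (x powr b) ((2 * x) powr b)"
      proof -
        have i: "inverse (real n) powr b = real n powr (- b)"
          by (simp only: inverse_powr powr_minus)
        have "x = (1/4) * inverse (real n)" "2 * x = (1/2) * inverse (real n)"
          unfolding n(2) by (simp_all add: inverse_eq_divide)
        then have "x powr b = (1/4) powr b * real n powr (- b)" "(2 * x) powr b = (1/2) powr b * real n powr (- b)"
          by (simp_all only: powr_mult i)
        then show ?thesis by (simp add: min_mult_distrib_right)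
      qed
      also have "\<dots> \<le> rho w powr b" using True x by (intro powr_between_ge) auto
      finally have 1: "?m * real n powr (- b) \<le> rho w powr b" .
      have "n * rho w \<le> n * (2 * x)" using True n by (intro mult_left_mono) auto
      also have "\<dots> = 1 / 2" using n by simp
      finally have "1 / 2 \<le> 1 - n * rho w" by simp
      also have "\<dots> \<le> (1 - rho w) ^ n"
        using Bernoulli_inequality[of "- rho w" n] rho_le_1[of w] by (simp only: mult_minus_right diff_conv_add_uminus[symmetric])
      also have "(1 - rho w) ^ n = cmod w ^ (2 * n)" by (simp add: power_mult)
      finally have "(?m * real n powr (- b)) * (1 / 2) \<le> rho w powr b * cmod w ^ (2 * n)"
        by (intro mult_mono 1) auto
      then show ?thesis using True w by simp
    qed simp
  qed
  finally show ?thesis .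
qed

text \<open>The \<open>k\<close>-th summand of \<open>f\<close> is \<open>w ^ (4 ^ k)\<close> on an annulus with \<open>rho w\<close> of order
  \<open>1 / 4 ^ k\<close>, normalised so that its image is exactly \<open>z ^ (4 ^ k)\<close>.\<close>

lemma lacunary_preimage:
  fixes N :: nat
  assumes s: "0 \<le> s" and c: "c > 1" and b: "c - 2 + s > -1"
  obtains M where "M \<ge> 0" and "\<And>N::nat. \<exists>f. f \<in> borel_measurable dA \<and>
    (\<forall>w. cmod w < 1 \<longrightarrow> cmod (f w) \<le> (if rho w > (1/4) ^ N / 4 then M * rho w powr (- s) else 0)) \<and>
    (\<forall>z. cmod z < 1 \<longrightarrow> cauchy_int c (\<lambda>w. f w * of_real (rho w powr (c - 2 + s))) z = poly (lacunary N) z)"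
proof -
  define b where "b = c - 2 + s"
  have b1: "b > -1" using b by (simp add: b_def)
  obtain \<delta> where \<delta>: "\<delta> > 0" "\<And>n. n \<ge> 1 \<Longrightarrow> \<delta> * real n powr (c - 1) \<le> kernel_coeff c n"
    using kernel_coeff_lower[of c] c by auto
  define \<eta> where "\<eta> = \<delta> * (min ((1/4) powr b) ((1/2) powr b) / 8)"
  have \<eta>: "\<eta> > 0" using \<delta> by (simp add: \<eta>_def)
  define x where "x k = ((1/4) ^ k / 4 :: real)" for k :: nat
  define J where "J k = {x k<..2 * x k}" for k
  define I where "I k = (LINT w|dA. indicator (J k) (rho w) * rho w powr b * cmod w ^ (2 * 4 ^ k))" for k
  define \<sigma> where "\<sigma> k = 1 / (kernel_coeff c (4 ^ k) * I k)" for k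
  \<comment> \<open>With n = \<open>4 ^ k\<close>, the kernel coefficient has lower order c - 1 in n
    and the block integral -b - 1; for b = c - 2 + s these add up to -s.\<close>
  have gI: "\<eta> * real (4 ^ k) powr (- s) \<le> kernel_coeff c (4 ^ k) * I k" for k
  proof -
    have "\<eta> * real (4 ^ k) powr (- s) = (\<delta> * real (4 ^ k) powr (c - 1)) * (min ((1/4) powr b) ((1/2) powr b) / 8 * real (4 ^ k) powr (- b - 1))"
    proof -
      have "real (4 ^ k) powr (- s) = real (4 ^ k) powr (c - 1) * real (4 ^ k) powr (- b - 1)"
        unfolding powr_add[symmetric] by (simp add: b_def)
      then show ?thesis unfolding \<eta>_def by (simp only: mult_ac)
    qed
    also have "\<dots> \<le> kernel_coeff c (4 ^ k) * I k"
      unfolding I_def J_def x_def using \<delta>(2)[of "4 ^ k"] block_integral_lower_bound[OF b1, of k] \<delta>(1) kernel_coeff_pos[of c "4 ^ k"] c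
      by (intro mult_mono) auto
    finally show ?thesis .
  qed
  have gIpos: "kernel_coeff c (4 ^ k) * I k > 0" for k
    by (rule less_le_trans[OF _ gI]) (use \<eta> in simp)
  have \<sigma>: "0 < \<sigma> k" "\<sigma> k \<le> real (4 ^ k) powr s / \<eta>" for k
  proof -
    show "0 < \<sigma> k" using gIpos by (simp add: \<sigma>_def)
    have "\<sigma> k \<le> 1 / (\<eta> * real (4 ^ k) powr (- s))"
      unfolding \<sigma>_def using gI[of k] \<eta> gIpos[of k] by (intro divide_left_mono) auto
    then show "\<sigma> k \<le> real (4 ^ k) powr s / \<eta>" by (simp add: powr_minus field_simps)
  qed
  show ?thesis
  proof (rule that[of "1 / \<eta>"])
    show "1 / \<eta> \<ge> 0" using \<eta> by simp
    fix N :: nat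
    define f where "f w = (\<Sum>k<N. of_real (\<sigma> k * indicator (J k) (rho w)) * w ^ (4 ^ k))" for w :: complex
    have Jm [measurable]: "J k \<in> sets borel" for k by (simp add: J_def)
    have fm: "f \<in> borel_measurable dA" unfolding f_def by (rule measurable_dA) measurable
    \<comment> \<open>The intervals \<open>J k\<close> are disjoint since \<open>x k\<close> shrinks
      by 4 while \<open>J k\<close> ends at \<open>2 * x k\<close>. So at most one summand is
      nonzero, and on \<open>J l\<close> the normalising factor, of order \<open>4 ^ l\<close> to
      the power s, is bounded by a multiple of \<open>rho w powr (- s)\<close> uniformly in
      N.\<close>
    have fle: "cmod (f w) \<le> (if rho w > (1/4) ^ N / 4 then 1 / \<eta> * rho w powr (- s) else 0)" if w: "cmod w < 1" for w
    proof (cases "\<exists>l<N. rho w \<in> J l")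
      case True
      then obtain l where l: "l < N" "rho w \<in> J l" by blast
      have uniq: "k = l" if "rho w \<in> J k" for k
      proof (rule ccontr)
        assume "k \<noteq> l"
        then consider "Suc k \<le> l" | "Suc l \<le> k" by linarith
        then show False
        proof cases
          case 1
          then have "(1/4 :: real) ^ l \<le> (1/4) ^ Suc k" by (intro power_decreasing) auto
          then have "x l \<le> x k / 4" by (simp add: x_def)
          then show False using l(2) that by (auto simp: J_def)
        next
          case 2
          then have "(1/4 :: real) ^ k \<le> (1/4) ^ Suc l" by (intro power_decreasing) auto
          then have "x k \<le> x l / 4" by (simp add: x_def)
          then show False using l(2) that by (auto simp: J_def)
        qed
      qed
      have "f w = (\<Sum>k<N. if k = l then of_real (\<sigma> l) * w ^ (4 ^ l) else 0)"
        unfolding f_def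
      proof (rule sum.cong[OF refl])
        fix k
        have "rho w \<notin> J k" if "k \<noteq> l" using uniq[of k] that by blast
        then show "of_real (\<sigma> k * indicator (J k) (rho w)) * w ^ (4 ^ k) = (if k = l then of_real (\<sigma> l) * w ^ (4 ^ l) else 0)"
          using l(2) by (cases "k = l") simp_all
      qed
      also have "\<dots> = of_real (\<sigma> l) * w ^ (4 ^ l)" using l(1) by simp
      finally have "cmod (f w) = \<sigma> l * cmod w ^ (4 ^ l)" using \<sigma>(1)[of l] by (simp add: norm_mult norm_power)
      also have "\<dots> \<le> \<sigma> l * 1" using w \<sigma>(1)[of l] by (intro mult_left_mono power_le_one) auto
      also have "\<dots> \<le> real (4 ^ l) powr s / \<eta>" using \<sigma>(2)[of l] by simp
      also have "\<dots> \<le> rho w powr (- s) / \<eta>"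
      proof (intro divide_right_mono)
        have r: "rho w > 0" using rho_pos[OF w] .
        have "rho w \<le> 1 / 4 ^ l" using l(2) by (auto simp: J_def x_def power_one_over intro: order_trans)
        then have "real (4 ^ l) \<le> 1 / rho w" using r by (simp add: field_simps)
        then have "real (4 ^ l) powr s \<le> (1 / rho w) powr s" using s by (intro powr_mono2) auto
        also have "\<dots> = rho w powr (- s)" by (simp add: powr_minus divide_inverse inverse_powr)
        finally show "real (4 ^ l) powr s \<le> rho w powr (- s)" .
      qed (use \<eta> in simp)
      finally have "cmod (f w) \<le> 1 / \<eta> * rho w powr (- s)" by simp
      moreover have "rho w > (1/4) ^ N / 4"
      proof -
        have "(1/4 :: real) ^ N \<le> (1/4) ^ l" using l(1) by (intro power_decreasing) auto
        then have "(1/4) ^ N / 4 \<le> x l" by (simp add: x_def)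
        then show ?thesis using l(2) by (auto simp only: J_def greaterThanAtMost_iff)
      qed
      ultimately show ?thesis by simp
    next
      case False
      then have "f w = 0" unfolding f_def by (intro sum.neutral) auto
      then show ?thesis using \<eta> by simp
    qed
    have "cauchy_int c (\<lambda>w. f w * of_real (rho w powr b)) z = poly (lacunary N) z" if z: "cmod z < 1" for z
    proof -
      let ?g = "\<lambda>k w. of_real (indicator (J k) (rho w) * rho w powr b) * w ^ (4 ^ k) :: complex"
      have "cauchy_int c (\<lambda>w. f w * of_real (rho w powr b)) z
          = (LINT w|dA. (\<Sum>k<N. of_real (\<sigma> k) * (?g k w * (1 - z * cnj w) powr (- of_real c))))"
        unfolding cauchy_int_def f_def sum_distrib_right
        by (intro Bochner_Integration.integral_cong sum.cong refl) (simp only: of_real_mult mult_ac)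
      also have "\<dots> = (\<Sum>k<N. LINT w|dA. of_real (\<sigma> k) * (?g k w * (1 - z * cnj w) powr (- of_real c)))"
        by (intro Bochner_Integration.integral_sum integrable_mult_right integrable_kernel_mult integrable_block b1 Jm z) (use c in simp)
      also have "\<dots> = (\<Sum>k<N. of_real (\<sigma> k) * cauchy_int c (?g k) z)"
        by (simp only: integral_mult_right_zero cauchy_int_def)
      also have "\<dots> = (\<Sum>k<N. z ^ (4 ^ k))"
      proof (rule sum.cong[OF refl])
        fix k
        have "of_real (\<sigma> k) * cauchy_int c (?g k) z = of_real (\<sigma> k * (kernel_coeff c (4 ^ k) * I k)) * z ^ (4 ^ k)"
          using c by (subst cauchy_int_block[OF _ b1 Jm z]) (simp_all add: I_def mult.assoc)
        also have "\<sigma> k * (kernel_coeff c (4 ^ k) * I k) = 1" using less_imp_neq[OF gIpos[of k]] by (simp add: \<sigma>_def)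
        finally show "of_real (\<sigma> k) * cauchy_int c (?g k) z = z ^ (4 ^ k)" by simp
      qed
      finally show ?thesis by (simp only: poly_lacunary)
    qed
    with fm fle show "\<exists>f. f \<in> borel_measurable dA \<and>
      (\<forall>w. cmod w < 1 \<longrightarrow> cmod (f w) \<le> (if rho w > (1/4) ^ N / 4 then 1 / \<eta> * rho w powr (- s) else 0)) \<and>
      (\<forall>z. cmod z < 1 \<longrightarrow> cauchy_int c (\<lambda>w. f w * of_real (rho w powr (c - 2 + s))) z = poly (lacunary N) z)"
      unfolding b_def by blast
  qed
qed

text \<open>The image of the test function is the weight times a lacunary polynomial, which exceeds
  \<open>sqrt N / 2\<close> on a fixed proportion of a thin annulus. The norm of the test function
  has order N to the power s < 1/2.\<close>

lemma not_T_bounded: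
  assumes s: "0 \<le> s" "s < 1 / 2" and c: "c > 1" and b: "c - 2 + s > -1" and a: "a < 0"
  shows "\<not> T_bounded a (c - 2 + s) c (1 / ereal s) (- 1 / a)"
proof
  define b where "b = c - 2 + s"
  assume "T_bounded a (c - 2 + s) c (1 / ereal s) (- 1 / a)"
  then obtain C where C: "\<forall>f\<in>Lp_space (1 / ereal s). (AE z in dA. integrable dA (\<lambda>w. T_kernel b c z w * f w)) \<and>
        weighted_int_op a (T_kernel b c) f \<in> borel_measurable dA \<and>
        weak_Lq_norm (- 1 / a) (weighted_int_op a (T_kernel b c) f) \<le> ennreal (C * Lp_norm (1 / ereal s) f)"
    unfolding T_bounded_def bounded_Lp_weak_Lq_def b_def by blast
  obtain M where M: "M \<ge> 0" and ex: "\<And>N::nat. \<exists>f. f \<in> borel_measurable dA \<and>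
    (\<forall>w. cmod w < 1 \<longrightarrow> cmod (f w) \<le> (if rho w > (1/4) ^ N / 4 then M * rho w powr (- s) else 0)) \<and>
    (\<forall>z. cmod z < 1 \<longrightarrow> cauchy_int c (\<lambda>w. f w * of_real (rho w powr (c - 2 + s))) z = poly (lacunary N) z)"
    using lacunary_preimage[OF s(1) c b] by blast
  show False
  proof (rule growth_contradiction)
    show "s < 1 / 2" by (rule s)
    show "(1/32) powr (- a) / 2 > 0" by simp
    show "\<bar>C\<bar> * M \<ge> 0" using M by simp
    fix N :: nat assume N: "N \<ge> 1"
    obtain f where f: "f \<in> borel_measurable dA"
      "\<And>w. cmod w < 1 \<Longrightarrow> cmod (f w) \<le> (if rho w > (1/4) ^ N / 4 then M * rho w powr (- s) else 0)"
      "\<And>z. cmod z < 1 \<Longrightarrow> cauchy_int c (\<lambda>w. f w * of_real (rho w powr b)) z = poly (lacunary N) z"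
      using ex[of N] unfolding b_def by blast
    have s1: "s < 1" using s by simp
    note W = weak_norm_bound_of_test_function[OF C s(1) s1 N M f(1,2)]
    define e where "e = (1 / (2 * 4 ^ N) :: real)"
    have e: "e > 0" by (simp add: e_def)
    let ?X = "{z \<in> unit_disc. rho z \<in> {0<..e} \<and> cmod (poly (lacunary N) z) > sqrt N / 2}"
    have "(sqrt N / 2) * (measure dA ?X / e) powr (- a) \<le> \<bar>C\<bar> * M * (4 * real N) powr s"
    proof (rule weak_norm_annulus_bound[OF a W(2) _ W(1) e])
      fix z assume z: "z \<in> ?X"
      have "e powr a * (sqrt N / 2) \<le> rho z powr a * (sqrt N / 2)"
        using z a by (intro mult_right_mono powr_mono2') auto
      also have "\<dots> < rho z powr a * cmod (poly (lacunary N) z)"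
        using z by (intro mult_strict_left_mono) auto
      also have "\<dots> = cmod (weighted_int_op a (T_kernel b c) f z)"
        unfolding weighted_int_op_def T_integral_eq_cauchy_int using z f(3)[of z] by (simp add: norm_mult)
      finally show "e powr a * (sqrt N / 2) < cmod (weighted_int_op a (T_kernel b c) f z)" .
    qed (use N M in auto)
    moreover have "(1/32) powr (- a) \<le> (measure dA ?X / e) powr (- a)"
    proof (rule powr_mono2)
      show "1 / 32 \<le> measure dA ?X / e"
        using lacunary_level_set[OF N, folded e_def] e by (simp add: pos_le_divide_eq)
    qed (use a in auto)
    then have "(sqrt N / 2) * (1/32) powr (- a) \<le> (sqrt N / 2) * (measure dA ?X / e) powr (- a)"
      by (intro mult_left_mono) auto
    ultimately have "(sqrt N / 2) * (1/32) powr (- a) \<le> \<bar>C\<bar> * M * (4 * real N) powr s" by linarith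
    then show "(1/32) powr (- a) / 2 * real N powr (1 / 2) \<le> \<bar>C\<bar> * M * (4 * real N) powr s"
      by (simp add: powr_half_sqrt mult_ac)
  qed
qed

theorem theorem5p1:
  fixes a b c :: real
  assumes "a > -1" and "b > -1"
    and "0 < c - a - b - 2" and "c - a - b - 2 < 1"
    and "0 \<le> 2 - c + b" and "2 - c + b < 1"
    and "a < 0" and "c > 1"
  shows "\<not> S_bounded a b c (1 / ereal (2 - c + b)) (- 1 / a)
    \<and> (0 \<le> 2 - c + b \<and> 2 - c + b < 1/2
        \<longrightarrow> \<not> T_bounded a b c (1 / ereal (2 - c + b)) (- 1 / a))
    \<and> (1/2 \<le> 2 - c + b \<and> 2 - c + b < 1
        \<longrightarrow> T_bounded a b c (1 / ereal (2 - c + b)) (- 1 / a))"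
proof -
  \<comment> \<open>In this notation the hypothesis \<open>0 < c - a - b - 2\<close> reads -a > s,
    the condition for summing over dyadic annuli.\<close>
  define s where "s = 2 - c + b"
  have b: "b = c - 2 + s" by (simp add: s_def)
  show ?thesis
    unfolding s_def[symmetric] unfolding b
    using not_S_bounded[of s c a] not_T_bounded[of s c a] T_bounded_of_half_le[of s c a] assms
    by (simp add: b)
qed

end
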